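(* In the single-sample semiparametric density model described in the context, suppose Assumptions 1 to 8 (written out in the context) hold, and let $\hat\tau=(\hat\theta,\hat h)$ be the penalized likelihood estimator. Then, as $n\to\infty$, $\lambda\to0$ and $n\lambda^{1/r}\to\infty$, $$\mathrm{SKL}(\tau_0,\hat\tau)=O_p\big(n^{-1}\lambda^{-1/r}+\lambda\big),$$ where $\mathrm{SKL}(\tau_0,\hat\tau)=\mu_{\tau_0}[\eta(\theta_0,h_0)-\eta(\hat\theta,\hat h)]+\mu_{\hat\tau}[\eta(\hat\theta,\hat h)-\eta(\theta_0,h_0)]$ is the symmetrized Kullback–Leibler distance between $f_{\tau_0}$ and $f_{\hat\tau}$.
   Context: Setting. $p\ge1$; $\mathcal X$ is a sample space (integrals are with respect to a reference measure $dx$); $\mathcal H$ is a real Hilbert space of functions with norm $\|\cdot\|$; $\mathcal Q=\mathbb R^p\times\mathcal H$. Write $\tau=(\theta,h)\in\mathcal Q$. $\eta:\mathcal Q\to L^2_0(\mathcal X)$ is a known map, with values written $\eta(x;\tau)=\eta(x;\theta,h)$, and $f_\tau(x)=e^{\eta(x;\tau)}/\int_{\mathcal X}e^{\eta(t;\tau)}dt$. The true parameter is $\tau_0=(\theta_0,h_0)$; $L^2_{\tau_0}(\mathcal X)$ is the space of functions with finite second moment under $f_{\tau_0}$ and $L^2_0(\mathcal X)=L^2_{\tau_0}(\mathcal X)\ominus\{1\}$ (constants removed). $X_1,\dots,X_n$ are iid from $f_{\tau_0}$; $\lambda>0$ is a smoothing parameter. $D_\theta,D_h$ are Fréchet partial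 derivatives. Put $\mu_\tau(\varphi)=\int\varphi f_\tau$, $V_\tau(\varphi_1,\varphi_2)=\mu_\tau(\varphi_1\varphi_2)-\mu_\tau(\varphi_1)\mu_\tau(\varphi_2)$, $V_\tau(\varphi)=V_\tau(\varphi,\varphi)$. $O_p$ statements are along arbitrary deterministic sequences $\lambda=\lambda_n$ with the stated limits. Criteria. $\mathfrak L_n(\theta,h)=-\frac1n\sum_{i=1}^n\eta(X_i;\theta,h)+\log\int_{\mathcal X}e^{\eta(x;\theta,h)}dx$ and $\mathfrak L_{n,\lambda}=\mathfrak L_n+\frac\lambda2J(h)$. It is assumed that $\mathfrak L_n$ is convex and that $\mathfrak L_{n,\lambda}$ has a unique local minimum $\hat\tau=(\hat\theta,\hat h)$ in $\mathcal N_{\theta_0}\times\mathcal N_{h_0}$, which is the unique solution there of $D_\theta\mathfrak L_{n,\lambda}=0$, $D_h\mathfrak L_{n,\lambda}=0$. It is also assumed that the minimizer $\tilde\tau$ of the quadratic criterion $$\tilde{\mathfrak L}_{n,\lambda}(\theta,h)=-\tfrac1n\sum_{i}[D_\theta\eta(X_i;\tau_0)\theta+D_h\eta(X_i;\tau_0)h]+\mu_{\tau_0}[D_\theta\eta(\tau_0)\theta+D_h\eta(\tau_0)h]+\tfrac12V_{\tau_0}[D_\theta\eta(\tau_0)(\theta-\theta_0)+D_h\eta(\tau_0)(h-h_0)]+\tfrac\lambda2J(h)$$ lies in $\mathcal N_{\theta_0}\times\mathcal N_{h_0}$. Assumption 1. $J$ is a square seminorm on $\mathcal H$ with finite-dimensional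 null space and semi-inner product $J(\cdot,\cdot)$; $J(h_0)<\infty$. Assumption 2. There are bounded linear operators $L_\theta:\mathbb R^p\to L^2_0(\mathcal X)$, $L_h:\mathcal H\to L^2_0(\mathcal X)$ with zero null spaces such that (i) there are positive constants $M_1,M_2$ (possibly depending on $\lambda$) with $M_1\|g\|^2\le V_{\tau_0}(L_hg)+\lambda J(g)\le M_2\|g\|^2$ for all $g\in\mathcal H$; (ii) there is $c_\delta>0$ with $V_{\tau_0}(L_\theta\zeta-L_hg)>c_\delta$ for all $\zeta\in\mathbb R^p$ with $\|\zeta\|_{l^2}=1$ and all $g\in\mathcal H$. The norm on $\mathcal Q$ is $\|(\zeta,g)\|_{\mathcal Q}^2=V_{\tau_0}(L_\theta\zeta+L_hg)+\lambda J(g)$. There are neighborhoods $\mathcal N_{\theta_0}\subset\mathbb R^p$ of $\theta_0$ and $\mathcal N_{h_0}\subset\mathcal H$ of $h_0$ for which Assumptions 3–6 hold. Assumption 3. $\eta$ is one-to-one and three times continuously Fréchet differentiable on $\mathcal N_{\theta_0}\times\mathcal N_{h_0}$, and $\tau_0$ is the unique root there of $E[D_\theta\mathfrak L_n(\theta,h)]=0$, $E[D_h\mathfrak L_n(\theta,h)]=0$. Assumption 4. For all $(\theta_*,h_* )\in\mathcal N_{\theta_0}\times\mathcal N_{h_0}$, $D_\theta\eta(\theta_*,h_* ):\mathbb R^p\to L_0^2(\mathcal X)$ and $D_h\eta(\theta_*,h_* ):\mathcal H\to L_0^2(\mathcal X)$ are bounded linear, and there are constants $C_1,C_2>0$ with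 $C_1V_{\tau_0}(L_\theta\zeta+L_hg)\le V_{\tau_0}(D_\theta\eta(\theta_*,h_* )\zeta+D_h\eta(\theta_*,h_* )g)\le C_2V_{\tau_0}(L_\theta\zeta+L_hg)$ for all $(\zeta,g)\in\mathcal Q$. Assumption 5. There is a positive constant $C_d<2C_1$ such that for all $(\theta_1,h_1),(\theta_2,h_2)$ and $(\zeta,g)$ in $\mathcal N_{\theta_0}\times\mathcal N_{h_0}$, $V_{\tau_0}[(D_\theta\eta(\theta_1,h_1)-D_\theta\eta(\theta_2,h_2))\zeta+(D_h\eta(\theta_1,h_1)-D_h\eta(\theta_2,h_2))g]\le C_dV_{\tau_0}(L_\theta\zeta+L_hg)$. Assumption 6. $\mathcal N_{\theta_0}\times\mathcal N_{h_0}$ is convex and contains $\hat\tau$, and there are $C_3,C_4>0$ with $C_3V_{\tau_0}(f)\le V_\tau(f)\le C_4V_{\tau_0}(f)$ for all $\tau\in\mathcal N_{\theta_0}\times\mathcal N_{h_0}$ and $f\in L_0^2(\mathcal X)$. Assumption 7. The quadratic functional $g\mapsto V_{\tau_0}(L_hg)$ is completely continuous with respect to $J$ (for every $\epsilon>0$ there are finitely many continuous linear functionals $\ell_1,\dots,\ell_k$ such that $\ell_1(g)=\dots=\ell_k(g)=0$ implies $V_{\tau_0}(L_hg)\le\epsilon J(g)$). This yields eigenfunctions $\phi_\nu$ and eigenvalues $0\le\rho_\nu\to\infty$, $\nu=1,2,\dots$, with $V_{\tau_0}(L_h\phi_\nu,L_h\phi_\mu)=\delta_{\nu\mu}$, $J(\phi_\nu,\phi_\mu)=\rho_\nu\delta_{\nu\mu}$.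 Assumption 8. $\rho_\nu=\kappa_\nu\nu^r$ with $r>1$ and $\kappa_\nu\in(\beta_1,\beta_2)\subset(0,\infty)$. *)

theory Defs
  imports "HOL-Probability.Probability"
begin

text \<open>
  Throughout, \<open>M\<close> is the reference measure on the sample space, a parameter is a pair
  \<open>\<tau> = (\<theta>, h)\<close> in \<open>real ^ 'p \<times> 'h\<close> with \<open>'h\<close> a real Hilbert space, and \<open>\<eta> \<tau> x\<close> stands for
  \<open>\<eta>(x; \<tau>)\<close>. Elements of the \<open>L\<^sup>2\<close> spaces are represented by functions, and equality in
  \<open>L\<^sup>2\<close> is equality almost everywhere with respect to \<open>M\<close>; all densities below are positive, so
  \<open>M\<close> and the distributions of the model have the same null sets.
\<close>

type_synonym ('p, 'h) param = "(real ^ 'p) \<times> 'h"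

type_synonym ('p, 'h, 'x) model = "('p, 'h) param \<Rightarrow> 'x \<Rightarrow> real"

definition pdf_of :: "'x measure \<Rightarrow> ('p::finite, 'h, 'x) model \<Rightarrow> ('p, 'h) param \<Rightarrow> 'x \<Rightarrow> real" where
  "pdf_of M \<eta> \<tau> x = exp (\<eta> \<tau> x) / (\<integral>t. exp (\<eta> \<tau> t) \<partial>M)"

definition mean_of ::
  "'x measure \<Rightarrow> ('p::finite, 'h, 'x) model \<Rightarrow> ('p, 'h) param \<Rightarrow> ('x \<Rightarrow> real) \<Rightarrow> real" where
  "mean_of M \<eta> \<tau> \<phi> = (\<integral>x. \<phi> x * pdf_of M \<eta> \<tau> x \<partial>M)"

definition cov_of ::
  "'x measure \<Rightarrow> ('p::finite, 'h, 'x) model \<Rightarrow> ('p, 'h) param \<Rightarrow>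
    ('x \<Rightarrow> real) \<Rightarrow> ('x \<Rightarrow> real) \<Rightarrow> real" where
  "cov_of M \<eta> \<tau> \<phi> \<psi> =
     mean_of M \<eta> \<tau> (\<lambda>x. \<phi> x * \<psi> x) - mean_of M \<eta> \<tau> \<phi> * mean_of M \<eta> \<tau> \<psi>"

definition var_of ::
  "'x measure \<Rightarrow> ('p::finite, 'h, 'x) model \<Rightarrow> ('p, 'h) param \<Rightarrow> ('x \<Rightarrow> real) \<Rightarrow> real" where
  "var_of M \<eta> \<tau> \<phi> = cov_of M \<eta> \<tau> \<phi> \<phi>"

definition L2_of ::
  "'x measure \<Rightarrow> ('p::finite, 'h, 'x) model \<Rightarrow> ('p, 'h) param \<Rightarrow> ('x \<Rightarrow> real) set" where
  "L2_of M \<eta> \<tau> =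
     {f \<in> borel_measurable M. integrable M (\<lambda>x. (f x)\<^sup>2 * pdf_of M \<eta> \<tau> x)}"

definition L20_of ::
  "'x measure \<Rightarrow> ('p::finite, 'h, 'x) model \<Rightarrow> ('p, 'h) param \<Rightarrow> ('x \<Rightarrow> real) set" where
  "L20_of M \<eta> \<tau> = {f \<in> L2_of M \<eta> \<tau>. mean_of M \<eta> \<tau> f = 0}"

definition L2norm_of ::
  "'x measure \<Rightarrow> ('p::finite, 'h, 'x) model \<Rightarrow> ('p, 'h) param \<Rightarrow> ('x \<Rightarrow> real) \<Rightarrow> real" where
  "L2norm_of M \<eta> \<tau> f = sqrt (mean_of M \<eta> \<tau> (\<lambda>x. (f x)\<^sup>2))"

definition SKL :: "'x measure \<Rightarrow> ('p::finite, 'h, 'x) model \<Rightarrow>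
    ('p, 'h) param \<Rightarrow> ('p, 'h) param \<Rightarrow> real" where
  "SKL M \<eta> \<tau> \<tau>' = mean_of M \<eta> \<tau> (\<lambda>x. \<eta> \<tau> x - \<eta> \<tau>' x) + mean_of M \<eta> \<tau>' (\<lambda>x. \<eta> \<tau>' x - \<eta> \<tau> x)"

definition bounded_linear_L20 ::
  "'x measure \<Rightarrow> ('p::finite, 'h, 'x) model \<Rightarrow> ('p, 'h) param \<Rightarrow>
    ('v::real_normed_vector \<Rightarrow> 'x \<Rightarrow> real) \<Rightarrow> bool" where
  "bounded_linear_L20 M \<eta> \<tau>0 T \<longleftrightarrow>
     (\<forall>v. T v \<in> L20_of M \<eta> \<tau>0) \<and>
     (\<forall>a b u v. AE x in M. T (a *\<^sub>R u + b *\<^sub>R v) x = a * T u x + b * T v x) \<and>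
     (\<exists>B. \<forall>v. L2norm_of M \<eta> \<tau>0 (T v) \<le> B * norm v)"

definition bounded_multilinear_L20 ::
  "'x measure \<Rightarrow> ('p::finite, 'h, 'x) model \<Rightarrow> ('p, 'h) param \<Rightarrow> nat \<Rightarrow>
    ('v::real_normed_vector list \<Rightarrow> 'x \<Rightarrow> real) \<Rightarrow> bool" where
  "bounded_multilinear_L20 M \<eta> \<tau>0 k T \<longleftrightarrow>
     (\<forall>vs. length vs = k \<longrightarrow> T vs \<in> L20_of M \<eta> \<tau>0) \<and>
     (\<forall>vs i a b u v. length vs = k \<longrightarrow> i < k \<longrightarrow>
        (AE x in M. T (vs[i := a *\<^sub>R u + b *\<^sub>R v]) x = a * T (vs[i := u]) x + b * T (vs[i := v]) x)) \<and>
     (\<exists>B. \<forall>vs. length vs = k \<longrightarrow> L2norm_of M \<eta> \<tau>0 (T vs) \<le> B * prod_list (map norm vs))"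

text \<open>
  \<open>D k \<tau>\<close> is the \<open>k\<close>-th Frechet derivative at \<open>\<tau>\<close> of \<open>\<eta>\<close> as a map into \<open>L\<^sup>2\<^sub>0\<close>, a bounded
  \<open>k\<close>-linear map whose arguments are collected in a list; \<open>D (Suc k)\<close> is the derivative of
  \<open>D k\<close> in the operator norm of bounded \<open>k\<close>-linear maps. The product norm on the parameter space
  is used.
\<close>

definition C_k_Frechet_L20 ::
  "'x measure \<Rightarrow> ('p::finite, 'h::real_inner, 'x) model \<Rightarrow> ('p, 'h) param \<Rightarrow> nat \<Rightarrow>
    ('p, 'h) param set \<Rightarrow> bool" where
  "C_k_Frechet_L20 M \<eta> \<tau>0 K U \<longleftrightarrow> open U \<and>
     (\<exists>D :: nat \<Rightarrow> ('p, 'h) param \<Rightarrow> ('p, 'h) param list \<Rightarrow> 'x \<Rightarrow> real.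
        (\<forall>\<tau>\<in>U. D 0 \<tau> [] = \<eta> \<tau>) \<and>
        (\<forall>\<tau>\<in>U. \<forall>k\<le>K. bounded_multilinear_L20 M \<eta> \<tau>0 k (D k \<tau>)) \<and>
        (\<forall>\<tau>\<in>U. \<forall>k<K. \<forall>\<epsilon>>0. \<forall>\<^sub>F \<tau>' in at \<tau>. \<forall>vs. length vs = k \<longrightarrow>
           L2norm_of M \<eta> \<tau>0 (\<lambda>x. D k \<tau>' vs x - D k \<tau> vs x - D (Suc k) \<tau> ((\<tau>' - \<tau>) # vs) x)
             \<le> \<epsilon> * norm (\<tau>' - \<tau>) * prod_list (map norm vs)) \<and>
        (\<forall>\<tau>\<in>U. \<forall>\<epsilon>>0. \<forall>\<^sub>F \<tau>' in at \<tau>. \<forall>vs. length vs = K \<longrightarrow>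
           L2norm_of M \<eta> \<tau>0 (\<lambda>x. D K \<tau>' vs x - D K \<tau> vs x) \<le> \<epsilon> * prod_list (map norm vs)))"

text \<open>
  The partial derivatives have to be evaluated at the observations, so they are those of
  \<open>\<tau> \<mapsto> \<eta>(x; \<tau>)\<close> for fixed \<open>x\<close>. If \<open>\<eta>\<close> is differentiable both as a map into \<open>L\<^sup>2\<^sub>0\<close> and for
  almost every fixed \<open>x\<close>, the two derivatives agree almost everywhere, since a subsequence of
  the difference quotients converging in \<open>L\<^sup>2\<close> converges almost everywhere.
\<close>

definition D\<theta> :: "('p::finite, 'h::real_inner, 'x) model \<Rightarrow> ('p, 'h) param \<Rightarrow> real ^ 'p \<Rightarrow> 'x \<Rightarrow> real" where
  "D\<theta> \<eta> \<tau> \<zeta> x = frechet_derivative (\<lambda>\<theta>. \<eta> (\<theta>, snd \<tau>) x) (at (fst \<tau>)) \<zeta>"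

definition Dh :: "('p::finite, 'h::real_inner, 'x) model \<Rightarrow> ('p, 'h) param \<Rightarrow> 'h \<Rightarrow> 'x \<Rightarrow> real" where
  "Dh \<eta> \<tau> g x = frechet_derivative (\<lambda>h. \<eta> (fst \<tau>, h) x) (at (snd \<tau>)) g"

text \<open>A sample of size \<open>n\<close> is \<open>xs 0, \<dots>, xs (n - 1)\<close>; \<open>J\<close> is the semi-inner product.\<close>

definition crit :: "'x measure \<Rightarrow> ('p::finite, 'h, 'x) model \<Rightarrow> nat \<Rightarrow> (nat \<Rightarrow> 'x) \<Rightarrow>
    ('p, 'h) param \<Rightarrow> real" where
  "crit M \<eta> n xs \<tau> = - (1 / real n) * (\<Sum>i<n. \<eta> \<tau> (xs i)) + ln (\<integral>x. exp (\<eta> \<tau> x) \<partial>M)"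

definition pen_crit :: "'x measure \<Rightarrow> ('p::finite, 'h, 'x) model \<Rightarrow> ('h \<Rightarrow> 'h \<Rightarrow> real) \<Rightarrow> real \<Rightarrow>
    nat \<Rightarrow> (nat \<Rightarrow> 'x) \<Rightarrow> ('p, 'h) param \<Rightarrow> real" where
  "pen_crit M \<eta> J l n xs \<tau> = crit M \<eta> n xs \<tau> + l / 2 * J (snd \<tau>) (snd \<tau>)"

definition quad_crit :: "'x measure \<Rightarrow> ('p::finite, 'h::real_inner, 'x) model \<Rightarrow>
    ('h \<Rightarrow> 'h \<Rightarrow> real) \<Rightarrow> ('p, 'h) param \<Rightarrow> real \<Rightarrow> nat \<Rightarrow> (nat \<Rightarrow> 'x) \<Rightarrow>
    ('p, 'h) param \<Rightarrow> real" where
  "quad_crit M \<eta> J \<tau>0 l n xs \<tau> =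
     - (1 / real n) * (\<Sum>i<n. D\<theta> \<eta> \<tau>0 (fst \<tau>) (xs i) + Dh \<eta> \<tau>0 (snd \<tau>) (xs i))
     + mean_of M \<eta> \<tau>0 (\<lambda>x. D\<theta> \<eta> \<tau>0 (fst \<tau>) x + Dh \<eta> \<tau>0 (snd \<tau>) x)
     + 1 / 2 * var_of M \<eta> \<tau>0
         (\<lambda>x. D\<theta> \<eta> \<tau>0 (fst \<tau> - fst \<tau>0) x + Dh \<eta> \<tau>0 (snd \<tau> - snd \<tau>0) x)
     + l / 2 * J (snd \<tau>) (snd \<tau>)"

definition local_min :: "('a::topological_space \<Rightarrow> real) \<Rightarrow> 'a \<Rightarrow> bool" where
  "local_min F a \<longleftrightarrow> (\<forall>\<^sub>F b in nhds a. F a \<le> F b)"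

definition stationary :: "(('p::finite, 'h::real_inner) param \<Rightarrow> real) \<Rightarrow> ('p, 'h) param \<Rightarrow> bool" where
  "stationary F \<tau> \<longleftrightarrow>
     ((\<lambda>\<theta>. F (\<theta>, snd \<tau>)) has_derivative (\<lambda>_. 0)) (at (fst \<tau>)) \<and>
     ((\<lambda>h. F (fst \<tau>, h)) has_derivative (\<lambda>_. 0)) (at (snd \<tau>))"

definition unique_penalized_min ::
  "(('p::finite, 'h::real_inner) param \<Rightarrow> real) \<Rightarrow> ('p, 'h) param set \<Rightarrow> ('p, 'h) param \<Rightarrow> bool" where
  "unique_penalized_min F N \<tau>h \<longleftrightarrow>
     \<tau>h \<in> N \<and> (\<forall>\<tau>\<in>N. local_min F \<tau> \<longleftrightarrow> \<tau> = \<tau>h) \<and> (\<forall>\<tau>\<in>N. stationary F \<tau> \<longleftrightarrow> \<tau> = \<tau>h)"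

definition minimizer_in :: "('a \<Rightarrow> real) \<Rightarrow> 'a set \<Rightarrow> bool" where
  "minimizer_in F N \<longleftrightarrow> (\<exists>a\<in>N. \<forall>b. F a \<le> F b)"

text \<open>
  No measurability of the quantities involved is required: an event has probability at least
  \<open>p\<close> if it contains a measurable set of probability at least \<open>p\<close>. For measurable quantities
  these are the usual notions.
\<close>

definition with_prob_tending_to_1 :: "'w measure \<Rightarrow> (nat \<Rightarrow> 'w \<Rightarrow> bool) \<Rightarrow> bool" where
  "with_prob_tending_to_1 P Q \<longleftrightarrow>
     (\<exists>E. (\<forall>n. E n \<in> sets P \<and> (\<forall>\<omega>\<in>E n. Q n \<omega>)) \<and> (\<lambda>n. measure P (E n)) \<longlonglongrightarrow> 1)"

definition bigO_in_prob :: "'w measure \<Rightarrow> (nat \<Rightarrow> 'w \<Rightarrow> real) \<Rightarrow> (nat \<Rightarrow> real) \<Rightarrow> bool" where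
  "bigO_in_prob P Z a \<longleftrightarrow>
     (\<forall>\<epsilon>>0. \<exists>C. \<forall>\<^sub>F n in sequentially.
        \<exists>A\<in>sets P. measure P A \<ge> 1 - \<epsilon> \<and> (\<forall>\<omega>\<in>A. \<bar>Z n \<omega>\<bar> \<le> C * a n))"

text \<open>
  \<open>J\<close> being real valued on the whole of the Hilbert space, \<open>J(h) < \<infinity>\<close> holds for every \<open>h\<close>; the
  upper bound required in \<open>assumption2\<close> leaves no other possibility.
\<close>

definition assumption1 :: "('h::real_inner \<Rightarrow> 'h \<Rightarrow> real) \<Rightarrow> bool" where
  "assumption1 J \<longleftrightarrow>
     (\<forall>f g. J f g = J g f) \<and> (\<forall>g. linear (\<lambda>f. J f g)) \<and> (\<forall>g. 0 \<le> J g g) \<and>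
     (\<exists>B. finite B \<and> {g. J g g = 0} \<subseteq> span B)"

definition assumption2 ::
  "'x measure \<Rightarrow> ('p::finite, 'h::real_inner, 'x) model \<Rightarrow> ('h \<Rightarrow> 'h \<Rightarrow> real) \<Rightarrow> ('p, 'h) param \<Rightarrow>
    (real ^ 'p \<Rightarrow> 'x \<Rightarrow> real) \<Rightarrow> ('h \<Rightarrow> 'x \<Rightarrow> real) \<Rightarrow> bool" where
  "assumption2 M \<eta> J \<tau>0 L\<theta> Lh \<longleftrightarrow>
     bounded_linear_L20 M \<eta> \<tau>0 L\<theta> \<and> bounded_linear_L20 M \<eta> \<tau>0 Lh \<and>
     (\<forall>\<zeta>. (AE x in M. L\<theta> \<zeta> x = 0) \<longrightarrow> \<zeta> = 0) \<and> (\<forall>g. (AE x in M. Lh g x = 0) \<longrightarrow> g = 0) \<and>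
     (\<forall>l>0. \<exists>M1>0. \<exists>M2>0. \<forall>g.
        M1 * (norm g)\<^sup>2 \<le> var_of M \<eta> \<tau>0 (Lh g) + l * J g g \<and>
        var_of M \<eta> \<tau>0 (Lh g) + l * J g g \<le> M2 * (norm g)\<^sup>2) \<and>
     (\<exists>c>0. \<forall>\<zeta> g. norm \<zeta> = 1 \<longrightarrow> var_of M \<eta> \<tau>0 (\<lambda>x. L\<theta> \<zeta> x - Lh g x) > c)"

definition expected_score_root ::
  "'w measure \<Rightarrow> 'x measure \<Rightarrow> ('p::finite, 'h::real_inner, 'x) model \<Rightarrow> (nat \<Rightarrow> 'w \<Rightarrow> 'x) \<Rightarrow> nat \<Rightarrow>
    ('p, 'h) param \<Rightarrow> bool" where
  "expected_score_root P M \<eta> X n \<tau> \<longleftrightarrow>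
     (\<forall>\<zeta>. (\<integral>\<omega>. frechet_derivative (\<lambda>\<theta>. crit M \<eta> n (\<lambda>i. X i \<omega>) (\<theta>, snd \<tau>)) (at (fst \<tau>)) \<zeta> \<partial>P) = 0) \<and>
     (\<forall>g. (\<integral>\<omega>. frechet_derivative (\<lambda>h. crit M \<eta> n (\<lambda>i. X i \<omega>) (fst \<tau>, h)) (at (snd \<tau>)) g \<partial>P) = 0)"

text \<open>
  Differentiability on a set that need not be open means differentiability on an open superset.
  Differentiability of \<open>\<tau> \<mapsto> \<eta>(x; \<tau>)\<close> for almost every \<open>x\<close> is what makes the derivatives of
  the sample criterion and of \<open>\<eta>\<close> at an observation meaningful.
\<close>

definition assumption3 ::
  "'w measure \<Rightarrow> 'x measure \<Rightarrow> ('p::finite, 'h::real_inner, 'x) model \<Rightarrow> (nat \<Rightarrow> 'w \<Rightarrow> 'x) \<Rightarrow>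
    ('p, 'h) param \<Rightarrow> ('p, 'h) param set \<Rightarrow> bool" where
  "assumption3 P M \<eta> X \<tau>0 N \<longleftrightarrow>
     (\<forall>\<tau>\<in>N. \<forall>\<tau>'\<in>N. (AE x in M. \<eta> \<tau> x = \<eta> \<tau>' x) \<longrightarrow> \<tau> = \<tau>') \<and>
     (\<exists>U. N \<subseteq> U \<and> C_k_Frechet_L20 M \<eta> \<tau>0 3 U) \<and>
     (AE x in M. \<forall>\<tau>\<in>N. (\<lambda>\<tau>. \<eta> \<tau> x) differentiable (at \<tau>)) \<and>
     (\<forall>n\<ge>1. \<forall>\<tau>\<in>N. expected_score_root P M \<eta> X n \<tau> \<longleftrightarrow> \<tau> = \<tau>0)"

definition assumption4 ::
  "'x measure \<Rightarrow> ('p::finite, 'h::real_inner, 'x) model \<Rightarrow> ('p, 'h) param \<Rightarrow>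
    (real ^ 'p \<Rightarrow> 'x \<Rightarrow> real) \<Rightarrow> ('h \<Rightarrow> 'x \<Rightarrow> real) \<Rightarrow> ('p, 'h) param set \<Rightarrow> real \<Rightarrow> real \<Rightarrow> bool" where
  "assumption4 M \<eta> \<tau>0 L\<theta> Lh N C1 C2 \<longleftrightarrow> C1 > 0 \<and> C2 > 0 \<and>
     (\<forall>\<tau>\<in>N. bounded_linear_L20 M \<eta> \<tau>0 (D\<theta> \<eta> \<tau>) \<and> bounded_linear_L20 M \<eta> \<tau>0 (Dh \<eta> \<tau>) \<and>
       (\<forall>\<zeta> g.
          C1 * var_of M \<eta> \<tau>0 (\<lambda>x. L\<theta> \<zeta> x + Lh g x)
            \<le> var_of M \<eta> \<tau>0 (\<lambda>x. D\<theta> \<eta> \<tau> \<zeta> x + Dh \<eta> \<tau> g x) \<and>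
          var_of M \<eta> \<tau>0 (\<lambda>x. D\<theta> \<eta> \<tau> \<zeta> x + Dh \<eta> \<tau> g x)
            \<le> C2 * var_of M \<eta> \<tau>0 (\<lambda>x. L\<theta> \<zeta> x + Lh g x)))"

definition assumption5 ::
  "'x measure \<Rightarrow> ('p::finite, 'h::real_inner, 'x) model \<Rightarrow> ('p, 'h) param \<Rightarrow>
    (real ^ 'p \<Rightarrow> 'x \<Rightarrow> real) \<Rightarrow> ('h \<Rightarrow> 'x \<Rightarrow> real) \<Rightarrow> ('p, 'h) param set \<Rightarrow> real \<Rightarrow> bool" where
  "assumption5 M \<eta> \<tau>0 L\<theta> Lh N C1 \<longleftrightarrow>
     (\<exists>Cd>0. Cd < 2 * C1 \<and>
       (\<forall>\<tau>1\<in>N. \<forall>\<tau>2\<in>N. \<forall>(\<zeta>, g)\<in>N.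
          var_of M \<eta> \<tau>0 (\<lambda>x. (D\<theta> \<eta> \<tau>1 \<zeta> x - D\<theta> \<eta> \<tau>2 \<zeta> x) + (Dh \<eta> \<tau>1 g x - Dh \<eta> \<tau>2 g x))
            \<le> Cd * var_of M \<eta> \<tau>0 (\<lambda>x. L\<theta> \<zeta> x + Lh g x)))"

text \<open>
  Membership in \<open>L2_of M \<eta> \<tau>\<close> records that the variance under \<open>\<tau>\<close> is finite, which the upper
  bound tacitly asserts.
\<close>

definition assumption6 ::
  "'x measure \<Rightarrow> ('p::finite, 'h::real_inner, 'x) model \<Rightarrow> ('p, 'h) param \<Rightarrow>
    ('p, 'h) param set \<Rightarrow> bool" where
  "assumption6 M \<eta> \<tau>0 N \<longleftrightarrow> convex N \<and>
     (\<exists>C3>0. \<exists>C4>0. \<forall>\<tau>\<in>N. \<forall>f\<in>L20_of M \<eta> \<tau>0.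
        f \<in> L2_of M \<eta> \<tau> \<and>
        C3 * var_of M \<eta> \<tau>0 f \<le> var_of M \<eta> \<tau> f \<and> var_of M \<eta> \<tau> f \<le> C4 * var_of M \<eta> \<tau>0 f)"

definition completely_continuous_wrt ::
  "('h::real_normed_vector \<Rightarrow> real) \<Rightarrow> ('h \<Rightarrow> real) \<Rightarrow> bool" where
  "completely_continuous_wrt V J \<longleftrightarrow>
     (\<forall>\<epsilon>>0. \<exists>S :: ('h \<Rightarrow> real) set. finite S \<and> (\<forall>l\<in>S. bounded_linear l) \<and>
        (\<forall>g. (\<forall>l\<in>S. l g = 0) \<longrightarrow> V g \<le> \<epsilon> * J g))"

text \<open>
  Indices start at 1. The system of eigenfunctions is complete: orthogonality relations alone
  would also hold for an arbitrary subsystem and would not determine the eigenvalues. Together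
  with completeness they imply \<open>J(\<phi>\<^sub>\<nu>, g) = \<rho>\<^sub>\<nu> V(L\<^sub>h \<phi>\<^sub>\<nu>, L\<^sub>h g)\<close> for all \<open>g\<close>.
\<close>

definition eigen_system ::
  "'x measure \<Rightarrow> ('p::finite, 'h::real_inner, 'x) model \<Rightarrow> ('h \<Rightarrow> 'h \<Rightarrow> real) \<Rightarrow> ('p, 'h) param \<Rightarrow>
    ('h \<Rightarrow> 'x \<Rightarrow> real) \<Rightarrow> (nat \<Rightarrow> 'h) \<Rightarrow> (nat \<Rightarrow> real) \<Rightarrow> bool" where
  "eigen_system M \<eta> J \<tau>0 Lh \<phi> \<rho> \<longleftrightarrow>
     (\<forall>\<nu>\<ge>1. \<forall>\<mu>\<ge>1.
        cov_of M \<eta> \<tau>0 (Lh (\<phi> \<nu>)) (Lh (\<phi> \<mu>)) = (if \<nu> = \<mu> then 1 else 0) \<and>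
        J (\<phi> \<nu>) (\<phi> \<mu>) = (if \<nu> = \<mu> then \<rho> \<nu> else 0)) \<and>
     closure (span (\<phi> ` {1..})) = UNIV \<and>
     (\<forall>\<nu>\<ge>1. 0 \<le> \<rho> \<nu>) \<and> filterlim \<rho> at_top sequentially"

definition assumption7 ::
  "'x measure \<Rightarrow> ('p::finite, 'h::real_inner, 'x) model \<Rightarrow> ('h \<Rightarrow> 'h \<Rightarrow> real) \<Rightarrow> ('p, 'h) param \<Rightarrow>
    ('h \<Rightarrow> 'x \<Rightarrow> real) \<Rightarrow> (nat \<Rightarrow> 'h) \<Rightarrow> (nat \<Rightarrow> real) \<Rightarrow> bool" where
  "assumption7 M \<eta> J \<tau>0 Lh \<phi> \<rho> \<longleftrightarrow>
     completely_continuous_wrt (\<lambda>g. var_of M \<eta> \<tau>0 (Lh g)) (\<lambda>g. J g g) \<and>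
     eigen_system M \<eta> J \<tau>0 Lh \<phi> \<rho>"

definition assumption8 :: "(nat \<Rightarrow> real) \<Rightarrow> real \<Rightarrow> bool" where
  "assumption8 \<rho> r \<longleftrightarrow> r > 1 \<and>
     (\<exists>\<kappa> \<beta>1 \<beta>2. 0 < \<beta>1 \<and> (\<forall>\<nu>\<ge>1. \<kappa> \<nu> \<in> {\<beta>1<..<\<beta>2} \<and> \<rho> \<nu> = \<kappa> \<nu> * real \<nu> powr r))"

end

theory Submission
  imports Defs
begin

text \<open>
  Write \<open>d\<close> for the deviation from the true parameter, \<open>\<psi> d x\<close> for the negative log density ratio
  at an observation \<open>x\<close>, \<open>q\<close> for the information form \<open>V (L\<^sub>\<theta> \<zeta> + L\<^sub>h g)\<close> and
  \<open>\<delta>\<^sup>2 = n\<^sup>-\<^sup>1 \<lambda>\<^sup>-\<^sup>1\<^sup>/\<^sup>r + \<lambda>\<close>. Testing Assumption 6 on indicator functions bounds the density ratios on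
  the neighbourhood, and convexity of the criterion for samples of size one makes \<open>\<psi> d x\<close> convex in
  \<open>d\<close> for almost every \<open>x\<close>. Hence \<open>\<psi>\<close> lies above its tangents, and the mean slope of the tangent at
  \<open>d\<close> is comparable to \<open>q d\<close> in direction \<open>d\<close> and bounded by the form \<open>q\<close> in every direction.

  Suppose the estimator had distance more than \<open>2 K \<delta>\<close> from the truth. The criterion does not
  increase from any point \<open>d\<close> towards the estimator. Let \<open>d\<close> run through a net of
  \<open>exp (C \<lambda>\<^sup>-\<^sup>1\<^sup>/\<^sup>r)\<close> points at distance \<open>K \<delta>\<close>, one of which is close to a multiple of the estimator. The
  tangent at \<open>d\<close> is linear in the direction, so a PAC-Bayes bound with a Rademacher prior and a
  truncation compares its sample mean with its expectation, simultaneously for all directions and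
  with an error probability that survives the union over the net. Only second moments enter, since
  the tangent is used together with the uniform lower bound on \<open>\<psi>\<close>. For large \<open>K\<close> the criterion then
  has to increase, a contradiction, and SKL is bounded by a multiple of \<open>q\<close>.
\<close>

section \<open>Density ratios, tangents and strong convexity\<close>

text \<open>The obstacle: derivatives of \<open>\<eta>\<close> at different parameters are compared
  only up to constants, through the form \<open>q\<close>. They need not be close to each other, and
  only second moments are available, so a linearisation at the truth leaves a remainder of the same
  order as the leading term. A tangent at the comparison point \<open>d\<close> itself leaves no
  remainder. Its mean slope in direction \<open>d\<close> is at least the mean loss at
  \<open>d\<close>, which strong convexity along the segment from 0 to \<open>d\<close> bounds below
  by a multiple of \<open>q d\<close>. The price is that the tangent depends on \<open>d\<close>
  non-linearly: uniformity in \<open>d\<close> needs a net, while uniformity in the direction comes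
  from linearity. The entropy of the net and the trace of the prior covariance are both governed by
  the effective dimension \<open>\<lambda> powr (- 1 / r)\<close>, which
  \<open>n * \<delta>\<^sup>2\<close> has to dominate; penalising the true function adds the bias
  \<open>\<lambda>\<close>. The bound \<open>\<kappa>\<close> on the density ratios gives loss
  differences the floor \<open>- 2 * ln \<kappa>\<close>, so a truncated tangent is enough.\<close>

lemma sqrt_bound_of_quadratic_nonneg:
  fixes a b c :: real
  assumes quad: "\<And>t. 0 \<le> a + t\<^sup>2 * c + 2 * t * b" and c0: "c \<ge> 0"
  shows "\<bar>b\<bar> \<le> sqrt a * sqrt c"
proof -
  have "b\<^sup>2 \<le> a * c"
  proof (cases "c = 0")
    case True
    have "b = 0"
    proof (rule ccontr)
      assume b: "b \<noteq> 0"
      \<comment> \<open>With \<open>c = 0\<close> the quadratic is affine in \<open>t\<close>, and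
        this \<open>t\<close> gives it the value -1.\<close>
      have "0 \<le> a + 2 * (- (a + 1) / (2 * b)) * b" using quad[of "- (a + 1) / (2 * b)"] True by simp
      also have "2 * (- (a + 1) / (2 * b)) * b = - (a + 1)" using b by simp
      finally show False by simp
    qed
    thus ?thesis by (simp add: True)
  next
    case False
    with c0 have c: "c > 0" by simp
    have "0 \<le> a - b\<^sup>2 / c" using quad[of "- b / c"] c by (simp add: power2_eq_square field_simps)
    thus ?thesis using c by (simp add: field_simps)
  qed
  hence "\<bar>b\<bar> \<le> sqrt (a * c)" by (simp add: real_le_rsqrt abs_le_square_iff)
  thus ?thesis by (simp add: real_sqrt_mult)
qed

lemma (in prob_space) square_integrable_mult:
  fixes f g :: "'a \<Rightarrow> real"
  assumes [measurable]: "f \<in> borel_measurable M" "g \<in> borel_measurable M"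
    and sq: "integrable M (\<lambda>x. (f x)\<^sup>2)" "integrable M (\<lambda>x. (g x)\<^sup>2)"
  shows "integrable M (\<lambda>x. f x * g x)"
    and "integrable M (\<lambda>x. (f x + g x)\<^sup>2)"
    and "\<bar>\<integral>x. f x * g x \<partial>M\<bar> \<le> sqrt (\<integral>x. (f x)\<^sup>2 \<partial>M) * sqrt (\<integral>x. (g x)\<^sup>2 \<partial>M)"
proof -
  have 2: "2 * \<bar>u * v\<bar> \<le> u\<^sup>2 + v\<^sup>2" for u v :: real
    using sum_squares_bound[of "\<bar>u\<bar>" "\<bar>v\<bar>"] by (simp add: abs_mult)
  hence "\<bar>u * v\<bar> \<le> u\<^sup>2 + v\<^sup>2" for u v :: real by (smt (verit) abs_ge_zero)
  hence ae: "AE x in M. norm (f x * g x) \<le> norm ((f x)\<^sup>2 + (g x)\<^sup>2)" by simp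
  show fg: "integrable M (\<lambda>x. f x * g x)"
    by (rule Bochner_Integration.integrable_bound[OF Bochner_Integration.integrable_add[OF sq] _ ae]) measurable
  have eq: "(f x + t * g x)\<^sup>2 = (f x)\<^sup>2 + t\<^sup>2 * (g x)\<^sup>2 + 2 * t * (f x * g x)" for x t
    by (simp add: power2_eq_square algebra_simps)
  show "integrable M (\<lambda>x. (f x + g x)\<^sup>2)"
    using eq[of _ 1] fg sq by simp
  define a b c where "a = (\<integral>x. (f x)\<^sup>2 \<partial>M)" and "b = (\<integral>x. f x * g x \<partial>M)" and "c = (\<integral>x. (g x)\<^sup>2 \<partial>M)"
  have quad: "0 \<le> a + t\<^sup>2 * c + 2 * t * b" for t
  proof -
    have "0 \<le> (\<integral>x. (f x + t * g x)\<^sup>2 \<partial>M)" by simp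
    also have "\<dots> = a + t\<^sup>2 * c + 2 * t * b" unfolding eq a_def b_def c_def using fg sq by simp
    finally show ?thesis .
  qed
  have "\<bar>b\<bar> \<le> sqrt a * sqrt c"
    by (rule sqrt_bound_of_quadratic_nonneg[OF quad]) (simp add: c_def)
  thus "\<bar>\<integral>x. f x * g x \<partial>M\<bar> \<le> sqrt (\<integral>x. (f x)\<^sup>2 \<partial>M) * sqrt (\<integral>x. (g x)\<^sup>2 \<partial>M)"
    by (simp add: a_def b_def c_def)
qed

text \<open>Testing the variance comparison on indicator functions bounds the density ratio. Splitting
  along a set \<open>E\<close> of non-trivial probability keeps the probabilities involved away from 1.\<close>

lemma (in prob_space) density_ratio_bounds:
  fixes g :: "'a \<Rightarrow> real"
  assumes gm [measurable]: "g \<in> borel_measurable M" and g0: "\<And>x. g x \<ge> 0"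
    and gi: "integrable M g" "(\<integral>x. g x \<partial>M) = 1"
    and E: "E \<in> events" "0 < prob E" "prob E < 1" and C: "C3 > 0" "C4 > 0"
    and var: "\<And>f. f \<in> borel_measurable M \<Longrightarrow> integrable M (\<lambda>x. (f x)\<^sup>2) \<Longrightarrow> (\<integral>x. f x \<partial>M) = 0 \<Longrightarrow>
        C3 * (\<integral>x. (f x)\<^sup>2 \<partial>M) \<le> (\<integral>x. (f x)\<^sup>2 * g x \<partial>M) - (\<integral>x. f x * g x \<partial>M)\<^sup>2 \<and>
        (\<integral>x. (f x)\<^sup>2 * g x \<partial>M) - (\<integral>x. f x * g x \<partial>M)\<^sup>2 \<le> C4 * (\<integral>x. (f x)\<^sup>2 \<partial>M)"
  shows "AE x in M. C3 * (prob E * (1 - prob E)) \<le> g x \<and> g x \<le> C4 / (C3 * (prob E * (1 - prob E)))"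
proof -
  define e where "e = prob E"
  define k where "k = C3 * (e * (1 - e))"
  have e: "0 < e" "e < 1" using E by (auto simp: e_def)
  have k: "k > 0" using e C by (simp add: k_def)
  define G where "G B = (\<integral>x. indicator B x * g x \<partial>M)" for B
  have ind_int: "integrable M (\<lambda>x. indicator B x * g x)" if "B \<in> events" for B
    using integrable_mult_indicator[OF that gi(1)] by (simp add: scaleR_conv_of_real)
  have G_mono: "G A \<le> G B" if "A \<in> events" "B \<in> events" "A \<subseteq> B" for A B
    unfolding G_def using that g0 by (intro integral_mono ind_int) (auto simp: indicator_def)
  have G_un: "G (A \<union> B) = G A + G B" if "A \<in> events" "B \<in> events" "A \<inter> B = {}" for A B
  proof -
    have "G (A \<union> B) = (\<integral>x. indicator A x * g x + indicator B x * g x \<partial>M)"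
      unfolding G_def using that by (intro Bochner_Integration.integral_cong) (auto simp: indicator_def)
    thus ?thesis using ind_int that by (simp add: G_def)
  qed
  have G0: "G B \<ge> 0" for B unfolding G_def using g0 by simp
  \<comment> \<open>The test function is the centred indicator of \<open>B\<close>; both variances
    are then Bernoulli variances, with success probabilities \<open>prob B\<close> and
    \<open>G B\<close>.\<close>
  have key: "C3 * (prob B * (1 - prob B)) \<le> G B * (1 - G B) \<and> G B * (1 - G B) \<le> C4 * (prob B * (1 - prob B))"
    if B [measurable]: "B \<in> events" for B
  proof -
    define b where "b = prob B"
    define f :: "'a \<Rightarrow> real" where "f x = indicator B x - b" for x
    have f2: "(f x)\<^sup>2 = (1 - 2 * b) * indicator B x + b\<^sup>2" for x
      by (simp add: f_def indicator_def power2_eq_square algebra_simps)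
    have [measurable]: "f \<in> borel_measurable M" unfolding f_def by measurable
    have iB: "integrable M (indicator B :: 'a \<Rightarrow> real)" "(\<integral>x. indicator B x \<partial>M) = b"
      using B by (auto simp: b_def intro!: integrable_const_bound[where B = 1])
    have "integrable M (\<lambda>x. (f x)\<^sup>2)" "(\<integral>x. f x \<partial>M) = 0" unfolding f2 using iB by (auto simp: f_def prob_space)
    note v = var[OF \<open>f \<in> borel_measurable M\<close> this]
    have 1: "(\<integral>x. (f x)\<^sup>2 \<partial>M) = b * (1 - b)"
      unfolding f2 using iB by (simp add: prob_space power2_eq_square algebra_simps)
    have "(\<lambda>x. (f x)\<^sup>2 * g x) = (\<lambda>x. (1 - 2 * b) * (indicator B x * g x) + b\<^sup>2 * g x)"
      unfolding f2 by (simp add: algebra_simps)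
    hence 2: "(\<integral>x. (f x)\<^sup>2 * g x \<partial>M) = (1 - 2 * b) * G B + b\<^sup>2"
      using ind_int[OF B] gi by (simp add: G_def)
    have "(\<lambda>x. f x * g x) = (\<lambda>x. indicator B x * g x - b * g x)"
      by (simp add: f_def algebra_simps)
    hence 3: "(\<integral>x. f x * g x \<partial>M) = G B - b"
      using ind_int[OF B] gi by (simp add: G_def)
    have "(1 - 2 * b) * G B + b\<^sup>2 - (G B - b)\<^sup>2 = G B * (1 - G B)"
      by (simp add: power2_eq_square algebra_simps)
    thus ?thesis using v unfolding 1 2 3 b_def by simp
  qed
  define E' where "E' = space M - E"
  have E': "E' \<in> events" "prob E' = 1 - e" "E \<inter> E' = {}"
    using E by (auto simp: E'_def prob_compl e_def)
  have "G E + G E' = G (space M)" using G_un[OF E(1) E'(1,3)] E(1) sets.sets_into_space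
    by (metis E'_def Un_Diff_cancel sup.absorb2)
  also have "G (space M) = (\<integral>x. g x \<partial>M)"
    unfolding G_def by (intro Bochner_Integration.integral_cong) auto
  finally have GE: "G E + G E' = 1" using gi by simp
  have kE: "k \<le> G E * (1 - G E)" using key[OF E(1)] by (simp add: k_def e_def)
  \<comment> \<open>Each of \<open>E\<close> and its complement has \<open>g\<close>-mass at least
    \<open>k\<close>, so a subset of either one leaves out at least that much.\<close>
  have far: "k \<le> 1 - G E" "k \<le> 1 - G E'"
  proof -
    have "G E * (1 - G E) \<le> 1 * (1 - G E)" using GE G0[of E'] by (intro mult_right_mono) auto
    thus "k \<le> 1 - G E" using kE by simp
    have "G E * (1 - G E) \<le> G E * 1" using GE G0[of E] by (intro mult_left_mono) auto
    thus "k \<le> 1 - G E'" using kE GE by simp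
  qed
  \<comment> \<open>Inside one part the factors \<open>1 - prob B\<close> and \<open>1 - G B\<close>
    stay away from 0, so the comparison in \<open>key\<close> becomes linear in the two
    probabilities and extends to all sets by additivity.\<close>
  have part: "k * prob B \<le> G B \<and> k * G B \<le> C4 * prob B"
    if B: "B \<in> events" "B \<subseteq> A" and A: "A = E \<or> A = E'" for A B
  proof -
    have A': "A \<in> events" using A E E' by auto
    have pB: "prob B \<le> prob A" "prob A \<le> max e (1 - e)"
      using B A' A E'(2) by (auto intro!: finite_measure_mono simp: e_def)
    have 1: "e * (1 - e) \<le> 1 - prob B"
    proof -
      have "e * (1 - e) \<le> e" "e * (1 - e) \<le> 1 - e" using e by (auto simp: mult_le_cancel_left2 mult_left_le_one_le)
      thus ?thesis using pB by linarith
    qed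
    have "k * prob B = C3 * (prob B * (e * (1 - e)))" by (simp add: k_def)
    also have "\<dots> \<le> C3 * (prob B * (1 - prob B))"
      using 1 C by (intro mult_left_mono) auto
    also have "\<dots> \<le> G B * (1 - G B)" using key[OF B(1)] by simp
    also have "\<dots> \<le> G B * 1" using G0[of B] by (intro mult_left_mono) auto
    finally have lower: "k * prob B \<le> G B" by simp
    have "k \<le> 1 - G B" using G_mono[OF B(1) A' B(2)] far A by auto
    hence "k * G B \<le> (1 - G B) * G B" using G0[of B] by (intro mult_right_mono)
    also have "\<dots> \<le> C4 * (prob B * (1 - prob B))" using key[OF B(1)] by (simp add: mult.commute)
    also have "\<dots> \<le> C4 * (prob B * 1)"
      using C by (intro mult_left_mono) auto
    finally show ?thesis using lower by simp
  qed
  have all: "k * prob B \<le> G B \<and> k * G B \<le> C4 * prob B" if B: "B \<in> events" for B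
  proof -
    have s: "B \<inter> E \<in> events" "B \<inter> E' \<in> events" "(B \<inter> E) \<inter> (B \<inter> E') = {}" "B = (B \<inter> E) \<union> (B \<inter> E')"
      using B E E' sets.sets_into_space[OF B] by (auto simp: E'_def)
    have "prob B = prob (B \<inter> E) + prob (B \<inter> E')" using finite_measure_Union[OF s(1-3)] s(4) by simp
    moreover have "G B = G (B \<inter> E) + G (B \<inter> E')" using G_un[OF s(1-3)] s(4) by simp
    ultimately show ?thesis
      using part[of "B \<inter> E" E] part[of "B \<inter> E'" E'] s by (simp add: distrib_left)
  qed
  have ae_le: "AE x in M. u x \<le> v x"
    if [measurable]: "u \<in> borel_measurable M" "v \<in> borel_measurable M"
      and uv: "integrable M u" "integrable M v"
      and le: "\<And>B. B \<in> events \<Longrightarrow> (\<integral>x. indicator B x * u x \<partial>M) \<le> (\<integral>x. indicator B x * v x \<partial>M)"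
    for u v :: "'a \<Rightarrow> real"
  proof -
    define B where "B = {x \<in> space M. v x < u x}"
    have B [measurable]: "B \<in> events" unfolding B_def by measurable
    have i: "integrable M (\<lambda>x. indicator B x * u x)" "integrable M (\<lambda>x. indicator B x * v x)"
      using integrable_mult_indicator[OF B uv(1)] integrable_mult_indicator[OF B uv(2)]
      by (simp_all add: scaleR_conv_of_real)
    have nn: "0 \<le> indicator B x * (u x - v x)" for x by (auto simp: indicator_def B_def)
    have "(\<integral>x. indicator B x * (u x - v x) \<partial>M) \<le> 0"
      using le[OF B] i by (simp add: right_diff_distrib)
    hence "(\<integral>x. indicator B x * (u x - v x) \<partial>M) = 0" using nn by (simp add: antisym)
    moreover have "integrable M (\<lambda>x. indicator B x * (u x - v x))"
      using i by (simp add: right_diff_distrib)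
    ultimately have "AE x in M. indicator B x * (u x - v x) = 0"
      using nn by (subst (asm) integral_nonneg_eq_0_iff_AE) auto
    thus ?thesis by (rule AE_mp) (intro AE_I2, auto simp: B_def indicator_def split: if_splits)
  qed
  have ind_c: "(\<integral>x. indicator B x * c \<partial>M) = prob B * c" if "B \<in> events" for B c
    using that by simp
  have "AE x in M. k \<le> g x"
    by (rule ae_le) (use gi all in \<open>auto simp: ind_c G_def mult.commute\<close>)
  moreover have "AE x in M. g x \<le> C4 / k"
  proof (rule ae_le)
    fix B assume B: "B \<in> events"
    have "G B \<le> C4 * prob B / k" using all[OF B] k by (simp add: field_simps)
    thus "(\<integral>x. indicator B x * g x \<partial>M) \<le> (\<integral>x. indicator B x * (C4 / k) \<partial>M)"
      using B by (simp add: G_def field_simps)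
  qed (use gi in auto)
  ultimately show ?thesis by (auto simp: k_def e_def)
qed

lemma has_derivative_directional:
  fixes f :: "'q::real_normed_vector \<Rightarrow> real"
  assumes "(f has_derivative f') (at d)"
  shows "((\<lambda>t. f (d + t *\<^sub>R u)) has_real_derivative f' u) (at 0)"
proof -
  have "((\<lambda>t. d + t *\<^sub>R u) has_derivative (\<lambda>t. t *\<^sub>R u)) (at 0)"
    by (auto intro!: derivative_eq_intros)
  hence "((\<lambda>t. f (d + t *\<^sub>R u)) has_derivative (\<lambda>t. f' (t *\<^sub>R u))) (at 0)"
    by (rule has_derivative_compose) (use assms in simp)
  moreover have "f' (t *\<^sub>R u) = t * f' u" for t
    using linear_cmul[OF has_derivative_linear[OF assms]] by simp
  ultimately have "((\<lambda>t. f (d + t *\<^sub>R u)) has_derivative (\<lambda>t. t * f' u)) (at 0)" by simp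
  moreover have "(\<lambda>t. t * f' u) = (*) (f' u)" by (simp add: fun_eq_iff mult.commute)
  ultimately show ?thesis by (simp add: has_field_derivative_def)
qed

section \<open>Exponential tilts: cumulant function, score and gradient inequalities\<close>

definition cgf :: "'x measure \<Rightarrow> ('q \<Rightarrow> 'x \<Rightarrow> real) \<Rightarrow> 'q \<Rightarrow> real" where
  "cgf Q h d = ln (\<integral>x. exp (h d x) \<partial>Q)"

definition loss :: "'x measure \<Rightarrow> ('q \<Rightarrow> 'x \<Rightarrow> real) \<Rightarrow> 'q \<Rightarrow> 'x \<Rightarrow> real" where
  "loss Q h d x = cgf Q h d - h d x"

text \<open>The model seen from the true parameter: \<open>d\<close> is the deviation from it, \<open>h d\<close> the deviation of
  the log density up to a constant, \<open>exp (- loss Q h d)\<close> the density ratio, \<open>D d u\<close> the derivative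
  of \<open>h\<close> at \<open>d\<close> in direction \<open>u\<close>, and \<open>q\<close> the Fisher information at 0.\<close>

locale convex_family = prob_space Q for Q :: "'x measure" +
  fixes h :: "'q::real_normed_vector \<Rightarrow> 'x \<Rightarrow> real" and D :: "'q \<Rightarrow> 'q \<Rightarrow> 'x \<Rightarrow> real"
    and S :: "'q set" and q :: "'q \<Rightarrow> real" and C1 C2 \<kappa> :: real
  assumes h_meas [measurable]: "\<And>d. h d \<in> borel_measurable Q"
    and h_sq: "\<And>d. integrable Q (\<lambda>x. (h d x)\<^sup>2)"
    and h_mean: "\<And>d. (\<integral>x. h d x \<partial>Q) = 0"
    and h_exp: "\<And>d. integrable Q (\<lambda>x. exp (h d x))"
    and h_zero: "\<And>x. h 0 x = 0"
    and S: "convex S" "0 \<in> S"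
    and deriv: "AE x in Q. \<forall>d\<in>S. ((\<lambda>d. h d x) has_derivative (\<lambda>u. D d u x)) (at d)"
    and D_meas: "\<And>d u. d \<in> S \<Longrightarrow> D d u \<in> borel_measurable Q"
    and D_sq: "\<And>d u. d \<in> S \<Longrightarrow> integrable Q (\<lambda>x. (D d u x)\<^sup>2)"
    and D_mean: "\<And>d u. d \<in> S \<Longrightarrow> (\<integral>x. D d u x \<partial>Q) = 0"
    and C1: "C1 > 0" and C2: "C2 > 0" and \<kappa>: "\<kappa> \<ge> 1"
    and D_lower: "\<And>d u. d \<in> S \<Longrightarrow> C1 * q u \<le> (\<integral>x. (D d u x)\<^sup>2 \<partial>Q)"
    and D_upper: "\<And>d u. d \<in> S \<Longrightarrow> (\<integral>x. (D d u x)\<^sup>2 \<partial>Q) \<le> C2 * q u"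
    and loss_convex: "\<And>d d' t. 0 \<le> t \<Longrightarrow> t \<le> 1 \<Longrightarrow>
       AE x in Q. loss Q h ((1 - t) *\<^sub>R d + t *\<^sub>R d') x \<le> (1 - t) * loss Q h d x + t * loss Q h d' x"
    and ratio: "\<And>d. d \<in> S \<Longrightarrow> AE x in Q. 1 / \<kappa> \<le> exp (- loss Q h d x) \<and> exp (- loss Q h d x) \<le> \<kappa>"
    and separable: "\<exists>T. countable T \<and> T \<subseteq> S \<and> S \<subseteq> closure T"
    and q_le: "\<exists>C. \<forall>u. q u \<le> C * (norm u)\<^sup>2"
begin

abbreviation "W \<equiv> cgf Q h"
abbreviation "\<psi> \<equiv> loss Q h"
abbreviation "g d x \<equiv> exp (- \<psi> d x)"

text \<open>Formally the derivative of \<open>W\<close> at \<open>d\<close> in direction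
  \<open>u\<close>: the mean of the derivative of \<open>h\<close> under the tilted law. The link to
  \<open>W\<close> is made by inequalities, \<open>jensen\<close> and
  \<open>tangent\<close>.\<close>

definition m :: "'q \<Rightarrow> 'q \<Rightarrow> real" where "m d u = (\<integral>x. D d u x * g d x \<partial>Q)"
text \<open>The directional derivative of the loss, that is the negative score of the tilted law:
  centred under that law, with mean \<open>m d u\<close> under the base law.\<close>

definition Y :: "'q \<Rightarrow> 'q \<Rightarrow> 'x \<Rightarrow> real" where "Y d u x = m d u - D d u x"
definition "CY = C2 * (1 + \<kappa>\<^sup>2)"

lemma q_nonneg: "q u \<ge> 0"
proof -
  have "0 \<le> (\<integral>x. (D 0 u x)\<^sup>2 \<partial>Q)" by simp
  also have "\<dots> \<le> C2 * q u" by (rule D_upper[OF S(2)])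
  finally show ?thesis using C2 by (simp add: zero_le_mult_iff)
qed

lemma CY: "CY > 0" using C2 by (simp add: CY_def add_pos_nonneg)

lemma \<psi>_meas [measurable]: "\<psi> d \<in> borel_measurable Q" unfolding loss_def by measurable

lemma h_int: "integrable Q (h d)"
  by (rule square_integrable_imp_integrable[OF h_meas h_sq])

lemma \<psi>_int: "integrable Q (\<psi> d)"
  unfolding loss_def using h_int by simp

text \<open>As \<open>h\<close> is centred, \<open>W d\<close> is the Kullback-Leibler divergence of
  the tilted law from the base law.\<close>

lemma \<psi>_mean: "(\<integral>x. \<psi> d x \<partial>Q) = W d"
  unfolding loss_def using h_int h_mean by (simp add: prob_space)

lemma exp_h_ge_1: "(\<integral>x. exp (h d x) \<partial>Q) \<ge> 1"
proof -
  have "1 = (\<integral>x. 1 + h d x \<partial>Q)" using h_int h_mean by (simp add: prob_space)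
  also have "\<dots> \<le> (\<integral>x. exp (h d x) \<partial>Q)"
    using h_int h_exp by (intro integral_mono) auto
  finally show ?thesis .
qed

lemma W_nonneg: "W d \<ge> 0" unfolding cgf_def by (rule ln_ge_zero[OF exp_h_ge_1])

lemma W_zero: "W 0 = 0" by (simp add: cgf_def h_zero prob_space)

lemma \<psi>_zero: "\<psi> 0 x = 0" by (simp add: loss_def W_zero h_zero)

lemma g_eq: "g d x = exp (h d x) / (\<integral>x. exp (h d x) \<partial>Q)"
  using exp_h_ge_1[of d] by (simp add: loss_def cgf_def exp_diff)

lemma g_int: "integrable Q (g d)" and g_mean: "(\<integral>x. g d x \<partial>Q) = 1"
  unfolding g_eq using h_exp exp_h_ge_1[of d] by auto

lemma g_mult:
  assumes f: "integrable Q f" and d: "d \<in> S"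
  shows "integrable Q (\<lambda>x. f x * g d x)" "\<bar>\<integral>x. f x * g d x \<partial>Q\<bar> \<le> \<kappa> * (\<integral>x. \<bar>f x\<bar> \<partial>Q)"
proof -
  have [measurable]: "f \<in> borel_measurable Q" using f by simp
  have ae: "AE x in Q. \<bar>f x * g d x\<bar> \<le> \<kappa> * \<bar>f x\<bar>"
    using ratio[OF d] by eventually_elim (metis abs_exp_cancel abs_ge_zero abs_mult mult.commute mult_right_mono)
  have k: "integrable Q (\<lambda>x. \<kappa> * \<bar>f x\<bar>)" using f by simp
  have "AE x in Q. norm (f x * g d x) \<le> norm (\<kappa> * \<bar>f x\<bar>)"
    using ae \<kappa> by simp
  thus i: "integrable Q (\<lambda>x. f x * g d x)"
    by (rule Bochner_Integration.integrable_bound[OF k, rotated]) measurable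
  have "\<bar>\<integral>x. f x * g d x \<partial>Q\<bar> \<le> (\<integral>x. \<bar>f x * g d x\<bar> \<partial>Q)" using integral_abs_bound by blast
  also have "\<dots> \<le> (\<integral>x. \<kappa> * \<bar>f x\<bar> \<partial>Q)"
    using i k ae by (intro integral_mono_AE) auto
  finally show "\<bar>\<integral>x. f x * g d x \<partial>Q\<bar> \<le> \<kappa> * (\<integral>x. \<bar>f x\<bar> \<partial>Q)" by simp
qed

lemma g_mult_nonneg:
  assumes f: "integrable Q f" "AE x in Q. 0 \<le> f x" and d: "d \<in> S"
  shows "(\<integral>x. f x * g d x \<partial>Q) \<le> \<kappa> * (\<integral>x. f x \<partial>Q)" "(\<integral>x. f x \<partial>Q) \<le> \<kappa> * (\<integral>x. f x * g d x \<partial>Q)"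
proof -
  have a1: "AE x in Q. f x * g d x \<le> \<kappa> * f x" and a2: "AE x in Q. f x \<le> \<kappa> * (f x * g d x)"
  proof -
    show "AE x in Q. f x * g d x \<le> \<kappa> * f x"
      using ratio[OF d] f(2) by eventually_elim (metis mult.commute mult_right_mono)
    show "AE x in Q. f x \<le> \<kappa> * (f x * g d x)"
      using ratio[OF d] f(2)
    proof eventually_elim
      case (elim x)
      hence "1 \<le> \<kappa> * g d x" using \<kappa> by (simp add: field_simps)
      hence "1 * f x \<le> \<kappa> * g d x * f x" using elim by (intro mult_right_mono) auto
      thus ?case by (simp add: mult_ac)
    qed
  qed
  show "(\<integral>x. f x * g d x \<partial>Q) \<le> \<kappa> * (\<integral>x. f x \<partial>Q)"
    using integral_mono_AE[OF g_mult(1)[OF f(1) d] _ a1] f(1) by simp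
  show "(\<integral>x. f x \<partial>Q) \<le> \<kappa> * (\<integral>x. f x * g d x \<partial>Q)"
    using integral_mono_AE[OF f(1) _ a2] g_mult(1)[OF f(1) d] by simp
qed

lemma D_int: "d \<in> S \<Longrightarrow> integrable Q (D d u)"
  by (rule square_integrable_imp_integrable[OF D_meas D_sq])

lemma D_linear: "d \<in> S \<Longrightarrow> AE x in Q. linear (\<lambda>u. D d u x)"
  using deriv by (rule AE_mp) (auto intro!: AE_I2 has_derivative_linear)

lemma m_linear: assumes d: "d \<in> S" shows "linear (m d)"
proof
  have gi: "integrable Q (\<lambda>x. D d u x * g d x)" for u by (rule g_mult(1)[OF D_int[OF d] d])
  show "m d (u + v) = m d u + m d v" for u v
  proof -
    have "m d (u + v) = (\<integral>x. D d u x * g d x + D d v x * g d x \<partial>Q)"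
      unfolding m_def
    proof (rule integral_cong_AE)
      show "AE x in Q. D d (u + v) x * g d x = D d u x * g d x + D d v x * g d x"
        using D_linear[OF d]
      proof eventually_elim
        case (elim x)
        show ?case by (simp only: linear_add[OF elim] distrib_right)
      qed
    qed (use D_meas[OF d] in measurable)
    thus ?thesis using gi by (simp add: m_def)
  qed
  show "m d (r *\<^sub>R u) = r *\<^sub>R m d u" for r u
  proof -
    have "m d (r *\<^sub>R u) = (\<integral>x. r * (D d u x * g d x) \<partial>Q)"
      unfolding m_def
    proof (rule integral_cong_AE)
      show "AE x in Q. D d (r *\<^sub>R u) x * g d x = r * (D d u x * g d x)"
        using D_linear[OF d]
      proof eventually_elim
        case (elim x)
        show ?case by (simp add: linear_cmul[OF elim])
      qed
    qed (use D_meas[OF d] in measurable)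
    thus ?thesis by (simp add: m_def)
  qed
qed

lemma Y_linear: "d \<in> S \<Longrightarrow> AE x in Q. linear (\<lambda>u. Y d u x)"
  unfolding Y_def using D_linear by (rule AE_mp) (auto intro!: AE_I2 linear_compose_sub m_linear)

lemma Y_meas: "d \<in> S \<Longrightarrow> Y d u \<in> borel_measurable Q"
  unfolding Y_def using D_meas by measurable

lemma Y_int: "d \<in> S \<Longrightarrow> integrable Q (Y d u)"
  unfolding Y_def using D_int by simp

lemma Y_mean: "d \<in> S \<Longrightarrow> (\<integral>x. Y d u x \<partial>Q) = m d u"
  unfolding Y_def using D_int D_mean by (simp add: prob_space)

lemma Y_mean_tilted: "d \<in> S \<Longrightarrow> (\<integral>x. Y d u x * g d x \<partial>Q) = 0"
  unfolding Y_def left_diff_distrib using g_mult(1)[OF D_int] g_int g_mean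
  by (simp add: m_def)

text \<open>\<open>D d u\<close> is centred under the base law, so the second moment of
  \<open>Y\<close> is \<open>(m d u)\<^sup>2\<close> plus that of \<open>D d u\<close>. The tilted
  density is at most \<open>\<kappa>\<close>, which bounds \<open>(m d u)\<^sup>2\<close> by
  \<open>\<kappa>\<^sup>2\<close> times the latter; hence \<open>1 + \<kappa>\<^sup>2\<close> in
  \<open>CY\<close>.\<close>

lemma Y_sq: assumes d: "d \<in> S"
  shows "integrable Q (\<lambda>x. (Y d u x)\<^sup>2)" "(\<integral>x. (Y d u x)\<^sup>2 \<partial>Q) \<le> CY * q u"
proof -
  have eq: "(\<lambda>x. (Y d u x)\<^sup>2) = (\<lambda>x. (m d u)\<^sup>2 - 2 * m d u * D d u x + (D d u x)\<^sup>2)"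
    by (simp add: Y_def power2_eq_square algebra_simps)
  show "integrable Q (\<lambda>x. (Y d u x)\<^sup>2)" unfolding eq using D_int[OF d] D_sq[OF d] by simp
  have "\<bar>m d u\<bar> \<le> \<kappa> * (\<integral>x. \<bar>D d u x\<bar> \<partial>Q)" unfolding m_def by (rule g_mult(2)[OF D_int[OF d] d])
  also have "(\<integral>x. \<bar>D d u x\<bar> \<partial>Q) \<le> sqrt (\<integral>x. (D d u x)\<^sup>2 \<partial>Q)"
  proof -
    have "\<bar>\<integral>x. \<bar>D d u x\<bar> * 1 \<partial>Q\<bar> \<le> sqrt (\<integral>x. \<bar>D d u x\<bar>\<^sup>2 \<partial>Q) * sqrt (\<integral>x. 1\<^sup>2 \<partial>Q)"
      using D_meas[OF d] D_sq[OF d] by (intro square_integrable_mult(3)) auto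
    thus ?thesis by (simp add: prob_space)
  qed
  finally have "\<bar>m d u\<bar> \<le> \<kappa> * sqrt (\<integral>x. (D d u x)\<^sup>2 \<partial>Q)" using \<kappa> by (simp add: mult_left_mono)
  hence "\<bar>m d u\<bar>\<^sup>2 \<le> (\<kappa> * sqrt (\<integral>x. (D d u x)\<^sup>2 \<partial>Q))\<^sup>2" by (intro power_mono) auto
  hence m2: "(m d u)\<^sup>2 \<le> \<kappa>\<^sup>2 * (\<integral>x. (D d u x)\<^sup>2 \<partial>Q)" by (simp add: power_mult_distrib)
  have "(\<integral>x. (Y d u x)\<^sup>2 \<partial>Q) = (m d u)\<^sup>2 + (\<integral>x. (D d u x)\<^sup>2 \<partial>Q)"
    unfolding eq using D_int[OF d] D_sq[OF d] D_mean[OF d] by (simp add: prob_space)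
  also have "\<dots> \<le> (1 + \<kappa>\<^sup>2) * (\<integral>x. (D d u x)\<^sup>2 \<partial>Q)" using m2 by (simp add: algebra_simps)
  also have "\<dots> \<le> (1 + \<kappa>\<^sup>2) * (C2 * q u)" using D_upper[OF d] by (intro mult_left_mono) auto
  finally show "(\<integral>x. (Y d u x)\<^sup>2 \<partial>Q) \<le> CY * q u" by (simp add: CY_def mult_ac)
qed

text \<open>The bound \<open>1 + y \<le> exp y\<close> is integrated against the tilted law.
  Subtracting \<open>W v - W d\<close> in \<open>y\<close> makes \<open>exp y * g d\<close> equal to
  \<open>g v\<close>, again a probability density.\<close>

lemma jensen:
  assumes d: "d \<in> S" shows "(\<integral>x. (h v x - h d x) * g d x \<partial>Q) \<le> W v - W d"
proof -
  let ?y = "\<lambda>x. h v x - h d x - (W v - W d)"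
  have yi: "integrable Q ?y" using h_int by simp
  have e: "exp (?y x) * g d x = g v x" for x
    by (simp add: loss_def exp_add[symmetric])
  have "(\<integral>x. (1 + ?y x) * g d x \<partial>Q) \<le> (\<integral>x. g v x \<partial>Q)"
  proof (rule integral_mono)
    show "integrable Q (\<lambda>x. (1 + ?y x) * g d x)" using yi d by (intro g_mult) auto
    show "integrable Q (g v)" by (rule g_int)
    show "(1 + ?y x) * g d x \<le> g v x" for x
      unfolding e[symmetric] by (intro mult_right_mono exp_ge_add_one_self) simp
  qed
  also have "(\<lambda>x. (1 + ?y x) * g d x) = (\<lambda>x. (1 - (W v - W d)) * g d x + (h v x - h d x) * g d x)"
    by (simp add: algebra_simps)
  finally show ?thesis
    using g_mult(1)[of "\<lambda>x. h v x - h d x", OF _ d] h_int g_int g_mean by simp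
qed

lemma W_convex: "0 \<le> t \<Longrightarrow> t \<le> 1 \<Longrightarrow> W ((1 - t) *\<^sub>R d + t *\<^sub>R d') \<le> (1 - t) * W d + t * W d'"
  using integral_mono_AE[OF \<psi>_int _ loss_convex[of t d d']] \<psi>_int by (simp add: \<psi>_mean)

text \<open>Each instance of \<open>loss_convex\<close> has its own null set, so the derivative is
  approached along the countable sequence \<open>p k\<close>. Convexity keeps the difference
  quotients \<open>H k\<close> between \<open>B\<close> and \<open>\<Delta>\<close>, which dominates
  them. The quotients \<open>w k\<close> of \<open>W\<close> are bounded below through
  \<open>jensen\<close> by tilted means of the quotients of \<open>h\<close>, and it is these means
  that converge to \<open>m d u\<close>.\<close>

lemma tangent:
  assumes d: "d \<in> S" shows "AE x in Q. \<psi> (d + u) x - \<psi> d x \<ge> Y d u x"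
proof -
  define c where "c k = real (Suc k)" for k
  have c: "c k > 0" for k by (simp add: c_def)
  define p where "p k = d + (1 / c k) *\<^sub>R u" for k
  define H where "H k x = c k * (\<psi> (p k) x - \<psi> d x)" for k x
  define r where "r k x = c k * (h (p k) x - h d x)" for k x
  define w where "w k = c k * (W (p k) - W d)" for k
  define \<Delta> where "\<Delta> x = \<psi> (d + u) x - \<psi> d x" for x
  define B where "B x = \<psi> d x - \<psi> (d - u) x" for x
  have Hr: "H k x = w k - r k x" for k x by (simp add: H_def r_def w_def loss_def algebra_simps)
  have int: "integrable Q \<Delta>" "integrable Q B" "integrable Q (H k)" "integrable Q (r k)" for k
    unfolding \<Delta>_def B_def H_def r_def using \<psi>_int h_int by auto
  have up: "AE x in Q. H k x \<le> \<Delta> x" for k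
  proof -
    have "(1 - 1 / c k) *\<^sub>R d + (1 / c k) *\<^sub>R (d + u) = p k" by (simp add: p_def algebra_simps)
    hence "AE x in Q. \<psi> (p k) x \<le> (1 - 1 / c k) * \<psi> d x + 1 / c k * \<psi> (d + u) x"
      using loss_convex[of "1 / c k" d "d + u"] by (simp add: c_def)
    thus ?thesis
    proof eventually_elim
      case (elim x)
      hence "c k * \<psi> (p k) x \<le> c k * ((1 - 1 / c k) * \<psi> d x + 1 / c k * \<psi> (d + u) x)"
        using c by (intro mult_left_mono) (auto simp: less_imp_le)
      also have "\<dots> = c k * \<psi> d x - \<psi> d x + \<psi> (d + u) x" using c[of k] by (simp add: field_simps)
      finally show ?case by (simp add: H_def \<Delta>_def algebra_simps)
    qed
  qed
  have low: "AE x in Q. B x \<le> H k x" for k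
  proof -
    \<comment> \<open>With this weight \<open>d\<close> is a convex combination of
      \<open>d - u\<close> and \<open>p k\<close>, so the increment on the opposite side bounds
      \<open>H k\<close> from below.\<close>
    define t where "t = c k / (c k + 1)"
    have t: "0 \<le> t" "t \<le> 1" "1 - t = 1 / (c k + 1)" using c[of k] by (auto simp: t_def field_simps)
    have ck: "c k + 1 \<noteq> 0" using c[of k] by simp
    have "t * (1 / c k) = 1 - t" using c[of k] by (simp add: t_def field_simps)
    hence "(1 - t) *\<^sub>R (d - u) + t *\<^sub>R p k = d"
      unfolding p_def scaleR_add_right scaleR_scaleR by (simp add: scaleR_diff_right scaleR_left_diff_distrib)
    hence "AE x in Q. \<psi> d x \<le> (1 - t) * \<psi> (d - u) x + t * \<psi> (p k) x"
      using loss_convex[OF t(1,2), of "d - u" "p k"] by simp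
    thus ?thesis
    proof eventually_elim
      case (elim x)
      hence "(c k + 1) * \<psi> d x \<le> (c k + 1) * ((1 - t) * \<psi> (d - u) x + t * \<psi> (p k) x)"
        using c[of k] by (intro mult_left_mono) auto
      also have "\<dots> = \<psi> (d - u) x + c k * \<psi> (p k) x" using ck unfolding t(3) by (simp add: t_def distrib_left)
      finally show ?case by (simp add: H_def B_def algebra_simps)
    qed
  qed
  have wH: "(\<integral>x. H k x \<partial>Q) = w k" for k
    unfolding H_def w_def using \<psi>_int by (simp add: \<psi>_mean)
  have wb: "(\<integral>x. B x \<partial>Q) \<le> w k" "w k \<le> (\<integral>x. \<Delta> x \<partial>Q)" for k
    using integral_mono_AE[OF int(2,3) low] integral_mono_AE[OF int(3,1) up] by (auto simp: wH)
  define b where "b x = \<bar>\<integral>x. B x \<partial>Q\<bar> + \<bar>\<integral>x. \<Delta> x \<partial>Q\<bar> + \<bar>B x\<bar> + \<bar>\<Delta> x\<bar>" for x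
  have lim: "AE x in Q. (\<lambda>k. r k x) \<longlonglongrightarrow> D d u x"
    using deriv
  proof eventually_elim
    case (elim x)
    have "((\<lambda>t. h (d + t *\<^sub>R u) x) has_real_derivative D d u x) (at 0)"
      using has_derivative_directional[of "\<lambda>d. h d x"] elim d by blast
    hence "((\<lambda>t. (h (d + t *\<^sub>R u) x - h d x) / t) \<longlongrightarrow> D d u x) (at 0)"
      by (simp add: has_field_derivative_iff)
    moreover have "filterlim (\<lambda>k. 1 / c k) (at 0) sequentially"
      using LIMSEQ_inverse_real_of_nat c by (auto simp: filterlim_at c_def inverse_eq_divide)
    ultimately have "(\<lambda>k. (h (d + (1 / c k) *\<^sub>R u) x - h d x) / (1 / c k)) \<longlonglongrightarrow> D d u x"
      by (rule filterlim_compose)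
    thus ?case by (simp add: r_def p_def mult.commute)
  qed
  have "(\<lambda>k. \<integral>x. r k x * g d x \<partial>Q) \<longlonglongrightarrow> (\<integral>x. D d u x * g d x \<partial>Q)"
  proof (rule integral_dominated_convergence)
    show "(\<lambda>x. D d u x * g d x) \<in> borel_measurable Q" using D_meas[OF d] by measurable
    show "(\<lambda>x. r k x * g d x) \<in> borel_measurable Q" for k using int(4)[of k] by measurable
    show "integrable Q (\<lambda>x. b x * g d x)" unfolding b_def using int d by (intro g_mult) auto
    show "AE x in Q. (\<lambda>k. r k x * g d x) \<longlonglongrightarrow> D d u x * g d x"
      using lim by eventually_elim (auto intro!: tendsto_intros)
    show "AE x in Q. norm (r k x * g d x) \<le> b x * g d x" for k
      using up[of k] low[of k]
    proof eventually_elim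
      case (elim x)
      have "\<bar>r k x\<bar> \<le> b x" using elim wb[of k] Hr[of k x] unfolding b_def by linarith
      thus ?case by (simp add: abs_mult)
    qed
  qed
  hence m_lim: "(\<lambda>k. \<integral>x. r k x * g d x \<partial>Q) \<longlonglongrightarrow> m d u" by (simp add: m_def)
  have wj: "(\<integral>x. r k x * g d x \<partial>Q) \<le> w k" for k
  proof -
    have "(\<integral>x. r k x * g d x \<partial>Q) = c k * (\<integral>x. (h (p k) x - h d x) * g d x \<partial>Q)"
      by (simp add: r_def mult.assoc)
    also have "\<dots> \<le> c k * (W (p k) - W d)" using jensen[OF d] c by (intro mult_left_mono) (auto simp: less_imp_le)
    finally show ?thesis by (simp add: w_def)
  qed
  have "AE x in Q. \<forall>k. H k x \<le> \<Delta> x" using up by (simp add: AE_all_countable)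
  with lim show ?thesis
  proof eventually_elim
    case (elim x)
    have "(\<lambda>k. (\<integral>x. r k x * g d x \<partial>Q) - r k x) \<longlonglongrightarrow> m d u - D d u x"
      by (intro tendsto_diff m_lim elim)
    moreover have "\<forall>k. (\<integral>x. r k x * g d x \<partial>Q) - r k x \<le> \<Delta> x"
      using wj Hr[of _ x] elim(2) by (smt (verit))
    ultimately have "m d u - D d u x \<le> \<Delta> x" by (intro LIMSEQ_le_const2) auto
    thus ?case by (simp add: \<Delta>_def Y_def)
  qed
qed

text \<open>The loss vanishes at 0, so the tangents at 0 and at \<open>d\<close> enclose it:
  \<open>Y 0 d \<le> \<psi> d \<le> Y d d\<close>. Both ends have second moment at most
  \<open>CY * q d\<close>.\<close>

lemma \<psi>_sq:
  assumes d: "d \<in> S"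
  shows "integrable Q (\<lambda>x. (\<psi> d x)\<^sup>2)" "(\<integral>x. (\<psi> d x)\<^sup>2 \<partial>Q) \<le> 4 * CY * q d"
proof -
  have eq: "(\<psi> d x)\<^sup>2 = (W d)\<^sup>2 - 2 * W d * h d x + (h d x)\<^sup>2" for x
    by (simp add: loss_def power2_eq_square algebra_simps)
  show i: "integrable Q (\<lambda>x. (\<psi> d x)\<^sup>2)" unfolding eq using h_int h_sq by simp
  have "AE x in Q. (\<psi> d x)\<^sup>2 \<le> 2 * (Y d d x)\<^sup>2 + 2 * (Y 0 d x)\<^sup>2"
    using tangent[OF d, of "- d"] tangent[OF S(2), of d] Y_linear[OF d]
  proof eventually_elim
    case (elim x)
    have "Y d (- d) x = - Y d d x" by (rule linear_neg[OF elim(3)])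
    hence "\<psi> d x \<le> Y d d x" "Y 0 d x \<le> \<psi> d x" using elim by (auto simp: \<psi>_zero)
    hence "\<bar>\<psi> d x\<bar> \<le> \<bar>Y d d x\<bar> + \<bar>Y 0 d x\<bar>" by linarith
    hence "\<bar>\<psi> d x\<bar>\<^sup>2 \<le> (\<bar>Y d d x\<bar> + \<bar>Y 0 d x\<bar>)\<^sup>2" by (intro power_mono) auto
    also have "\<dots> \<le> 2 * (Y d d x)\<^sup>2 + 2 * (Y 0 d x)\<^sup>2"
      using sum_squares_bound[of "\<bar>Y d d x\<bar>" "\<bar>Y 0 d x\<bar>"] by (simp add: power2_sum)
    finally show ?case by simp
  qed
  hence "(\<integral>x. (\<psi> d x)\<^sup>2 \<partial>Q) \<le> (\<integral>x. 2 * (Y d d x)\<^sup>2 + 2 * (Y 0 d x)\<^sup>2 \<partial>Q)"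
    using Y_sq(1)[OF d] Y_sq(1)[OF S(2)] i by (intro integral_mono_AE) auto
  also have "\<dots> = 2 * (\<integral>x. (Y d d x)\<^sup>2 \<partial>Q) + 2 * (\<integral>x. (Y 0 d x)\<^sup>2 \<partial>Q)"
    using Y_sq(1)[OF d] Y_sq(1)[OF S(2)] by simp
  also have "\<dots> \<le> 4 * CY * q d" using Y_sq(2)[OF d, of d] Y_sq(2)[OF S(2), of d] by simp
  finally show "(\<integral>x. (\<psi> d x)\<^sup>2 \<partial>Q) \<le> 4 * CY * q d" .
qed

lemma h_sq_le: "d \<in> S \<Longrightarrow> (\<integral>x. (h d x)\<^sup>2 \<partial>Q) \<le> 4 * CY * q d"
proof -
  assume d: "d \<in> S"
  have eq: "(\<psi> d x)\<^sup>2 = (W d)\<^sup>2 - 2 * W d * h d x + (h d x)\<^sup>2" for x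
    by (simp add: loss_def power2_eq_square algebra_simps)
  have "(\<integral>x. (\<psi> d x)\<^sup>2 \<partial>Q) = (W d)\<^sup>2 + (\<integral>x. (h d x)\<^sup>2 \<partial>Q)"
    unfolding eq using h_int h_sq h_mean by (simp add: prob_space)
  thus ?thesis using \<psi>_sq(2)[OF d] zero_le_power2[of "W d"] by linarith
qed

text \<open>A function centred under the base law sees only \<open>g d - 1\<close>, and this is at
  most \<open>\<kappa>\<close> times the absolute loss, whose second moment is of order
  \<open>q d\<close>. Tilted means of centred functions are therefore small near the truth.\<close>

lemma tilted_mean_le:
  fixes f :: "'x \<Rightarrow> real"
  assumes d: "d \<in> S" and f [measurable]: "f \<in> borel_measurable Q" and sq: "integrable Q (\<lambda>x. (f x)\<^sup>2)"
    and mean: "(\<integral>x. f x \<partial>Q) = 0"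
  shows "\<bar>\<integral>x. f x * g d x \<partial>Q\<bar> \<le> \<kappa> * sqrt (4 * CY * q d) * sqrt (\<integral>x. (f x)\<^sup>2 \<partial>Q)"
proof -
  have fi: "integrable Q f" by (rule square_integrable_imp_integrable[OF f sq])
  have fg: "integrable Q (\<lambda>x. f x * g d x)" by (rule g_mult(1)[OF fi d])
  have i: "integrable Q (\<lambda>x. \<bar>f x\<bar> * \<bar>\<psi> d x\<bar>)"
    using sq \<psi>_sq(1)[OF d] by (intro square_integrable_mult(1)) auto
  have ae: "AE x in Q. \<bar>f x * (g d x - 1)\<bar> \<le> \<kappa> * (\<bar>f x\<bar> * \<bar>\<psi> d x\<bar>)"
    using ratio[OF d]
  proof eventually_elim
    case (elim x)
    have "\<bar>g d x - 1\<bar> \<le> \<kappa> * \<bar>\<psi> d x\<bar>"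
    proof (cases "\<psi> d x \<ge> 0")
      case True
      have "1 - g d x \<le> \<psi> d x" using exp_ge_add_one_self[of "- \<psi> d x"] by simp
      moreover have "g d x \<le> 1" using True by simp
      moreover have "1 * \<psi> d x \<le> \<kappa> * \<psi> d x" using True \<kappa> by (intro mult_right_mono) auto
      ultimately show ?thesis using True by simp
    next
      case False
      have "g d x * (1 - exp (\<psi> d x)) \<le> g d x * (- \<psi> d x)"
        using exp_ge_add_one_self[of "\<psi> d x"] by (intro mult_left_mono) (linarith, simp)
      also have "\<dots> \<le> \<kappa> * (- \<psi> d x)" using elim False by (intro mult_right_mono) auto
      also have "g d x * (1 - exp (\<psi> d x)) = g d x - 1" by (simp add: right_diff_distrib exp_add[symmetric])
      finally show ?thesis using False by simp
    qed
    hence "\<bar>f x\<bar> * \<bar>g d x - 1\<bar> \<le> \<bar>f x\<bar> * (\<kappa> * \<bar>\<psi> d x\<bar>)" by (intro mult_left_mono) auto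
    thus ?case by (simp add: abs_mult mult_ac)
  qed
  have "(\<integral>x. f x * g d x \<partial>Q) = (\<integral>x. f x * (g d x - 1) \<partial>Q)"
    using fg fi mean by (simp add: right_diff_distrib)
  also have "\<bar>\<dots>\<bar> \<le> (\<integral>x. \<bar>f x * (g d x - 1)\<bar> \<partial>Q)" using integral_abs_bound by blast
  also have "\<dots> \<le> (\<integral>x. \<kappa> * (\<bar>f x\<bar> * \<bar>\<psi> d x\<bar>) \<partial>Q)"
    using fg fi i ae by (intro integral_mono_AE) (auto simp: right_diff_distrib)
  also have "\<dots> = \<kappa> * (\<integral>x. \<bar>f x\<bar> * \<bar>\<psi> d x\<bar> \<partial>Q)" by simp
  also have "(\<integral>x. \<bar>f x\<bar> * \<bar>\<psi> d x\<bar> \<partial>Q) \<le> sqrt (\<integral>x. (f x)\<^sup>2 \<partial>Q) * sqrt (\<integral>x. (\<psi> d x)\<^sup>2 \<partial>Q)"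
    using square_integrable_mult(3)[of "\<lambda>x. \<bar>f x\<bar>" "\<lambda>x. \<bar>\<psi> d x\<bar>"] sq \<psi>_sq(1)[OF d] by simp
  also have "\<dots> \<le> sqrt (\<integral>x. (f x)\<^sup>2 \<partial>Q) * sqrt (4 * CY * q d)"
    using \<psi>_sq(2)[OF d] by (intro mult_left_mono) auto
  finally show ?thesis using \<kappa> by (simp add: mult_ac)
qed

lemma m_le:
  assumes d: "d \<in> S" shows "\<bar>m d u\<bar> \<le> 2 * \<kappa> * CY * sqrt (q d) * sqrt (q u)"
proof -
  have "\<bar>m d u\<bar> \<le> \<kappa> * sqrt (4 * CY * q d) * sqrt (\<integral>x. (D d u x)\<^sup>2 \<partial>Q)"
    unfolding m_def by (rule tilted_mean_le[OF d D_meas[OF d] D_sq[OF d] D_mean[OF d]])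
  also have "\<dots> \<le> \<kappa> * sqrt (4 * CY * q d) * sqrt (CY * q u)"
  proof (intro mult_left_mono real_sqrt_le_mono)
    have "C2 * 1 \<le> CY" unfolding CY_def using C2 by (intro mult_left_mono) auto
    hence "C2 * q u \<le> CY * q u" using q_nonneg by (intro mult_right_mono) auto
    thus "(\<integral>x. (D d u x)\<^sup>2 \<partial>Q) \<le> CY * q u" using D_upper[OF d, of u] by simp
  qed (use \<kappa> CY q_nonneg in auto)
  also have "\<dots> = 2 * \<kappa> * CY * sqrt (q d) * sqrt (q u)"
    using CY by (simp add: real_sqrt_mult)
  finally show ?thesis .
qed

text \<open>The integral is the symmetrised divergence of the two laws, because \<open>h d\<close>
  is centred under the base law. Both factors in \<open>tilted_mean_le\<close> are of order
  \<open>sqrt (q d)\<close>.\<close>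

lemma skl_le:
  assumes d: "d \<in> S" shows "\<bar>\<integral>x. h d x * g d x \<partial>Q\<bar> \<le> 4 * \<kappa> * CY * q d"
proof -
  have "\<bar>\<integral>x. h d x * g d x \<partial>Q\<bar> \<le> \<kappa> * sqrt (4 * CY * q d) * sqrt (\<integral>x. (h d x)\<^sup>2 \<partial>Q)"
    by (rule tilted_mean_le[OF d h_meas h_sq h_mean])
  also have "\<dots> \<le> \<kappa> * sqrt (4 * CY * q d) * sqrt (4 * CY * q d)"
    using h_sq_le[OF d] \<kappa> CY q_nonneg by (intro mult_left_mono) auto
  also have "\<dots> = 4 * \<kappa> * CY * q d" using CY q_nonneg by simp
  finally show ?thesis .
qed

text \<open>The tangent at \<open>d\<close> is evaluated at 0, where the loss vanishes, and
  integrated.\<close>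

lemma W_le_m: assumes d: "d \<in> S" shows "W d \<le> m d d"
proof -
  have "(\<integral>x. Y d (- d) x \<partial>Q) \<le> (\<integral>x. \<psi> 0 x - \<psi> d x \<partial>Q)"
    using tangent[OF d, of "- d"] Y_int[OF d] \<psi>_int by (intro integral_mono_AE) auto
  thus ?thesis using \<psi>_int by (simp add: Y_mean[OF d] linear_neg[OF m_linear[OF d]] \<psi>_mean W_zero)
qed


section \<open>Strong convexity of the cumulant function along segments\<close>

text \<open>A Jensen inequality with quadratic gain: for bounded ratios
  \<open>exp (- p) - 1 + p\<close> is at least \<open>p\<^sup>2 / (2 * \<kappa>\<^sup>2)\<close>.
  The gap \<open>G\<close> between \<open>p\<close> and its tangent is non-negative, so it can be
  moved from the tilted law to the base law at the cost of a factor \<open>\<kappa>\<close>; moving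
  the second moment of \<open>p\<close> costs another one, which gives
  \<open>\<kappa> ^ 4\<close>.\<close>

lemma W_second_order:
  assumes d: "d \<in> S" and s: "0 \<le> s" "s \<le> 1" and t: "0 \<le> t" "t \<le> 1"
  shows "W (s *\<^sub>R d) \<ge> W (t *\<^sub>R d) + (s - t) * m (t *\<^sub>R d) d
    + 1 / (2 * \<kappa> ^ 4) * (\<integral>x. (h (s *\<^sub>R d) x - h (t *\<^sub>R d) x)\<^sup>2 \<partial>Q)"
proof -
  have seg: "r *\<^sub>R d \<in> S" if "0 \<le> r" "r \<le> 1" for r
    using convexD[OF S(1) S(2) d, of "1 - r" r] that by simp
  let ?s = "s *\<^sub>R d" and ?t = "t *\<^sub>R d"
  have sS: "?s \<in> S" and tS: "?t \<in> S" using seg s t by auto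
  define p where "p x = \<psi> ?s x - \<psi> ?t x" for x
  have pi: "integrable Q p" unfolding p_def using \<psi>_int by simp
  define G where "G x = p x - (s - t) * Y ?t d x" for x
  have Gi: "integrable Q G" unfolding G_def using pi Y_int[OF tS] by simp
  have st: "?t + (s - t) *\<^sub>R d = ?s" by (simp add: algebra_simps)
  have G0: "AE x in Q. 0 \<le> G x"
    using tangent[OF tS, of "(s - t) *\<^sub>R d"] Y_linear[OF tS]
  proof eventually_elim
    case (elim x)
    have "Y ?t ((s - t) *\<^sub>R d) x = (s - t) * Y ?t d x"
      using linear_cmul[OF elim(2)] by simp
    thus ?case using elim(1) by (simp add: G_def p_def st)
  qed
  have GI: "(\<integral>x. G x \<partial>Q) = W ?s - W ?t - (s - t) * m ?t d"
    unfolding G_def p_def using \<psi>_int Y_int[OF tS] by (simp add: \<psi>_mean Y_mean[OF tS])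
  \<comment> \<open>The tangent term drops out because \<open>Y\<close> is centred under the tilted
    law.\<close>
  have Geq: "(\<integral>x. G x * g ?t x \<partial>Q) = (\<integral>x. p x * g ?t x \<partial>Q)"
  proof -
    have "(\<lambda>x. G x * g ?t x) = (\<lambda>x. p x * g ?t x - (s - t) * (Y ?t d x * g ?t x))"
      by (simp add: G_def algebra_simps)
    thus ?thesis using g_mult(1)[OF pi tS] g_mult(1)[OF Y_int[OF tS] tS] Y_mean_tilted[OF tS] by simp
  qed
  have p2: "integrable Q (\<lambda>x. (p x)\<^sup>2)"
  proof -
    have "(\<lambda>x. (p x)\<^sup>2) = (\<lambda>x. (\<psi> ?s x + - \<psi> ?t x)\<^sup>2)" by (simp add: p_def)
    thus ?thesis using square_integrable_mult(2)[of "\<psi> ?s" "\<lambda>x. - \<psi> ?t x"] \<psi>_sq(1)[OF sS] \<psi>_sq(1)[OF tS] by simp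
  qed
  have ae: "AE x in Q. (p x)\<^sup>2 * g ?t x / (2 * \<kappa>\<^sup>2) \<le> g ?s x - g ?t x + p x * g ?t x"
    using ratio[OF sS] ratio[OF tS]
  proof eventually_elim
    case (elim x)
    have gs: "g ?s x = g ?t x * exp (- p x)" by (simp add: p_def exp_add[symmetric])
    have "\<kappa> * g ?t x \<ge> 1" using elim \<kappa> by (simp add: field_simps)
    \<comment> \<open>The remainder \<open>exp (- p) - 1 + p\<close> loses its quadratic growth only
      for large positive \<open>p\<close>, and the density ratios keep \<open>p x\<close> below
      \<open>2 * ln \<kappa>\<close>.\<close>
    have "exp (p x) = g ?t x / g ?s x" by (simp add: p_def exp_diff[symmetric])
    also have "\<dots> \<le> \<kappa> / (1 / \<kappa>)" using elim \<kappa> by (intro frac_le) auto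
    finally have ep: "exp (p x) \<le> \<kappa>\<^sup>2" by (simp add: power2_eq_square)
    have "(p x)\<^sup>2 / (2 * \<kappa>\<^sup>2) \<le> exp (- p x) - 1 + p x"
    proof (cases "p x \<le> 0")
      case True
      have "1 + (- p x) + (- p x)\<^sup>2 / 2 \<le> exp (- p x)" using True by (intro exp_lower_Taylor_quadratic) simp
      hence "(p x)\<^sup>2 / 2 \<le> exp (- p x) - 1 + p x" by simp
      moreover have "(p x)\<^sup>2 / (2 * \<kappa>\<^sup>2) \<le> (p x)\<^sup>2 / (2 * 1)"
        using \<kappa> by (intro divide_left_mono) (auto simp: one_le_power)
      ultimately show ?thesis by simp
    next
      case False
      \<comment> \<open>Replacing the curvature of \<open>exp (- y)\<close> by its minimum over the
        interval from 0 to \<open>p x\<close>, the value \<open>exp (- p x)\<close>, makes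
        \<open>F\<close> monotone there.\<close>
      define F where "F y = exp (- y) - 1 + y - y\<^sup>2 / 2 * exp (- p x)" for y
      have "F 0 \<le> F (p x)"
      proof (rule DERIV_nonneg_imp_nondecreasing[where f = F and a = 0 and b = "p x"])
        show "0 \<le> p x" using False by simp
        fix y assume y: "0 \<le> y" "y \<le> p x"
        have "(F has_real_derivative (1 - exp (- y) - y * exp (- p x))) (at y)"
          unfolding F_def by (auto intro!: derivative_eq_intros)
        moreover have "y * exp (- p x) \<le> 1 - exp (- y)"
        proof -
          have "exp (- y) * (1 + y) \<le> exp (- y) * exp y"
            using exp_ge_add_one_self[of y] by (intro mult_left_mono) auto
          hence "y * exp (- y) \<le> 1 - exp (- y)" by (simp add: exp_add[symmetric] algebra_simps)
          moreover have "y * exp (- p x) \<le> y * exp (- y)" using y by (intro mult_left_mono) auto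
          ultimately show ?thesis by linarith
        qed
        ultimately show "\<exists>z. (F has_real_derivative z) (at y) \<and> 0 \<le> z"
          by (intro exI[of _ "1 - exp (- y) - y * exp (- p x)"]) auto
      qed
      hence "(p x)\<^sup>2 / 2 * exp (- p x) \<le> exp (- p x) - 1 + p x" by (simp add: F_def)
      moreover have "(p x)\<^sup>2 / (2 * \<kappa>\<^sup>2) \<le> (p x)\<^sup>2 / 2 * exp (- p x)"
      proof -
        have "1 / \<kappa>\<^sup>2 \<le> 1 / exp (p x)" using ep \<kappa> by (intro divide_left_mono) auto
        hence "(p x)\<^sup>2 / 2 * (1 / \<kappa>\<^sup>2) \<le> (p x)\<^sup>2 / 2 * exp (- p x)"
          by (intro mult_left_mono) (auto simp: exp_minus inverse_eq_divide)
        thus ?thesis by simp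
      qed
      ultimately show ?thesis by linarith
    qed
    hence "g ?t x * ((p x)\<^sup>2 / (2 * \<kappa>\<^sup>2)) \<le> g ?t x * (exp (- p x) - 1 + p x)"
      by (intro mult_left_mono) auto
    thus ?case unfolding gs by (simp add: algebra_simps)
  qed
  have p2g: "integrable Q (\<lambda>x. (p x)\<^sup>2 * g ?t x)" by (rule g_mult(1)[OF p2 tS])
  have "(\<integral>x. (p x)\<^sup>2 * g ?t x / (2 * \<kappa>\<^sup>2) \<partial>Q) \<le> (\<integral>x. g ?s x - g ?t x + p x * g ?t x \<partial>Q)"
    using p2g g_int g_mult(1)[OF pi tS] ae by (intro integral_mono_AE) auto
  also have "\<dots> = (\<integral>x. p x * g ?t x \<partial>Q)" using g_int g_mult(1)[OF pi tS] by (simp add: g_mean)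
  finally have 1: "(\<integral>x. (p x)\<^sup>2 * g ?t x \<partial>Q) / (2 * \<kappa>\<^sup>2) \<le> (\<integral>x. G x * g ?t x \<partial>Q)" unfolding Geq by simp
  have 2: "(\<integral>x. (p x)\<^sup>2 \<partial>Q) \<le> \<kappa> * (\<integral>x. (p x)\<^sup>2 * g ?t x \<partial>Q)"
    by (rule g_mult_nonneg(2)[OF p2 _ tS]) simp
  have 3: "(\<integral>x. G x * g ?t x \<partial>Q) \<le> \<kappa> * (\<integral>x. G x \<partial>Q)" by (rule g_mult_nonneg(1)[OF Gi G0 tS])
  have 4: "(\<integral>x. (h ?s x - h ?t x)\<^sup>2 \<partial>Q) \<le> (\<integral>x. (p x)\<^sup>2 \<partial>Q)"
  proof -
    define w where "w = W ?s - W ?t"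
    have eq: "(p x)\<^sup>2 = w\<^sup>2 - 2 * w * (h ?s x - h ?t x) + (h ?s x - h ?t x)\<^sup>2" for x
      by (simp add: p_def w_def loss_def power2_eq_square algebra_simps)
    have "integrable Q (\<lambda>x. (h ?s x + - h ?t x)\<^sup>2)"
      using square_integrable_mult(2)[of "h ?s" "\<lambda>x. - h ?t x"] h_sq by simp
    hence "(\<integral>x. (p x)\<^sup>2 \<partial>Q) = w\<^sup>2 + (\<integral>x. (h ?s x - h ?t x)\<^sup>2 \<partial>Q)"
      unfolding eq using h_int by (simp add: h_mean prob_space)
    thus ?thesis by simp
  qed
  have "1 / (2 * \<kappa> ^ 4) * (\<integral>x. (h ?s x - h ?t x)\<^sup>2 \<partial>Q) \<le> 1 / (2 * \<kappa> ^ 4) * (\<kappa> * (\<integral>x. (p x)\<^sup>2 * g ?t x \<partial>Q))"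
    using 2 4 \<kappa> by (intro mult_left_mono) auto
  also have "\<dots> = 1 / \<kappa> * ((\<integral>x. (p x)\<^sup>2 * g ?t x \<partial>Q) / (2 * \<kappa>\<^sup>2))"
    using \<kappa> by (simp add: power2_eq_square power4_eq_xxxx)
  also have "\<dots> \<le> 1 / \<kappa> * (\<kappa> * (\<integral>x. G x \<partial>Q))" using 1 3 \<kappa> by (intro mult_left_mono) auto
  also have "\<dots> = (\<integral>x. G x \<partial>Q)" using \<kappa> by simp
  finally show ?thesis unfolding GI by simp
qed

text \<open>Pointwise differentiability and Fatou's lemma turn the previous bound into strong convexity of
  \<open>W\<close> along the segment from 0 to \<open>d\<close>, but only near each point; a maximum argument globalises it.\<close>

lemma W_ge:
  assumes d: "d \<in> S" shows "W d \<ge> C1 / (8 * \<kappa> ^ 4) * q d"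
proof (cases "q d = 0")
  case True thus ?thesis using W_nonneg by simp
next
  case False
  with q_nonneg[of d] have q: "q d > 0" by simp
  \<comment> \<open>The constant \<open>1 / (2 * \<kappa> ^ 4)\<close> of
    \<open>W_second_order\<close> times half of the bound \<open>C1 * q d\<close>; the other half
    pays for turning a lower limit into an eventual inequality.\<close>
  define a where "a = C1 / (4 * \<kappa> ^ 4) * q d"
  have a: "a > 0" unfolding a_def using q C1 \<kappa> by simp
  have seg: "r *\<^sub>R d \<in> S" if "0 \<le> r" "r \<le> 1" for r
    using convexD[OF S(1) S(2) d, of "1 - r" r] that by simp
  define \<omega> where "\<omega> s = W (s *\<^sub>R d)" for s
  have local: "eventually (\<lambda>s. \<omega> s \<ge> \<omega> t + (s - t) * m (t *\<^sub>R d) d + a * (s - t)\<^sup>2) (at t within {0..1})"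
    if t: "0 \<le> t" "t \<le> 1" for t
  proof (rule sequentially_imp_eventually_within, intro allI impI)
    fix f :: "nat \<Rightarrow> real" assume f: "(\<forall>n. f n \<in> {0..1} \<and> f n \<noteq> t) \<and> f \<longlonglongrightarrow> t"
    have tS: "t *\<^sub>R d \<in> S" using seg t by simp
    define F where "F n x = (h (f n *\<^sub>R d) x - h (t *\<^sub>R d) x) / (f n - t)" for n x
    have Fm [measurable]: "F n \<in> borel_measurable Q" for n unfolding F_def by measurable
    have lim: "AE x in Q. (\<lambda>n. F n x) \<longlonglongrightarrow> D (t *\<^sub>R d) d x"
      using deriv
    proof eventually_elim
      case (elim x)
      have "((\<lambda>r. h (t *\<^sub>R d + r *\<^sub>R d) x) has_real_derivative D (t *\<^sub>R d) d x) (at 0)"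
        using has_derivative_directional[of "\<lambda>d. h d x"] elim tS by blast
      hence "((\<lambda>r. (h (t *\<^sub>R d + r *\<^sub>R d) x - h (t *\<^sub>R d) x) / r) \<longlongrightarrow> D (t *\<^sub>R d) d x) (at 0)"
        by (simp add: has_field_derivative_iff)
      moreover have "filterlim (\<lambda>n. f n - t) (at 0) sequentially"
        using f by (auto simp: filterlim_at LIM_zero)
      ultimately have "(\<lambda>n. (h (t *\<^sub>R d + (f n - t) *\<^sub>R d) x - h (t *\<^sub>R d) x) / (f n - t)) \<longlonglongrightarrow> D (t *\<^sub>R d) d x"
        by (rule filterlim_compose)
      thus ?case by (simp add: F_def scaleR_left_diff_distrib)
    qed
    have "ennreal (C1 * q d) \<le> ennreal (\<integral>x. (D (t *\<^sub>R d) d x)\<^sup>2 \<partial>Q)"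
      by (intro ennreal_leI D_lower tS)
    also have "\<dots> = (\<integral>\<^sup>+x. ennreal ((D (t *\<^sub>R d) d x)\<^sup>2) \<partial>Q)"
      using D_sq[OF tS] by (intro nn_integral_eq_integral[symmetric]) auto
    also have "\<dots> = (\<integral>\<^sup>+x. liminf (\<lambda>n. ennreal ((F n x)\<^sup>2)) \<partial>Q)"
    proof (rule nn_integral_cong_AE)
      show "AE x in Q. ennreal ((D (t *\<^sub>R d) d x)\<^sup>2) = liminf (\<lambda>n. ennreal ((F n x)\<^sup>2))"
        using lim
      proof eventually_elim
        case (elim x)
        have "(\<lambda>n. ennreal ((F n x)\<^sup>2)) \<longlonglongrightarrow> ennreal ((D (t *\<^sub>R d) d x)\<^sup>2)"
          by (intro tendsto_intros elim)
        thus ?case using lim_imp_Liminf[of sequentially] by (metis sequentially_bot)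
      qed
    qed
    also have "\<dots> \<le> liminf (\<lambda>n. \<integral>\<^sup>+x. ennreal ((F n x)\<^sup>2) \<partial>Q)"
      by (rule nn_integral_liminf) measurable
    finally have le: "ennreal (C1 * q d) \<le> liminf (\<lambda>n. \<integral>\<^sup>+x. ennreal ((F n x)\<^sup>2) \<partial>Q)" .
    have "ennreal (C1 * q d / 2) < ennreal (C1 * q d)" using C1 q by (intro ennreal_lessI) auto
    from less_LiminfD[OF order.strict_trans2[OF this le]]
    show "eventually (\<lambda>n. \<omega> (f n) \<ge> \<omega> t + (f n - t) * m (t *\<^sub>R d) d + a * (f n - t)\<^sup>2) sequentially"
    proof eventually_elim
      case (elim n)
      let ?I = "\<integral>x. (h (f n *\<^sub>R d) x - h (t *\<^sub>R d) x)\<^sup>2 \<partial>Q"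
      have fn: "0 \<le> f n" "f n \<le> 1" "f n \<noteq> t" using f by auto
      have hi: "integrable Q (\<lambda>x. (h (f n *\<^sub>R d) x - h (t *\<^sub>R d) x)\<^sup>2)"
        using square_integrable_mult(2)[of "h (f n *\<^sub>R d)" "\<lambda>x. - h (t *\<^sub>R d) x"] h_sq by simp
      have "(\<integral>\<^sup>+x. ennreal ((F n x)\<^sup>2) \<partial>Q) = ennreal (\<integral>x. (F n x)\<^sup>2 \<partial>Q)"
        unfolding F_def power_divide using hi by (intro nn_integral_eq_integral) auto
      hence "C1 * q d / 2 < (\<integral>x. (F n x)\<^sup>2 \<partial>Q)" using elim by (simp add: ennreal_less_iff C1 q less_imp_le)
      also have "\<dots> = ?I / (f n - t)\<^sup>2" by (simp add: F_def power_divide)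
      finally have "C1 * q d / 2 * (f n - t)\<^sup>2 \<le> ?I" using fn by (simp add: field_simps)
      hence "1 / (2 * \<kappa> ^ 4) * (C1 * q d / 2 * (f n - t)\<^sup>2) \<le> 1 / (2 * \<kappa> ^ 4) * ?I"
        using \<kappa> by (intro mult_left_mono) auto
      moreover have "1 / (2 * \<kappa> ^ 4) * (C1 * q d / 2 * (f n - t)\<^sup>2) = a * (f n - t)\<^sup>2" by (simp add: a_def)
      ultimately show ?case using W_second_order[OF d fn(1,2) t] unfolding \<omega>_def by linarith
    qed
  qed
  \<comment> \<open>Only half of the local curvature is subtracted, so near each of its points
    \<open>F\<close> still lies strictly above an affine function. A maximum over the unit interval
    can then only sit at 1, since elsewhere a move in a direction of non-negative slope would
    increase \<open>F\<close>. At 0 the slope is 0, which permits the move to the right.\<close>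
  define F where "F s = \<omega> s - a / 2 * s\<^sup>2" for s
  have "convex_on UNIV \<omega>"
  proof (rule convex_onI)
    fix t x y :: real assume t: "0 < t" "t < 1"
    show "\<omega> ((1 - t) *\<^sub>R x + t *\<^sub>R y) \<le> (1 - t) * \<omega> x + t * \<omega> y"
      using W_convex[of t "x *\<^sub>R d" "y *\<^sub>R d"] t by (simp add: \<omega>_def scaleR_add_left)
  qed simp
  hence "continuous_on UNIV \<omega>" by (intro convex_on_continuous) auto
  hence "continuous_on {0..1} F" unfolding F_def
    by (intro continuous_intros) (auto intro: continuous_on_subset)
  then obtain t where t: "t \<in> {0..1}" and tmax: "\<And>s. s \<in> {0..1} \<Longrightarrow> F s \<le> F t"
    using continuous_attains_sup[of "{0..1::real}" F] by auto
  have m0: "m 0 d = 0" unfolding m_def using D_mean[OF S(2)] by (simp add: \<psi>_zero)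
  have F_local: "eventually (\<lambda>s. F s > F t + (s - t) * (m (t *\<^sub>R d) d - a * t)) (at t within {0..1})"
  proof -
    have "eventually (\<lambda>s. s \<noteq> t) (at t within {0..1})" by (simp add: eventually_at_filter)
    moreover have "eventually (\<lambda>s. \<omega> s \<ge> \<omega> t + (s - t) * m (t *\<^sub>R d) d + a * (s - t)\<^sup>2) (at t within {0..1})"
      using local[of t] t by simp
    ultimately show ?thesis
    proof eventually_elim
      case (elim s)
      have "F t + (s - t) * (m (t *\<^sub>R d) d - a * t) + a / 2 * (s - t)\<^sup>2 \<le> F s"
        using elim(2) unfolding F_def by (simp add: power2_eq_square field_simps)
      moreover have "a / 2 * (s - t)\<^sup>2 > 0" using a elim(1) by simp
      ultimately show ?case by linarith
    qed
  qed
  have "t = 1"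
  proof (rule ccontr)
    assume "t \<noteq> 1"
    with t have t1: "0 \<le> t" "t < 1" by auto
    let ?c = "m (t *\<^sub>R d) d - a * t"
    obtain \<delta> where \<delta>: "\<delta> > 0"
      and near: "\<And>s. s \<in> {0..1} \<Longrightarrow> s \<noteq> t \<Longrightarrow> dist s t < \<delta> \<Longrightarrow> F s > F t + (s - t) * ?c"
      using F_local unfolding eventually_at by blast
    show False
    proof (cases "?c \<ge> 0")
      case True
      define s where "s = t + min (\<delta> / 2) (1 - t)"
      have s: "s \<in> {0..1}" "s \<noteq> t" "dist s t < \<delta>" "s - t \<ge> 0"
        using \<delta> t1 by (auto simp: s_def dist_real_def min_def)
      have "(s - t) * ?c \<ge> 0" using s True by simp
      thus False using near[OF s(1-3)] tmax[OF s(1)] by linarith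
    next
      case False
      have "t \<noteq> 0" using False m0 by auto
      define s where "s = t - min (\<delta> / 2) t"
      have s: "s \<in> {0..1}" "s \<noteq> t" "dist s t < \<delta>" "s - t \<le> 0"
        using \<delta> t1 \<open>t \<noteq> 0\<close> by (auto simp: s_def dist_real_def min_def)
      have "(s - t) * ?c \<ge> 0" using s False by (simp add: mult_nonpos_nonpos)
      thus False using near[OF s(1-3)] tmax[OF s(1)] by linarith
    qed
  qed
  hence "F 1 \<ge> F 0" using tmax[of 0] by simp
  thus ?thesis by (simp add: F_def \<omega>_def W_zero a_def)
qed

section \<open>Tangent bounds uniform over the neighbourhood\<close>

lemma m_bounded_linear: assumes d: "d \<in> S" shows "bounded_linear (m d)"
proof -
  obtain C where C: "\<And>u. q u \<le> C * (norm u)\<^sup>2" using q_le by blast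
  have "\<bar>m d u\<bar> \<le> norm u * (2 * \<kappa> * CY * sqrt (q d) * sqrt C)" for u
  proof -
    have "sqrt (q u) \<le> sqrt (C * (norm u)\<^sup>2)" by (intro real_sqrt_le_mono C)
    hence "2 * \<kappa> * CY * sqrt (q d) * sqrt (q u) \<le> 2 * \<kappa> * CY * sqrt (q d) * (sqrt C * norm u)"
      using \<kappa> CY q_nonneg by (intro mult_left_mono) (auto simp: real_sqrt_mult)
    thus ?thesis using m_le[OF d, of u] by (simp add: mult_ac)
  qed
  thus ?thesis using m_linear[OF d]
    by (intro bounded_linear_intro[of _ "2 * \<kappa> * CY * sqrt (q d) * sqrt C"]) (auto simp: linear_add linear_cmul)
qed

lemma \<psi>_abs_le: assumes d: "d \<in> S" shows "AE x in Q. \<bar>\<psi> d x\<bar> \<le> ln \<kappa>"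
  using ratio[OF d]
proof eventually_elim
  case (elim x)
  have "ln (1 / \<kappa>) \<le> - \<psi> d x" "- \<psi> d x \<le> ln \<kappa>"
    using elim \<kappa> ln_le_cancel_iff[of "1 / \<kappa>" "g d x"] ln_le_cancel_iff[of "g d x" \<kappa>] by auto
  thus ?case using \<kappa> by (simp add: ln_div)
qed

text \<open>Bounded density ratios make \<open>h = W - \<psi>\<close> at most
  \<open>2 * ln \<kappa>\<close>, so a constant dominates the exponentials.\<close>

lemma W_tendsto:
  assumes v: "\<And>k :: nat. v k \<in> S" "d \<in> S" "v \<longlonglongrightarrow> d" shows "(\<lambda>k. W (v k)) \<longlonglongrightarrow> W d"
proof -
  have Wle: "W d \<le> ln \<kappa>" if "d \<in> S" for d
  proof -
    have "AE x in Q. \<psi> d x \<le> ln \<kappa>" using \<psi>_abs_le[OF that] by eventually_elim simp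
    thus ?thesis using integral_mono_AE[OF \<psi>_int, of "\<lambda>_. ln \<kappa>" d] by (simp add: \<psi>_mean prob_space)
  qed
  have "(\<lambda>k. \<integral>x. exp (h (v k) x) \<partial>Q) \<longlonglongrightarrow> (\<integral>x. exp (h d x) \<partial>Q)"
  proof (rule integral_dominated_convergence[where w = "\<lambda>_. exp (2 * ln \<kappa>)"])
    show "AE x in Q. (\<lambda>k. exp (h (v k) x)) \<longlonglongrightarrow> exp (h d x)"
      using deriv
    proof eventually_elim
      case (elim x)
      hence "isCont (\<lambda>d. h d x) d" using v(2) has_derivative_continuous by blast
      thus ?case using v(3) by (intro tendsto_exp) (rule isCont_tendsto_compose)
    qed
    show "AE x in Q. norm (exp (h (v k) x)) \<le> exp (2 * ln \<kappa>)" for k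
      using \<psi>_abs_le[OF v(1)[of k]] by eventually_elim (use Wle[OF v(1)[of k]] in \<open>simp add: loss_def\<close>)
  qed auto
  thus ?thesis unfolding cgf_def using exp_h_ge_1[of d] by (intro tendsto_ln) auto
qed

text \<open>The estimator is random, so one null set has to serve all \<open>v\<close> in
  \<open>S\<close>: the inequality is collected over a countable dense subset and extended by
  continuity in \<open>v\<close> at fixed \<open>x\<close>. The floor holds because both losses are
  at most \<open>ln \<kappa>\<close> in absolute value; it is what allows the tangent to be
  truncated from below later.\<close>

lemma uniform_tangent:
  assumes d: "d \<in> S"
  shows "AE x in Q. \<forall>v\<in>S. \<psi> v x - \<psi> d x \<ge> max (Y d (v - d) x) (- 2 * ln \<kappa>)"
proof -
  obtain T where T: "countable T" "T \<subseteq> S" "S \<subseteq> closure T" using separable by blast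
  have "AE x in Q. \<forall>v\<in>T. \<psi> v x - \<psi> d x \<ge> Y d (v - d) x \<and> \<bar>\<psi> v x\<bar> \<le> ln \<kappa>"
  proof (subst AE_ball_countable[OF T(1)], intro ballI)
    fix v assume "v \<in> T"
    hence "v \<in> S" using T by blast
    have "AE x in Q. \<psi> v x - \<psi> d x \<ge> Y d (v - d) x" using tangent[OF d, of "v - d"] by simp
    with \<psi>_abs_le[OF \<open>v \<in> S\<close>]
    show "AE x in Q. \<psi> v x - \<psi> d x \<ge> Y d (v - d) x \<and> \<bar>\<psi> v x\<bar> \<le> ln \<kappa>" by eventually_elim simp
  qed
  with deriv \<psi>_abs_le[OF d] show ?thesis
  proof eventually_elim
    case (elim x)
    show ?case
    proof
      fix v assume v: "v \<in> S"
      then obtain w where w: "\<And>k. w k \<in> T" "w \<longlonglongrightarrow> v" using T(3) closure_sequential by blast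
      have wS: "w k \<in> S" for k using w T by blast
      have "isCont (\<lambda>d. h d x) v" using v elim(1) has_derivative_continuous by blast
      hence "(\<lambda>k. h (w k) x) \<longlonglongrightarrow> h v x" using w(2) by (rule isCont_tendsto_compose)
      hence \<psi>: "(\<lambda>k. \<psi> (w k) x) \<longlonglongrightarrow> \<psi> v x"
        unfolding loss_def using W_tendsto[OF wS v w(2)] by (intro tendsto_diff)
      have "bounded_linear (\<lambda>u. D d u x)" using elim(1) d has_derivative_bounded_linear by blast
      hence Yl: "(\<lambda>k. Y d (w k - d) x) \<longlonglongrightarrow> Y d (v - d) x"
        unfolding Y_def using m_bounded_linear[OF d] w(2)
        by (intro tendsto_diff bounded_linear.tendsto[of "m d"] bounded_linear.tendsto[of "\<lambda>u. D d u x"] tendsto_const)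
      have "Y d (v - d) x \<le> \<psi> v x - \<psi> d x"
        by (rule LIMSEQ_le[OF Yl tendsto_diff[OF \<psi> tendsto_const]]) (use elim(3) w in auto)
      moreover have "\<bar>\<psi> v x\<bar> \<le> ln \<kappa>"
        by (rule LIMSEQ_le_const2[OF tendsto_rabs[OF \<psi>]]) (use elim(3) w in auto)
      ultimately show "\<psi> v x - \<psi> d x \<ge> max (Y d (v - d) x) (- 2 * ln \<kappa>)"
        using elim(2) by auto
    qed
  qed
qed

end

section \<open>A PAC-Bayes bound for linear functionals\<close>

abbreviation signs :: "'a set \<Rightarrow> ('a \<Rightarrow> real) set" where
  "signs J \<equiv> PiE J (\<lambda>_. {-1, 1})"

text \<open>The product law on sign vectors whose coordinate \<open>a\<close> has mean
  \<open>\<tau> a\<close>; it is the posterior of the PAC-Bayes argument, and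
  \<open>\<tau> = 0\<close> gives the uniform prior.\<close>

definition tilt :: "'a set \<Rightarrow> ('a \<Rightarrow> real) \<Rightarrow> ('a \<Rightarrow> real) \<Rightarrow> real" where
  "tilt J \<tau> \<epsilon> = (\<Prod>a\<in>J. (1 + \<tau> a * \<epsilon> a) / 2)"

lemma finite_signs: "finite J \<Longrightarrow> finite (signs J)"
  by (simp add: finite_PiE)

lemma sum_tilt_prod:
  assumes "finite J"
  shows "(\<Sum>\<epsilon>\<in>signs J. tilt J \<tau> \<epsilon> * (\<Prod>a\<in>J. f a (\<epsilon> a)))
    = (\<Prod>a\<in>J. (1 + \<tau> a) / 2 * f a 1 + (1 - \<tau> a) / 2 * f a (-1))"
proof -
  have "(\<Prod>a\<in>J. (1 + \<tau> a) / 2 * f a 1 + (1 - \<tau> a) / 2 * f a (-1))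
      = (\<Prod>a\<in>J. \<Sum>e\<in>{-1, 1}. (1 + \<tau> a * e) / 2 * f a e)"
    by (intro prod.cong) auto
  also have "\<dots> = (\<Sum>\<epsilon>\<in>signs J. \<Prod>a\<in>J. (1 + \<tau> a * \<epsilon> a) / 2 * f a (\<epsilon> a))"
    using assms by (subst prod_sum_PiE) auto
  finally show ?thesis
    unfolding tilt_def prod.distrib by simp
qed

lemma tilt_pos:
  assumes "\<And>a. a \<in> J \<Longrightarrow> \<bar>\<tau> a\<bar> < 1" "\<epsilon> \<in> signs J"
  shows "tilt J \<tau> \<epsilon> > 0"
  unfolding tilt_def
proof (rule prod_pos)
  fix a assume "a \<in> J"
  moreover from this have "\<epsilon> a \<in> {-1, 1}" using assms(2) by (auto simp: PiE_def Pi_def)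
  ultimately show "(1 + \<tau> a * \<epsilon> a) / 2 > 0" using assms(1)[of a] by auto
qed

lemma sum_tilt:
  assumes "finite J" shows "(\<Sum>\<epsilon>\<in>signs J. tilt J \<tau> \<epsilon>) = 1"
proof -
  have "(1 + \<tau> a) / 2 + (1 - \<tau> a) / 2 = 1" for a by (simp add: field_simps)
  thus ?thesis using sum_tilt_prod[OF assms, of \<tau> "\<lambda>_ _. 1"] by simp
qed

lemma tilt_mean:
  assumes "finite J" "b \<in> J" shows "(\<Sum>\<epsilon>\<in>signs J. tilt J \<tau> \<epsilon> * \<epsilon> b) = \<tau> b"
proof -
  have "(\<Sum>\<epsilon>\<in>signs J. tilt J \<tau> \<epsilon> * \<epsilon> b)
      = (\<Sum>\<epsilon>\<in>signs J. tilt J \<tau> \<epsilon> * (\<Prod>a\<in>J. if a = b then \<epsilon> a else 1))"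
    using assms by (simp add: prod.delta)
  also have "\<dots> = (\<Prod>a\<in>J. (1 + \<tau> a) / 2 * (if a = b then 1 else 1) + (1 - \<tau> a) / 2 * (if a = b then -1 else 1))"
    by (rule sum_tilt_prod[OF assms(1)])
  also have "\<dots> = (\<Prod>a\<in>J. if a = b then \<tau> a else 1)"
    by (intro prod.cong) (auto simp: field_simps)
  finally show ?thesis using assms by (simp add: prod.delta)
qed

lemma tilt_cov:
  assumes "finite J" "b \<in> J" "c \<in> J"
  shows "(\<Sum>\<epsilon>\<in>signs J. tilt J \<tau> \<epsilon> * (\<epsilon> b * \<epsilon> c)) = (if b = c then 1 else \<tau> b * \<tau> c)"
proof (cases "b = c")
  case True
  have "\<epsilon> b * \<epsilon> c = 1" if "\<epsilon> \<in> signs J" for \<epsilon>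
    using that assms True by (auto simp: PiE_def Pi_def)
  thus ?thesis using True sum_tilt[OF assms(1)] by simp
next
  case False
  have "(\<Sum>\<epsilon>\<in>signs J. tilt J \<tau> \<epsilon> * (\<epsilon> b * \<epsilon> c))
      = (\<Sum>\<epsilon>\<in>signs J. tilt J \<tau> \<epsilon> * (\<Prod>a\<in>J. (if a = b then \<epsilon> a else 1) * (if a = c then \<epsilon> a else 1)))"
    using assms by (simp add: prod.delta prod.distrib)
  also have "\<dots> = (\<Prod>a\<in>J. (1 + \<tau> a) / 2 * ((if a = b then 1 else 1) * (if a = c then 1 else 1))
      + (1 - \<tau> a) / 2 * ((if a = b then -1 else 1) * (if a = c then -1 else 1)))"
    by (rule sum_tilt_prod[OF assms(1)])
  also have "\<dots> = (\<Prod>a\<in>J. (if a = b then \<tau> a else 1) * (if a = c then \<tau> a else 1))"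
    using False by (intro prod.cong) (auto simp: field_simps)
  finally show ?thesis using assms False by (simp add: prod.delta prod.distrib)
qed

lemma tilt_linear_mean:
  assumes "finite J"
  shows "(\<Sum>\<epsilon>\<in>signs J. tilt J \<tau> \<epsilon> * (\<Sum>a\<in>J. c a * \<epsilon> a)) = (\<Sum>a\<in>J. c a * \<tau> a)"
proof -
  have "(\<Sum>\<epsilon>\<in>signs J. tilt J \<tau> \<epsilon> * (\<Sum>a\<in>J. c a * \<epsilon> a))
    = (\<Sum>a\<in>J. \<Sum>\<epsilon>\<in>signs J. c a * (tilt J \<tau> \<epsilon> * \<epsilon> a))"
    by (subst sum.swap) (simp add: sum_distrib_left mult_ac)
  also have "\<dots> = (\<Sum>a\<in>J. c a * \<tau> a)"
    using tilt_mean[OF assms] by (intro sum.cong refl) (simp add: sum_distrib_left[symmetric])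
  finally show ?thesis .
qed

text \<open>Squared mean plus variance: the coordinates are uncorrelated, and a sign with mean
  \<open>\<tau> a\<close> has variance \<open>1 - (\<tau> a)\<^sup>2\<close>, which is at most
  1.\<close>

lemma tilt_quadratic_mean:
  assumes "finite J"
  shows "(\<Sum>\<epsilon>\<in>signs J. tilt J \<tau> \<epsilon> * (\<Sum>a\<in>J. c a * \<epsilon> a)\<^sup>2) \<le> (\<Sum>a\<in>J. c a * \<tau> a)\<^sup>2 + (\<Sum>a\<in>J. (c a)\<^sup>2)"
proof -
  have "(\<Sum>\<epsilon>\<in>signs J. tilt J \<tau> \<epsilon> * (\<Sum>a\<in>J. c a * \<epsilon> a)\<^sup>2)
     = (\<Sum>\<epsilon>\<in>signs J. \<Sum>a\<in>J. \<Sum>b\<in>J. c a * c b * (tilt J \<tau> \<epsilon> * (\<epsilon> a * \<epsilon> b)))"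
    by (simp add: power2_eq_square sum_product sum_distrib_left mult_ac)
  also have "\<dots> = (\<Sum>a\<in>J. \<Sum>b\<in>J. \<Sum>\<epsilon>\<in>signs J. c a * c b * (tilt J \<tau> \<epsilon> * (\<epsilon> a * \<epsilon> b)))"
    by (subst sum.swap, rule sum.cong[OF refl], subst sum.swap, simp)
  also have "\<dots> = (\<Sum>a\<in>J. \<Sum>b\<in>J. c a * c b * (if a = b then 1 else \<tau> a * \<tau> b))"
    using tilt_cov[OF assms] by (intro sum.cong refl) (simp add: sum_distrib_left[symmetric])
  also have "\<dots> \<le> (\<Sum>a\<in>J. \<Sum>b\<in>J. c a * c b * (\<tau> a * \<tau> b) + (if a = b then (c a)\<^sup>2 else 0))"
  proof (intro sum_mono)
    fix a b
    have "0 \<le> (c a * \<tau> a)\<^sup>2" by simp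
    thus "c a * c b * (if a = b then 1 else \<tau> a * \<tau> b) \<le> c a * c b * (\<tau> a * \<tau> b) + (if a = b then (c a)\<^sup>2 else 0)"
      by (auto simp: power2_eq_square mult_ac)
  qed
  also have "\<dots> = (\<Sum>a\<in>J. c a * \<tau> a)\<^sup>2 + (\<Sum>a\<in>J. (c a)\<^sup>2)"
    using assms by (simp add: sum.distrib power2_eq_square sum_product mult_ac)
  finally show ?thesis .
qed

text \<open>The relative entropy of the tilted law is at most \<open>\<Sum> \<tau>\<^sub>a\<^sup>2\<close> since \<open>ln (1 + x) \<le> x\<close>.\<close>

lemma tilt_gibbs:
  assumes J: "finite J" and \<tau>: "\<And>a. a \<in> J \<Longrightarrow> \<bar>\<tau> a\<bar> < 1"
  shows "(\<Sum>\<epsilon>\<in>signs J. tilt J \<tau> \<epsilon> * G \<epsilon>)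
    \<le> ln (\<Sum>\<epsilon>\<in>signs J. exp (G \<epsilon>) / 2 ^ card J) + (\<Sum>a\<in>J. (\<tau> a)\<^sup>2)"
proof -
  define S where "S = (\<Sum>\<epsilon>\<in>signs J. exp (G \<epsilon>) / 2 ^ card J)"
  have ne: "signs J \<noteq> {}" by (auto simp: PiE_eq_empty_iff)
  have S: "S > 0" unfolding S_def using finite_signs[OF J] ne by (intro sum_pos) auto
  have pt: "tilt J \<tau> \<epsilon> * G \<epsilon> \<le> tilt J \<tau> \<epsilon> * (ln S - 1) + exp (G \<epsilon>) / 2 ^ card J / S
      + tilt J \<tau> \<epsilon> * (\<Sum>a\<in>J. \<tau> a * \<epsilon> a)" if e: "\<epsilon> \<in> signs J" for \<epsilon>
  proof -
    let ?w = "tilt J \<tau> \<epsilon>"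
    have w: "?w > 0" by (rule tilt_pos[OF \<tau> e])
    have f: "1 + \<tau> a * \<epsilon> a > 0" if "a \<in> J" for a
    proof -
      have "\<epsilon> a \<in> {-1, 1}" using e that by (auto simp: PiE_def Pi_def)
      thus ?thesis using \<tau>[OF that] by auto
    qed
    have "2 ^ card J * ?w = (\<Prod>a\<in>J. 1 + \<tau> a * \<epsilon> a)"
      by (simp add: tilt_def prod_dividef prod_constant)
    hence "ln (2 ^ card J * ?w) = (\<Sum>a\<in>J. ln (1 + \<tau> a * \<epsilon> a))"
      using f J by (auto intro!: ln_prod dest: f)
    also have "\<dots> \<le> (\<Sum>a\<in>J. \<tau> a * \<epsilon> a)"
      using f by (intro sum_mono) (smt (verit) ln_le_minus_one)
    finally have 1: "ln (2 ^ card J * ?w) \<le> (\<Sum>a\<in>J. \<tau> a * \<epsilon> a)" .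
    \<comment> \<open>The argument is the density of the Gibbs law
      \<open>exp G / (2 ^ card J * S)\<close> relative to the tilted law;
      \<open>ln y \<le> y - 1\<close> expresses that relative entropy is non-negative.\<close>
    have "ln (exp (G \<epsilon>) / (2 ^ card J * ?w * S)) \<le> exp (G \<epsilon>) / (2 ^ card J * ?w * S) - 1"
      using w S by (intro ln_le_minus_one) simp
    moreover have "ln (exp (G \<epsilon>) / (2 ^ card J * ?w * S)) = G \<epsilon> - (ln (2 ^ card J * ?w) + ln S)"
      using w S by (subst ln_div) (auto simp: ln_mult)
    ultimately have "G \<epsilon> \<le> (ln S - 1) + exp (G \<epsilon>) / (2 ^ card J * ?w * S) + (\<Sum>a\<in>J. \<tau> a * \<epsilon> a)"
      using 1 by linarith
    hence "?w * G \<epsilon> \<le> ?w * ((ln S - 1) + exp (G \<epsilon>) / (2 ^ card J * ?w * S) + (\<Sum>a\<in>J. \<tau> a * \<epsilon> a))"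
      using w by (intro mult_left_mono) auto
    also have "\<dots> = ?w * (ln S - 1) + exp (G \<epsilon>) / 2 ^ card J / S + ?w * (\<Sum>a\<in>J. \<tau> a * \<epsilon> a)"
      using w S by (simp add: field_simps)
    finally show ?thesis .
  qed
  have "(\<Sum>\<epsilon>\<in>signs J. tilt J \<tau> \<epsilon> * G \<epsilon>) \<le> (\<Sum>\<epsilon>\<in>signs J. tilt J \<tau> \<epsilon> * (ln S - 1) + exp (G \<epsilon>) / 2 ^ card J / S
      + tilt J \<tau> \<epsilon> * (\<Sum>a\<in>J. \<tau> a * \<epsilon> a))"
    by (intro sum_mono pt)
  also have "\<dots> = (\<Sum>\<epsilon>\<in>signs J. tilt J \<tau> \<epsilon>) * (ln S - 1) + S / S + (\<Sum>a\<in>J. \<tau> a * \<tau> a)"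
    unfolding sum.distrib tilt_linear_mean[OF J] sum_distrib_right sum_divide_distrib[symmetric]
    by (simp only: S_def sum_divide_distrib)
  also have "\<dots> = ln S + (\<Sum>a\<in>J. (\<tau> a)\<^sup>2)"
    using S by (simp add: sum_tilt[OF J] power2_eq_square)
  finally show ?thesis by (simp add: S_def)
qed

text \<open>Catoni's truncation, chosen to make \<open>exp (- trunc y)\<close> quadratic: second moments suffice for
  exponential bounds.\<close>

definition trunc :: "real \<Rightarrow> real" where "trunc y = - ln (1 - y + y\<^sup>2)"

section \<open>Exponential moments and convexity of the truncation\<close>

lemma trunc_arg_ge: "1 - y + y\<^sup>2 \<ge> 3 / 4" for y :: real
  using zero_le_power2[of "y - 1/2"] by (simp add: power2_eq_square field_simps)

lemma exp_minus_trunc: "exp (- trunc y) = 1 - y + y\<^sup>2"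
  using trunc_arg_ge[of y] by (simp add: trunc_def)

lemma trunc_le_third: "trunc y \<le> 1 / 3"
proof -
  have "ln (4 / 3 :: real) \<le> 4 / 3 - 1" by (rule ln_le_minus_one) simp
  moreover have "ln (3 / 4 :: real) \<le> ln (1 - y + y\<^sup>2)"
    using trunc_arg_ge[of y] by (subst ln_le_cancel_iff) auto
  moreover have "ln (3 / 4 :: real) = - ln (4 / 3)"
    by (simp add: ln_div)
  ultimately show ?thesis by (simp add: trunc_def)
qed

text \<open>Links the smooth truncation to the hard floor that loss differences possess: down to -1
  it stays below the identity, and below -1 it does not exceed -1.\<close>

lemma trunc_le_max: "trunc y \<le> max y (-1)"
proof (cases "y \<ge> -1")
  case True
  have "exp (- y) \<le> 1 - y + y\<^sup>2"
  proof (cases "y \<ge> 0")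
    case True
    have "1 + y + y\<^sup>2 / 2 \<le> exp y" using exp_lower_Taylor_quadratic[OF True] by simp
    hence "exp (- y) \<le> 1 / (1 + y + y\<^sup>2 / 2)"
      using True by (simp add: exp_minus field_simps add_pos_nonneg)
    also have "\<dots> \<le> 1 - y + y\<^sup>2"
    proof -
      have "(1 - y + y\<^sup>2) * (1 + y + y\<^sup>2 / 2) = 1 + y\<^sup>2 / 2 + y ^ 3 / 2 + y ^ 4 / 2"
        by (simp add: algebra_simps power2_eq_square power3_eq_cube power4_eq_xxxx) (simp add: field_simps)
      also have "\<dots> \<ge> 1" using True by simp
      finally show ?thesis using True by (simp add: divide_le_eq add_pos_nonneg)
    qed
    finally show ?thesis .
  next
    case False
    thus ?thesis using exp_bound[of "- y"] \<open>y \<ge> -1\<close> by simp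
  qed
  hence "- y \<le> ln (1 - y + y\<^sup>2)" using trunc_arg_ge[of y] by (subst ln_ge_iff) auto
  thus ?thesis by (simp add: trunc_def)
next
  case False
  have "exp 1 \<le> (3::real)" using exp_le by simp
  also have "3 \<le> 1 - y + y\<^sup>2"
  proof -
    have "y\<^sup>2 \<ge> 1" using False one_le_power[of "- y" 2] by simp
    thus ?thesis using False by simp
  qed
  finally have "1 \<le> ln (1 - y + y\<^sup>2)" using trunc_arg_ge[of y] by (subst ln_ge_iff) auto
  thus ?thesis by (simp add: trunc_def)
qed

text \<open>\<open>trunc\<close> itself is not concave, but its second derivative is at most
  \<open>8 / 3\<close>. Adding the quadratic makes Jensen's inequality available at a cost of
  \<open>4 / 3\<close> times the variance.\<close>

lemma convex_trunc: "convex_on UNIV (\<lambda>y. 4 / 3 * y\<^sup>2 - trunc y)"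
proof (rule f''_ge0_imp_convex[where f' = "\<lambda>y. 8 / 3 * y + (2 * y - 1) / (1 - y + y\<^sup>2)"
     and f'' = "\<lambda>y. 8 / 3 + (2 * (1 - y + y\<^sup>2) - (2 * y - 1)\<^sup>2) / (1 - y + y\<^sup>2)\<^sup>2"])
  fix y :: real
  have p: "1 - y + y\<^sup>2 > 0" using trunc_arg_ge[of y] by simp
  show "((\<lambda>y. 4 / 3 * y\<^sup>2 - trunc y) has_real_derivative 8 / 3 * y + (2 * y - 1) / (1 - y + y\<^sup>2)) (at y)"
    unfolding trunc_def using p by (auto intro!: derivative_eq_intros simp: field_simps)
  show "((\<lambda>y. 8 / 3 * y + (2 * y - 1) / (1 - y + y\<^sup>2)) has_real_derivative
     8 / 3 + (2 * (1 - y + y\<^sup>2) - (2 * y - 1)\<^sup>2) / (1 - y + y\<^sup>2)\<^sup>2) (at y)"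
    using p by (auto intro!: derivative_eq_intros simp: power2_eq_square)
  let ?q = "1 - y + y\<^sup>2"
  have "(2 * y - 1)\<^sup>2 - 2 * ?q \<le> 8 / 3 * ?q\<^sup>2"
  proof -
    have "(2 * y - 1)\<^sup>2 - 2 * ?q = 2 * ?q - 3" by (simp add: power2_eq_square algebra_simps)
    also have "\<dots> \<le> 8 / 3 * ?q\<^sup>2"
      using zero_le_power2[of "?q - 3/8"] by (simp add: power2_eq_square field_simps)
    finally show ?thesis .
  qed
  hence "(2 * y - 1)\<^sup>2 - 2 * ?q \<le> 8 / 3 * ?q\<^sup>2" .
  hence "((2 * y - 1)\<^sup>2 - 2 * ?q) / ?q\<^sup>2 \<le> 8 / 3" using p by (simp add: divide_le_eq)
  thus "0 \<le> 8 / 3 + (2 * ?q - (2 * y - 1)\<^sup>2) / ?q\<^sup>2" by (simp only: diff_divide_distrib)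
qed simp

text \<open>Jensen's inequality for the convexified function costs \<open>4 / 3\<close> times the
  variance of the signed sum. The cap at 1 is free: \<open>trunc\<close> never exceeds
  \<open>1 / 3\<close> and the maximum never falls below -1, so the two differ by at most
  \<open>4 / 3\<close>.\<close>

lemma tilt_trunc:
  assumes J: "finite J" and \<tau>: "\<And>a. a \<in> J \<Longrightarrow> \<bar>\<tau> a\<bar> < 1"
  shows "(\<Sum>\<epsilon>\<in>signs J. tilt J \<tau> \<epsilon> * trunc (\<Sum>a\<in>J. c a * \<epsilon> a))
    \<le> max (\<Sum>a\<in>J. c a * \<tau> a) (-1) + 4 / 3 * min (\<Sum>a\<in>J. (c a)\<^sup>2) 1"
proof -
  let ?E = "\<lambda>F. \<Sum>\<epsilon>\<in>signs J. tilt J \<tau> \<epsilon> * F \<epsilon>"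
  let ?y = "\<lambda>\<epsilon>. \<Sum>a\<in>J. c a * \<epsilon> a" and ?m = "\<Sum>a\<in>J. c a * \<tau> a" and ?s = "\<Sum>a\<in>J. (c a)\<^sup>2"
  have nn: "tilt J \<tau> \<epsilon> \<ge> 0" if "\<epsilon> \<in> signs J" for \<epsilon>
    using tilt_pos[of J \<tau> \<epsilon>] \<tau> that by force
  have "(\<lambda>y. 4 / 3 * y\<^sup>2 - trunc y) (\<Sum>\<epsilon>\<in>signs J. tilt J \<tau> \<epsilon> *\<^sub>R ?y \<epsilon>)
     \<le> ?E (\<lambda>\<epsilon>. 4 / 3 * (?y \<epsilon>)\<^sup>2 - trunc (?y \<epsilon>))"
    by (rule convex_on_sum[OF finite_signs[OF J] _ convex_trunc])
      (auto simp: PiE_eq_empty_iff sum_tilt[OF J] nn)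
  hence "4 / 3 * ?m\<^sup>2 - trunc ?m \<le> 4 / 3 * ?E (\<lambda>\<epsilon>. (?y \<epsilon>)\<^sup>2) - ?E (\<lambda>\<epsilon>. trunc (?y \<epsilon>))"
    unfolding real_scaleR_def tilt_linear_mean[OF J]
    by (simp add: right_diff_distrib sum_subtractf sum_distrib_left mult.left_commute)
  hence 1: "?E (\<lambda>\<epsilon>. trunc (?y \<epsilon>)) \<le> max ?m (-1) + 4 / 3 * ?s"
    using tilt_quadratic_mean[OF J, of \<tau> c] trunc_le_max[of ?m] by linarith
  have "?E (\<lambda>\<epsilon>. trunc (?y \<epsilon>)) \<le> ?E (\<lambda>\<epsilon>. 1 / 3)"
    using nn trunc_le_third by (intro sum_mono mult_left_mono) auto
  also have "\<dots> = 1 / 3" by (simp add: sum_tilt[OF J] sum_divide_distrib[symmetric])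
  finally have "?E (\<lambda>\<epsilon>. trunc (?y \<epsilon>)) \<le> max ?m (-1) + 4 / 3" by linarith
  with 1 show ?thesis by (simp add: min_def)
qed

text \<open>Without the cap, the exponential of the variance correction would have no controlled
  mean. With it, the chord of \<open>exp\<close> bounds the correction by
  \<open>1 + 4 * min s 1\<close>, and the whole expression grows only linearly in
  \<open>y\<^sup>2\<close> and \<open>s\<close>.\<close>

lemma exp_trunc_bound:
  assumes "s \<ge> 0"
  shows "exp (- trunc y + 4 / 3 * min s 1) \<le> 1 - y + 7 * y\<^sup>2 + 6 * s"
proof -
  define k where "k = min s 1"
  have k: "0 \<le> k" "k \<le> 1" "k \<le> s" using assms by (auto simp: k_def)
  have e: "exp (4 / 3 * k) \<le> 1 + 4 * k"
  proof -
    have "exp ((1 - k) *\<^sub>R 0 + k *\<^sub>R (4/3)) \<le> (1 - k) * exp 0 + k * exp (4/3 :: real)"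
      using k by (intro convex_onD[OF exp_convex]) auto
    moreover have "exp (4/3 :: real) \<le> 5"
    proof -
      have "exp (4/3 :: real) ^ 3 = exp 1 ^ 4" by (simp add: exp_of_nat_mult[symmetric])
      also have "\<dots> \<le> (2.75 :: real) ^ 4" using e_less_272 by (intro power_mono) simp_all
      also have "\<dots> \<le> 5 ^ 3" by (simp add: power_divide)
      finally show ?thesis by (rule power_mono_iff[THEN iffD1, rotated 3]) auto
    qed
    ultimately show ?thesis using k mult_left_mono[of "exp (4/3 :: real)" 5 k] by (simp add: algebra_simps)
  qed
  have "exp (- trunc y + 4 / 3 * k) = (1 - y + y\<^sup>2) * exp (4 / 3 * k)"
    by (simp only: exp_add exp_minus_trunc)
  also have "\<dots> \<le> (1 - y + y\<^sup>2) * (1 + 4 * k)"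
    using trunc_arg_ge[of y] e by (intro mult_left_mono) auto
  also have "\<dots> \<le> 1 - y + 7 * y\<^sup>2 + 6 * k"
  proof -
    have "4 * k * (1 - y + y\<^sup>2) \<le> 4 * k * (3 / 2 + 3 / 2 * y\<^sup>2)"
      using k zero_le_power2[of "y + 1"] by (intro mult_left_mono) (auto simp: power2_eq_square algebra_simps)
    also have "\<dots> = 6 * k + k * (6 * y\<^sup>2)" by (simp add: algebra_simps)
    also have "\<dots> \<le> 6 * k + 6 * y\<^sup>2" using k mult_left_le_one_le[of "6 * y\<^sup>2" k] by simp
    finally show ?thesis by (simp add: algebra_simps)
  qed
  also have "\<dots> \<le> 1 - y + 7 * y\<^sup>2 + 6 * s" using k by simp
  finally show ?thesis by (simp add: k_def)
qed




text \<open>\<open>T\<close> averages, over uniform signs, exponentials of sums that each have mean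
  at most 1. The entropy inequality \<open>tilt_gibbs\<close> turns this one variable into a bound
  for all tilts simultaneously, so \<open>\<tau>\<close> may be chosen after the sample is
  seen.\<close>

lemma (in prob_space) rademacher_mixture:
  fixes z :: "'b \<Rightarrow> 'x \<Rightarrow> real" and X :: "nat \<Rightarrow> 'a \<Rightarrow> 'x"
  assumes J: "finite J"
    and indep: "indep_vars (\<lambda>_. N) X UNIV" and X: "\<And>i. distr M N (X i) = Q" and Q: "sets Q = sets N"
    and z: "\<And>a. a \<in> J \<Longrightarrow> z a \<in> borel_measurable N" "\<And>a. a \<in> J \<Longrightarrow> integrable Q (\<lambda>x. (z a x)\<^sup>2)"
  obtains T :: "'a \<Rightarrow> real" where "T \<in> borel_measurable M" "\<And>\<omega>. T \<omega> > 0"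
    "(\<integral>\<^sup>+\<omega>. ennreal (T \<omega>) \<partial>M) \<le> 1"
    "\<And>\<omega> \<tau>. (\<And>a. a \<in> J \<Longrightarrow> \<bar>\<tau> a\<bar> < 1) \<Longrightarrow>
       (\<Sum>i<n. max (\<Sum>a\<in>J. \<tau> a * z a (X i \<omega>)) (-1))
       \<ge> real n * (\<Sum>a\<in>J. \<tau> a * (\<integral>x. z a x \<partial>Q)) - 7 * real n * (\<integral>x. (\<Sum>a\<in>J. \<tau> a * z a x)\<^sup>2 \<partial>Q)
         - 13 * real n * (\<Sum>a\<in>J. \<integral>x. (z a x)\<^sup>2 \<partial>Q) - (\<Sum>a\<in>J. (\<tau> a)\<^sup>2) - ln (T \<omega>)"
proof -
  have XM: "X i \<in> measurable M N" for i using indep by (auto simp: indep_vars_def)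
  interpret Q: prob_space Q using prob_space_distr[OF XM, of 0] X by simp
  note [measurable] = XM
  have zQ: "z a \<in> borel_measurable Q" if "a \<in> J" for a using z(1)[OF that] Q by (simp cong: measurable_cong_sets)
  have zint: "integrable Q (z a)" if "a \<in> J" for a
    using Q.square_integrable_imp_integrable[OF zQ[OF that] z(2)[OF that]] .
  have zz: "integrable Q (\<lambda>x. z a x * z b x)" if "a \<in> J" "b \<in> J" for a b
  proof (rule Bochner_Integration.integrable_bound[OF Bochner_Integration.integrable_add[OF z(2)[OF that(1)] z(2)[OF that(2)]]])
    show "(\<lambda>x. z a x * z b x) \<in> borel_measurable Q" using zQ that by simp
    have "2 * \<bar>u * v\<bar> \<le> u\<^sup>2 + v\<^sup>2" for u v :: real
      using sum_squares_bound[of "\<bar>u\<bar>" "\<bar>v\<bar>"] by (simp add: abs_mult)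
    hence "\<bar>u * v\<bar> \<le> u\<^sup>2 + v\<^sup>2" for u v :: real by (smt (verit) abs_ge_zero)
    thus "AE x in Q. norm (z a x * z b x) \<le> norm ((z a x)\<^sup>2 + (z b x)\<^sup>2)" by simp
  qed
  define y where "y \<epsilon> x = (\<Sum>a\<in>J. z a x * \<epsilon> a)" for \<epsilon> x
  define s where "s x = (\<Sum>a\<in>J. (z a x)\<^sup>2)" for x
  \<comment> \<open>The capped term is put in beforehand so that it cancels the loss in
    \<open>tilt_trunc\<close> once the average over the tilted law is taken.\<close>
  define \<phi> where "\<phi> \<epsilon> x = - trunc (y \<epsilon> x) + 4 / 3 * min (s x) 1" for \<epsilon> x
  \<comment> \<open>The normaliser: \<open>exp (\<phi> \<epsilon>)\<close> has mean at most
    \<open>1 - c \<epsilon>\<close>, hence at most \<open>exp (- c \<epsilon>)\<close>.\<close>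
  define c where "c \<epsilon> = (\<integral>x. y \<epsilon> x \<partial>Q) - 7 * (\<integral>x. (y \<epsilon> x)\<^sup>2 \<partial>Q) - 6 * (\<integral>x. s x \<partial>Q)" for \<epsilon>
  define G where "G \<epsilon> \<omega> = (\<Sum>i<n. \<phi> \<epsilon> (X i \<omega>)) + real n * c \<epsilon>" for \<epsilon> \<omega>
  define T where "T \<omega> = (\<Sum>\<epsilon>\<in>signs J. exp (G \<epsilon> \<omega>) / 2 ^ card J)" for \<omega>
  have meas: "y \<epsilon> \<in> borel_measurable N" "s \<in> borel_measurable N" for \<epsilon>
    unfolding y_def s_def using z(1) by measurable
  hence [measurable]: "\<phi> \<epsilon> \<in> borel_measurable N" for \<epsilon>
    unfolding \<phi>_def trunc_def by measurable
  have [measurable]: "\<phi> \<epsilon> \<in> borel_measurable Q" for \<epsilon>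
    using Q by (simp cong: measurable_cong_sets)
  have Gm [measurable]: "G \<epsilon> \<in> borel_measurable M" for \<epsilon> unfolding G_def by measurable
  have yint: "integrable Q (y \<epsilon>)" for \<epsilon> unfolding y_def using zint by auto
  have y2: "integrable Q (\<lambda>x. (y \<epsilon> x)\<^sup>2)" for \<epsilon>
  proof -
    have "(\<lambda>x. (y \<epsilon> x)\<^sup>2) = (\<lambda>x. \<Sum>a\<in>J. \<Sum>b\<in>J. \<epsilon> a * \<epsilon> b * (z a x * z b x))"
      by (simp add: y_def power2_eq_square sum_product mult_ac)
    thus ?thesis using zz by auto
  qed
  have sint: "integrable Q s" unfolding s_def using z by auto
  have bound: "exp (\<phi> \<epsilon> x) \<le> 1 - y \<epsilon> x + 7 * (y \<epsilon> x)\<^sup>2 + 6 * s x" for \<epsilon> x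
    unfolding \<phi>_def by (rule exp_trunc_bound) (simp add: s_def sum_nonneg)
  have one: "(\<integral>\<^sup>+x. ennreal (exp (\<phi> \<epsilon> x)) \<partial>Q) \<le> ennreal (exp (- c \<epsilon>))" for \<epsilon>
  proof -
    let ?b = "\<lambda>x. 1 - y \<epsilon> x + 7 * (y \<epsilon> x)\<^sup>2 + 6 * s x"
    have b: "integrable Q ?b" using yint y2 sint by simp
    have "(\<integral>\<^sup>+x. ennreal (exp (\<phi> \<epsilon> x)) \<partial>Q) \<le> (\<integral>\<^sup>+x. ennreal (?b x) \<partial>Q)"
      using bound by (intro nn_integral_mono ennreal_leI)
    also have "\<dots> = ennreal (\<integral>x. ?b x \<partial>Q)"
      using b bound order.trans[OF exp_ge_zero bound] by (intro nn_integral_eq_integral) auto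
    also have "(\<integral>x. ?b x \<partial>Q) = 1 - c \<epsilon>"
      using yint y2 sint by (simp add: c_def Q.prob_space)
    also have "ennreal (1 - c \<epsilon>) \<le> ennreal (exp (- c \<epsilon>))"
      using exp_ge_add_one_self[of "- c \<epsilon>"] by (intro ennreal_leI) simp
    finally show ?thesis .
  qed
  have prod1: "(\<integral>\<^sup>+\<omega>. ennreal (exp (G \<epsilon> \<omega>)) \<partial>M) \<le> 1" for \<epsilon>
  proof -
    have ind: "indep_vars (\<lambda>_. borel) (\<lambda>i \<omega>. ennreal (exp (\<phi> \<epsilon> (X i \<omega>)))) {..<n}"
      by (rule indep_vars_compose2[where X = X and M' = "\<lambda>_. N" and Y = "\<lambda>_ x. ennreal (exp (\<phi> \<epsilon> x))"])
        (auto intro: indep_vars_subset[OF indep])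
    have "(\<integral>\<^sup>+\<omega>. ennreal (exp (G \<epsilon> \<omega>)) \<partial>M)
       = (\<integral>\<^sup>+\<omega>. ennreal (exp (real n * c \<epsilon>)) * (\<Prod>i<n. ennreal (exp (\<phi> \<epsilon> (X i \<omega>)))) \<partial>M)"
      by (intro nn_integral_cong)
        (simp add: G_def exp_add exp_sum prod_ennreal ennreal_mult[symmetric] prod_nonneg mult.commute)
    also have "\<dots> = ennreal (exp (real n * c \<epsilon>)) * (\<integral>\<^sup>+\<omega>. (\<Prod>i<n. ennreal (exp (\<phi> \<epsilon> (X i \<omega>)))) \<partial>M)"
      by (intro nn_integral_cmult) measurable
    also have "(\<integral>\<^sup>+\<omega>. (\<Prod>i<n. ennreal (exp (\<phi> \<epsilon> (X i \<omega>)))) \<partial>M)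
       = (\<Prod>i<n. \<integral>\<^sup>+\<omega>. ennreal (exp (\<phi> \<epsilon> (X i \<omega>))) \<partial>M)"
      by (rule indep_vars_nn_integral[OF _ ind]) auto
    also have "\<dots> = (\<Prod>i<n. \<integral>\<^sup>+x. ennreal (exp (\<phi> \<epsilon> x)) \<partial>Q)"
      by (intro prod.cong refl) (subst X[symmetric], subst nn_integral_distr, auto)
    also have "\<dots> \<le> (\<Prod>i<n. ennreal (exp (- c \<epsilon>)))"
      by (simp only: prod_constant) (intro power_mono_ennreal one)
    also have "\<dots> = ennreal (exp (- (real n * c \<epsilon>)))"
      by (simp add: ennreal_power exp_of_nat_mult[symmetric])
    finally show ?thesis
      by (simp add: mult_left_mono ennreal_mult[symmetric] exp_minus order.trans[OF mult_left_mono])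
  qed
  show ?thesis
  proof
    show "T \<in> borel_measurable M" unfolding T_def by measurable
    show "T \<omega> > 0" for \<omega> unfolding T_def
      using finite_signs[OF J] by (intro sum_pos) (auto simp: PiE_eq_empty_iff)
    have "(\<integral>\<^sup>+\<omega>. ennreal (T \<omega>) \<partial>M) = (\<integral>\<^sup>+\<omega>. (\<Sum>\<epsilon>\<in>signs J. ennreal (1 / 2 ^ card J) * ennreal (exp (G \<epsilon> \<omega>))) \<partial>M)"
      unfolding T_def by (intro nn_integral_cong) (simp add: sum_ennreal ennreal_mult[symmetric])
    also have "\<dots> = (\<Sum>\<epsilon>\<in>signs J. ennreal (1 / 2 ^ card J) * (\<integral>\<^sup>+\<omega>. ennreal (exp (G \<epsilon> \<omega>)) \<partial>M))"
      by (subst nn_integral_sum, measurable, subst nn_integral_cmult) auto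
    also have "\<dots> \<le> (\<Sum>\<epsilon>\<in>signs J. ennreal (1 / 2 ^ card J) * 1)"
      by (intro sum_mono mult_left_mono prod1) auto
    also have "\<dots> = ennreal (\<Sum>\<epsilon>\<in>signs J. 1 / 2 ^ card J)" by (simp add: sum_ennreal del: sum_constant)
    also have "(\<Sum>\<epsilon>\<in>signs J. 1 / 2 ^ card J :: real) = 1"
      using J by (simp add: card_PiE)
    finally show "(\<integral>\<^sup>+\<omega>. ennreal (T \<omega>) \<partial>M) \<le> 1" by simp
  next
    fix \<omega> and \<tau> :: "'b \<Rightarrow> real" assume \<tau>: "\<And>a. a \<in> J \<Longrightarrow> \<bar>\<tau> a\<bar> < 1"
    let ?E = "\<lambda>F. \<Sum>\<epsilon>\<in>signs J. tilt J \<tau> \<epsilon> * F \<epsilon>"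
    let ?m = "\<lambda>x. \<Sum>a\<in>J. \<tau> a * z a x"
    have comm: "(\<Sum>a\<in>J. z a x * \<tau> a) = ?m x" for x by (simp add: mult.commute)
    have 1: "?E (\<lambda>\<epsilon>. G \<epsilon> \<omega>) \<le> ln (T \<omega>) + (\<Sum>a\<in>J. (\<tau> a)\<^sup>2)"
      unfolding T_def by (rule tilt_gibbs[OF J \<tau>])
    have 2: "?E (\<lambda>\<epsilon>. \<phi> \<epsilon> x) \<ge> - max (?m x) (-1)" for x
    proof -
      have "?E (\<lambda>\<epsilon>. \<phi> \<epsilon> x) = - ?E (\<lambda>\<epsilon>. trunc (y \<epsilon> x)) + (\<Sum>\<epsilon>\<in>signs J. tilt J \<tau> \<epsilon>) * (4 / 3 * min (s x) 1)"
        unfolding \<phi>_def sum_distrib_right sum_negf[symmetric] sum.distrib[symmetric]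
        by (intro sum.cong refl) (simp only: ring_distribs mult_minus_right)
      moreover have "?E (\<lambda>\<epsilon>. trunc (y \<epsilon> x)) \<le> max (?m x) (-1) + 4 / 3 * min (s x) 1"
        using tilt_trunc[of J \<tau> "\<lambda>a. z a x"] J \<tau> by (simp only: y_def s_def comm)
      ultimately show ?thesis by (simp add: sum_tilt[OF J])
    qed
    have c_eq: "?E c = (\<Sum>a\<in>J. \<tau> a * (\<integral>x. z a x \<partial>Q)) - 7 * (\<integral>x. ?E (\<lambda>\<epsilon>. (y \<epsilon> x)\<^sup>2) \<partial>Q) - 6 * (\<integral>x. s x \<partial>Q)"
    proof -
      have "?E c = ?E (\<lambda>\<epsilon>. \<integral>x. y \<epsilon> x \<partial>Q) - 7 * ?E (\<lambda>\<epsilon>. \<integral>x. (y \<epsilon> x)\<^sup>2 \<partial>Q) - (\<Sum>\<epsilon>\<in>signs J. tilt J \<tau> \<epsilon>) * (6 * (\<integral>x. s x \<partial>Q))"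
        unfolding c_def sum_distrib_right sum_distrib_left sum_subtractf[symmetric]
        by (intro sum.cong refl) (simp add: algebra_simps)
      moreover have "?E (\<lambda>\<epsilon>. \<integral>x. y \<epsilon> x \<partial>Q) = (\<Sum>a\<in>J. \<tau> a * (\<integral>x. z a x \<partial>Q))"
        using tilt_linear_mean[OF J, of \<tau> "\<lambda>a. \<integral>x. z a x \<partial>Q"] zint
        by (simp add: y_def mult.commute)
      moreover have "?E (\<lambda>\<epsilon>. \<integral>x. (y \<epsilon> x)\<^sup>2 \<partial>Q) = (\<integral>x. ?E (\<lambda>\<epsilon>. (y \<epsilon> x)\<^sup>2) \<partial>Q)"
        using y2 by simp
      ultimately show ?thesis by (simp add: sum_tilt[OF J])
    qed
    have m2: "integrable Q (\<lambda>x. (?m x)\<^sup>2)" using y2[of \<tau>] by (simp add: y_def comm)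
    have "(\<integral>x. ?E (\<lambda>\<epsilon>. (y \<epsilon> x)\<^sup>2) \<partial>Q) \<le> (\<integral>x. (?m x)\<^sup>2 + s x \<partial>Q)"
    proof (rule integral_mono)
      show "integrable Q (\<lambda>x. ?E (\<lambda>\<epsilon>. (y \<epsilon> x)\<^sup>2))" using y2 by simp
      show "integrable Q (\<lambda>x. (?m x)\<^sup>2 + s x)" using m2 sint by simp
      show "?E (\<lambda>\<epsilon>. (y \<epsilon> x)\<^sup>2) \<le> (?m x)\<^sup>2 + s x" for x
        using tilt_quadratic_mean[OF J, of \<tau> "\<lambda>a. z a x"] by (simp only: y_def s_def comm)
    qed
    also have "\<dots> = (\<integral>x. (?m x)\<^sup>2 \<partial>Q) + (\<integral>x. s x \<partial>Q)" using m2 sint by simp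
    \<comment> \<open>The coefficient 13 of the trace consists of 6 from
      \<open>exp_trunc_bound\<close> and 7 from the spread of the signs around
      \<open>\<tau>\<close>.\<close>
    finally have 3: "?E c \<ge> (\<Sum>a\<in>J. \<tau> a * (\<integral>x. z a x \<partial>Q)) - 7 * (\<integral>x. (?m x)\<^sup>2 \<partial>Q) - 13 * (\<integral>x. s x \<partial>Q)"
      unfolding c_eq by linarith
    have "?E (\<lambda>\<epsilon>. G \<epsilon> \<omega>) = (\<Sum>i<n. ?E (\<lambda>\<epsilon>. \<phi> \<epsilon> (X i \<omega>))) + real n * ?E c"
    proof -
      have "?E (\<lambda>\<epsilon>. G \<epsilon> \<omega>) = (\<Sum>\<epsilon>\<in>signs J. \<Sum>i<n. tilt J \<tau> \<epsilon> * \<phi> \<epsilon> (X i \<omega>)) + real n * ?E c"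
        by (simp add: G_def distrib_left sum.distrib sum_distrib_left mult.left_commute)
      thus ?thesis by (subst (asm) sum.swap)
    qed
    moreover have "(\<Sum>i<n. ?E (\<lambda>\<epsilon>. \<phi> \<epsilon> (X i \<omega>))) \<ge> (\<Sum>i<n. - max (?m (X i \<omega>)) (-1))"
      by (intro sum_mono 2)
    moreover have "(\<integral>x. s x \<partial>Q) = (\<Sum>a\<in>J. \<integral>x. (z a x)\<^sup>2 \<partial>Q)"
      unfolding s_def using z by simp
    moreover have "real n * ?E c \<ge> real n * ((\<Sum>a\<in>J. \<tau> a * (\<integral>x. z a x \<partial>Q)) - 7 * (\<integral>x. (?m x)\<^sup>2 \<partial>Q) - 13 * (\<integral>x. s x \<partial>Q))"
      by (intro mult_left_mono 3) simp
    ultimately show "(\<Sum>i<n. max (?m (X i \<omega>)) (-1))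
       \<ge> real n * (\<Sum>a\<in>J. \<tau> a * (\<integral>x. z a x \<partial>Q)) - 7 * real n * (\<integral>x. (?m x)\<^sup>2 \<partial>Q)
         - 13 * real n * (\<Sum>a\<in>J. \<integral>x. (z a x)\<^sup>2 \<partial>Q) - (\<Sum>a\<in>J. (\<tau> a)\<^sup>2) - ln (T \<omega>)"
      using 1 by (simp add: sum_negf algebra_simps)
  qed
qed

text \<open>Replacing every coordinate by \<open>R\<close> scaled copies removes the restriction of the tilts to
  \<open>(-1, 1)\<close>.\<close>

lemma (in prob_space) pac_bayes_linear:
  fixes z :: "'b \<Rightarrow> 'x \<Rightarrow> real" and X :: "nat \<Rightarrow> 'a \<Rightarrow> 'x"
  assumes I: "finite I"
    and indep: "indep_vars (\<lambda>_. N) X UNIV" and X: "\<And>i. distr M N (X i) = Q" and Q: "sets Q = sets N"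
    and z: "\<And>a. a \<in> I \<Longrightarrow> z a \<in> borel_measurable N" "\<And>a. a \<in> I \<Longrightarrow> integrable Q (\<lambda>x. (z a x)\<^sup>2)"
  obtains T :: "'a \<Rightarrow> real" where "T \<in> borel_measurable M" "\<And>\<omega>. T \<omega> > 0"
    "(\<integral>\<^sup>+\<omega>. ennreal (T \<omega>) \<partial>M) \<le> 1"
    "\<And>\<omega> t. (\<Sum>a\<in>I. (t a)\<^sup>2) \<le> R \<Longrightarrow>
       (\<Sum>i<n. max (\<Sum>a\<in>I. t a * z a (X i \<omega>)) (-1))
       \<ge> real n * (\<Sum>a\<in>I. t a * (\<integral>x. z a x \<partial>Q)) - 7 * real n * (\<integral>x. (\<Sum>a\<in>I. t a * z a x)\<^sup>2 \<partial>Q)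
         - 13 * real n * (\<Sum>a\<in>I. \<integral>x. (z a x)\<^sup>2 \<partial>Q) - (\<Sum>a\<in>I. (t a)\<^sup>2) - ln (T \<omega>)"
proof -
  \<comment> \<open>\<open>K > R\<close> forces every tilt \<open>t a / sqrt K\<close> into the open
    unit interval around 0. Coordinates and tilts are both divided by \<open>sqrt K\<close>, so
    summing over the \<open>K\<close> copies restores every term of the bound.\<close>
  define K where "K = nat \<lceil>max R 0\<rceil> + 1"
  have K: "real K > R" "real K > 0" unfolding K_def by linarith+
  define J where "J = I \<times> {..<K}"
  define z' where "z' p x = z (fst p) x / sqrt K" for p :: "'b \<times> nat" and x
  have J: "finite J" using I by (simp add: J_def)
  have z': "z' p \<in> borel_measurable N" "integrable Q (\<lambda>x. (z' p x)\<^sup>2)" if "p \<in> J" for p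
    using z[of "fst p"] that unfolding z'_def by (auto simp: J_def power_divide)
  have sumJ: "(\<Sum>p\<in>J. f (fst p)) = real K * (\<Sum>a\<in>I. f a)" for f :: "'b \<Rightarrow> real"
  proof -
    have "(\<Sum>p\<in>J. f (fst p)) = (\<Sum>a\<in>I. \<Sum>k<K. f a)"
      unfolding J_def by (subst sum.cartesian_product) (simp add: case_prod_beta)
    thus ?thesis by (simp add: sum_distrib_left)
  qed
  obtain T where T: "T \<in> borel_measurable M" "\<And>\<omega>. T \<omega> > 0" "(\<integral>\<^sup>+\<omega>. ennreal (T \<omega>) \<partial>M) \<le> 1"
    and main: "\<And>\<omega> \<tau>. (\<And>p. p \<in> J \<Longrightarrow> \<bar>\<tau> p\<bar> < 1) \<Longrightarrow>
       (\<Sum>i<n. max (\<Sum>p\<in>J. \<tau> p * z' p (X i \<omega>)) (-1))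
       \<ge> real n * (\<Sum>p\<in>J. \<tau> p * (\<integral>x. z' p x \<partial>Q)) - 7 * real n * (\<integral>x. (\<Sum>p\<in>J. \<tau> p * z' p x)\<^sup>2 \<partial>Q)
         - 13 * real n * (\<Sum>p\<in>J. \<integral>x. (z' p x)\<^sup>2 \<partial>Q) - (\<Sum>p\<in>J. (\<tau> p)\<^sup>2) - ln (T \<omega>)"
    using rademacher_mixture[where J = J and N = N and X = X and Q = Q and z = z' and n = n, OF J indep X Q] z'
    by blast
  show ?thesis
  proof (rule that[OF T])
    fix \<omega> and t :: "'b \<Rightarrow> real" assume t: "(\<Sum>a\<in>I. (t a)\<^sup>2) \<le> R"
    define \<tau> where "\<tau> p = t (fst p) / sqrt K" for p :: "'b \<times> nat"
    have small: "\<bar>\<tau> p\<bar> < 1" if "p \<in> J" for p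
    proof -
      have "(t (fst p))\<^sup>2 \<le> (\<Sum>a\<in>I. (t a)\<^sup>2)"
        using that I by (intro member_le_sum) (auto simp: J_def)
      also have "\<dots> < real K" using t K by simp
      finally have "\<bar>t (fst p)\<bar> < sqrt K" by (metis real_sqrt_abs real_sqrt_less_iff)
      thus ?thesis using K by (simp add: \<tau>_def)
    qed
    have lin: "(\<Sum>p\<in>J. \<tau> p * z' p x) = (\<Sum>a\<in>I. t a * z a x)" for x
      using sumJ[of "\<lambda>a. t a * z a x / real K"] K by (simp add: \<tau>_def z'_def sum_divide_distrib[symmetric])
    have mean: "(\<Sum>p\<in>J. \<tau> p * (\<integral>x. z' p x \<partial>Q)) = (\<Sum>a\<in>I. t a * (\<integral>x. z a x \<partial>Q))"
      using sumJ[of "\<lambda>a. t a * (\<integral>x. z a x \<partial>Q) / real K"] K by (simp add: \<tau>_def z'_def sum_divide_distrib[symmetric])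
    have sq: "(\<Sum>p\<in>J. \<integral>x. (z' p x)\<^sup>2 \<partial>Q) = (\<Sum>a\<in>I. \<integral>x. (z a x)\<^sup>2 \<partial>Q)"
      using sumJ[of "\<lambda>a. (\<integral>x. (z a x)\<^sup>2 \<partial>Q) / real K"] K by (simp add: z'_def power_divide sum_divide_distrib[symmetric])
    have tau2: "(\<Sum>p\<in>J. (\<tau> p)\<^sup>2) = (\<Sum>a\<in>I. (t a)\<^sup>2)"
      using sumJ[of "\<lambda>a. (t a)\<^sup>2 / real K"] K by (simp add: \<tau>_def power_divide sum_divide_distrib[symmetric])
    show "(\<Sum>i<n. max (\<Sum>a\<in>I. t a * z a (X i \<omega>)) (-1))
       \<ge> real n * (\<Sum>a\<in>I. t a * (\<integral>x. z a x \<partial>Q)) - 7 * real n * (\<integral>x. (\<Sum>a\<in>I. t a * z a x)\<^sup>2 \<partial>Q)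
         - 13 * real n * (\<Sum>a\<in>I. \<integral>x. (z a x)\<^sup>2 \<partial>Q) - (\<Sum>a\<in>I. (t a)\<^sup>2) - ln (T \<omega>)"
      unfolding lin[symmetric] mean[symmetric] sq[symmetric] tau2[symmetric] by (rule main[OF small])
  qed
qed

section \<open>Eigenbases, effective dimension and nets\<close>

locale psd_form =
  fixes B :: "'h::real_vector \<Rightarrow> 'h \<Rightarrow> real"
  assumes sym: "B f g = B g f" and lin: "linear (\<lambda>f. B f g)" and pos: "B f f \<ge> 0"
begin

lemma add_left: "B (f + g) k = B f k + B g k" using linear_add[OF lin] .
lemma add_right: "B k (f + g) = B k f + B k g" using add_left sym by metis
lemma scale_left: "B (c *\<^sub>R f) k = c * B f k" using linear_cmul[OF lin, of c f] by simp
lemma scale_right: "B k (c *\<^sub>R f) = c * B k f" using scale_left sym by metis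
lemma minus_left: "B (- f) k = - B f k" using scale_left[of "-1" f k] by simp
lemma minus_right: "B k (- f) = - B k f" using minus_left sym by metis
lemma diff_left: "B (f - g) k = B f k - B g k" using linear_diff[OF lin] .
lemma diff_right: "B k (f - g) = B k f - B k g" using diff_left sym by metis
lemma sum_left: "B (\<Sum>i\<in>A. f i) k = (\<Sum>i\<in>A. B (f i) k)" using linear_sum[OF lin] .
lemma lin_right: "linear (\<lambda>g. B f g)" by (rule linearI) (simp_all add: add_right scale_right)
lemma sum_right: "B k (\<Sum>i\<in>A. f i) = (\<Sum>i\<in>A. B k (f i))" using linear_sum[OF lin_right] .

lemmas bilinear = add_left add_right scale_left scale_right diff_left diff_right minus_left minus_right

lemma add_le: "B (f + g) (f + g) \<le> 2 * B f f + 2 * B g g"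
  using pos[of "f - g"] by (simp add: bilinear sym[of g f])

lemma diff_le: "B (f - g) (f - g) \<le> 2 * B f f + 2 * B g g"
  using pos[of "f + g"] by (simp add: bilinear sym[of g f])

lemma cauchy_schwarz: "\<bar>B f g\<bar> \<le> sqrt (B f f) * sqrt (B g g)"
proof (rule sqrt_bound_of_quadratic_nonneg[OF _ pos])
  show "0 \<le> B f f + t\<^sup>2 * B g g + 2 * t * B f g" for t
    using pos[of "f + t *\<^sub>R g"] by (simp add: bilinear sym[of g f] power2_eq_square algebra_simps)
qed

end

text \<open>Indices start at 0 here and at 1 in \<open>eigen_system\<close>.\<close>

locale eigenbasis = v: psd_form v + J: psd_form J
  for v J :: "'h::real_normed_vector \<Rightarrow> 'h \<Rightarrow> real" +
  fixes \<phi> :: "nat \<Rightarrow> 'h" and \<rho> :: "nat \<Rightarrow> real" and M1 M2 :: real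
  assumes M1: "M1 > 0" and norm_le: "\<And>g. M1 * (norm g)\<^sup>2 \<le> v g g + J g g"
    and le_norm: "\<And>g. v g g + J g g \<le> M2 * (norm g)\<^sup>2"
    and v_\<phi>: "\<And>i k. v (\<phi> i) (\<phi> k) = (if i = k then 1 else 0)"
    and J_\<phi>: "\<And>i k. J (\<phi> i) (\<phi> k) = (if i = k then \<rho> i else 0)"
    and dense: "closure (span (range \<phi>)) = UNIV"
    and \<rho>: "\<And>i. \<rho> i \<ge> 0"
begin

definition P :: "nat \<Rightarrow> 'h \<Rightarrow> 'h" where "P k g = (\<Sum>a<k. v (\<phi> a) g *\<^sub>R \<phi> a)"

lemma v_bound: "v g g \<le> M2 * (norm g)\<^sup>2" and J_bound: "J g g \<le> M2 * (norm g)\<^sup>2"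
  using le_norm[of g] v.pos[of g] J.pos[of g] by linarith+

lemma bounded_linear_right:
  assumes "psd_form B" "\<And>g. B g g \<le> M2 * (norm g)\<^sup>2" shows "bounded_linear (\<lambda>g. B f g)"
proof -
  interpret B: psd_form B by fact
  have "\<bar>B f g\<bar> \<le> norm g * (sqrt (B f f) * sqrt M2)" for g
  proof -
    have "\<bar>B f g\<bar> \<le> sqrt (B f f) * sqrt (B g g)" by (rule B.cauchy_schwarz)
    also have "\<dots> \<le> sqrt (B f f) * sqrt (M2 * (norm g)\<^sup>2)"
      using assms(2) B.pos by (intro mult_left_mono real_sqrt_le_mono) auto
    finally show ?thesis by (simp add: real_sqrt_mult mult_ac)
  qed
  thus ?thesis
    by (intro bounded_linear_intro[of _ "sqrt (B f f) * sqrt M2"]) (auto simp: B.add_right B.scale_right)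
qed

text \<open>Both sides are bounded linear functionals of \<open>g\<close> that agree on the basis,
  so density of its span extends the orthogonality relations to the eigenvalue equation. The
  projection \<open>P\<close> thereby becomes orthogonal for \<open>v\<close> and \<open>J\<close>
  at once.\<close>

lemma J_eq: "J (\<phi> a) g = \<rho> a * v (\<phi> a) g"
proof -
  have "closed {g. J (\<phi> a) g = \<rho> a * v (\<phi> a) g}"
  proof (rule closed_Collect_eq)
    show "continuous_on UNIV (\<lambda>g. J (\<phi> a) g)"
      using bounded_linear_right[OF J.psd_form_axioms J_bound] by (rule linear_continuous_on)
    show "continuous_on UNIV (\<lambda>g. \<rho> a * v (\<phi> a) g)"
      using bounded_linear_right[OF v.psd_form_axioms v_bound]
      by (intro continuous_on_mult continuous_on_const) (rule linear_continuous_on)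
  qed
  moreover have "span (range \<phi>) \<subseteq> {g. J (\<phi> a) g = \<rho> a * v (\<phi> a) g}"
  proof
    fix g assume g: "g \<in> span (range \<phi>)"
    have "(\<lambda>g. J (\<phi> a) g) g = (\<lambda>g. \<rho> a * v (\<phi> a) g) g"
    proof (rule linear_eq_on_span[OF _ _ _ g])
      show "linear (\<lambda>g. J (\<phi> a) g)" by (rule J.lin_right)
      show "linear (\<lambda>g. \<rho> a * v (\<phi> a) g)"
        by (rule linearI) (simp_all add: v.add_right v.scale_right algebra_simps)
    qed (auto simp: v_\<phi> J_\<phi>)
    thus "g \<in> {g. J (\<phi> a) g = \<rho> a * v (\<phi> a) g}" by simp
  qed
  ultimately have "closure (span (range \<phi>)) \<subseteq> {g. J (\<phi> a) g = \<rho> a * v (\<phi> a) g}"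
    by (simp add: closure_minimal)
  thus ?thesis using dense by auto
qed

lemma v_P: "a < k \<Longrightarrow> v (\<phi> a) (P k g) = v (\<phi> a) g"
  by (simp add: P_def v.sum_right v.scale_right v_\<phi> if_distrib cong: if_cong)

lemma orth_v: "f \<in> span (\<phi> ` {..<k}) \<Longrightarrow> v f (g - P k g) = 0"
  by (rule linear_eq_0_on_span[where f = "\<lambda>f. v f (g - P k g)", OF v.lin]) (auto simp: v.diff_right v_P)

lemma orth_J: "f \<in> span (\<phi> ` {..<k}) \<Longrightarrow> J f (g - P k g) = 0"
  by (rule linear_eq_0_on_span[where f = "\<lambda>f. J f (g - P k g)", OF J.lin]) (auto simp: J_eq v.diff_right v_P)

lemma P_in_span: "P k g \<in> span (\<phi> ` {..<k})"
  unfolding P_def by (intro span_sum span_scale span_base) auto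

lemma pythagoras:
  assumes "psd_form B" "B f e = 0" shows "B (f + e) (f + e) = B f f + B e e"
proof -
  interpret B: psd_form B by fact
  show ?thesis using assms(2) by (simp add: B.bilinear B.sym[of e f])
qed

lemma v_parseval: "v g g = (\<Sum>a<k. (v (\<phi> a) g)\<^sup>2) + v (g - P k g) (g - P k g)"
proof -
  have "v (P k g) (P k g) = (\<Sum>a<k. v (\<phi> a) g * v (\<phi> a) (P k g))"
    by (subst (1) P_def) (simp add: v.sum_left v.scale_left)
  also have "\<dots> = (\<Sum>a<k. (v (\<phi> a) g)\<^sup>2)" by (simp add: v_P power2_eq_square)
  finally show ?thesis
    using pythagoras[OF v.psd_form_axioms orth_v[OF P_in_span, of k g g]] by simp
qed

lemma J_parseval: "J g g = (\<Sum>a<k. \<rho> a * (v (\<phi> a) g)\<^sup>2) + J (g - P k g) (g - P k g)"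
proof -
  have "J (P k g) (P k g) = (\<Sum>a<k. v (\<phi> a) g * J (\<phi> a) (P k g))"
    by (subst (1) P_def) (simp add: J.sum_left J.scale_left)
  also have "\<dots> = (\<Sum>a<k. \<rho> a * (v (\<phi> a) g)\<^sup>2)" by (simp add: v_P J_eq power2_eq_square mult_ac)
  finally show ?thesis
    using pythagoras[OF J.psd_form_axioms orth_J[OF P_in_span, of k g g]] by simp
qed

text \<open>The difference \<open>g - f\<close> splits orthogonally for both forms, so
  \<open>P k g\<close> is the best approximation for \<open>v + J\<close>; passing to the norm costs
  the two equivalence constants.\<close>

lemma P_best:
  assumes "f \<in> span (\<phi> ` {..<k})"
  shows "M1 * (norm (g - P k g))\<^sup>2 \<le> M2 * (norm (g - f))\<^sup>2"
proof -
  let ?e = "g - P k g" and ?s = "P k g - f"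
  have s: "?s \<in> span (\<phi> ` {..<k})" by (intro span_diff P_in_span assms)
  have "v (?s + ?e) (?s + ?e) = v ?s ?s + v ?e ?e" by (rule pythagoras[OF v.psd_form_axioms orth_v[OF s]])
  moreover have "J (?s + ?e) (?s + ?e) = J ?s ?s + J ?e ?e" by (rule pythagoras[OF J.psd_form_axioms orth_J[OF s]])
  moreover have "?s + ?e = g - f" by simp
  ultimately show ?thesis
    using norm_le[of ?e] le_norm[of "g - f"] v.pos[of ?s] J.pos[of ?s] by simp
qed

lemma P_tendsto: "(\<lambda>k. P k g) \<longlonglongrightarrow> g"
proof (rule LIMSEQ_I)
  fix e :: real assume e: "e > 0"
  \<comment> \<open>Chosen so that \<open>P_best\<close> turns distance \<open>c\<close> into
    distance \<open>e\<close>; the positive \<open>\<bar>M2\<bar> + 1\<close> replaces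
    \<open>M2\<close> as a divisor.\<close>
  define c where "c = sqrt (M1 / (\<bar>M2\<bar> + 1)) * e"
  have c: "c > 0" using e M1 by (simp add: c_def)
  have "g \<in> closure (span (range \<phi>))" using dense by simp
  then obtain f where f: "f \<in> span (range \<phi>)" "dist f g < c"
    using c by (auto simp: closure_approachable)
  obtain T r where T: "finite T" "T \<subseteq> range \<phi>" and fT: "f = (\<Sum>a\<in>T. r a *\<^sub>R a)"
    using f(1) by (auto simp: span_explicit)
  obtain I where I: "finite I" "T = \<phi> ` I" using finite_subset_image[OF T] by metis
  obtain k0 where k0: "I \<subseteq> {..<k0}" using I(1) finite_nat_iff_bounded by auto
  have "norm (P k g - g) < e" if "k \<ge> k0" for k
  proof -
    have "I \<subseteq> {..<k}" using k0 that by auto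
    hence "T \<subseteq> \<phi> ` {..<k}" unfolding I(2) by (rule image_mono)
    hence "f \<in> span (\<phi> ` {..<k})" unfolding fT by (intro span_sum span_scale span_base) auto
    hence "M1 * (norm (g - P k g))\<^sup>2 \<le> M2 * (norm (g - f))\<^sup>2" by (rule P_best)
    also have "\<dots> \<le> (\<bar>M2\<bar> + 1) * (norm (g - f))\<^sup>2" by (intro mult_right_mono) auto
    also have "\<dots> < (\<bar>M2\<bar> + 1) * c\<^sup>2"
    proof (intro mult_strict_left_mono power_strict_mono)
      show "norm (g - f) < c" using f(2) by (simp add: dist_norm norm_minus_commute)
    qed auto
    also have "\<dots> = M1 * e\<^sup>2"
    proof -
      have "c\<^sup>2 = M1 / (\<bar>M2\<bar> + 1) * e\<^sup>2" using M1 by (simp add: c_def power_mult_distrib)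
      moreover have "\<bar>M2\<bar> + 1 \<noteq> 0" by simp
      ultimately show ?thesis by simp
    qed
    finally have "(norm (g - P k g))\<^sup>2 < e\<^sup>2" using M1 by simp
    hence "norm (g - P k g) < e" using e by (simp add: power_less_imp_less_base)
    thus ?thesis by (simp add: norm_minus_commute)
  qed
  thus "\<exists>k0. \<forall>k\<ge>k0. norm (P k g - g) < e" by (intro exI[of _ k0] allI impI)
qed

text \<open>Beyond \<open>k\<close> each squared coefficient is at most \<open>\<rho> a / R\<close>
  times itself, and the weighted squares add up to at most \<open>J g g\<close>. The expansion is
  cut at a finite \<open>i\<close>, and convergence of \<open>P\<close> makes the remainder smaller
  than any \<open>e\<close>.\<close>

lemma v_tail:
  assumes R: "R > 0" "\<And>a. a \<ge> k \<Longrightarrow> \<rho> a \<ge> R"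
  shows "v g g \<le> (\<Sum>a<k. (v (\<phi> a) g)\<^sup>2) + J g g / R"
proof (rule field_le_epsilon)
  fix e :: real assume e: "e > 0"
  have "(\<lambda>i. M2 * (norm (g - P i g))\<^sup>2) \<longlonglongrightarrow> M2 * (norm (g - g))\<^sup>2"
    by (intro tendsto_intros P_tendsto)
  hence "eventually (\<lambda>i. M2 * (norm (g - P i g))\<^sup>2 < e) sequentially"
    using e by (intro order_tendstoD(2)) auto
  then obtain i where i: "M2 * (norm (g - P i g))\<^sup>2 < e" "i \<ge> k"
    using eventually_happens[OF eventually_conj[OF _ eventually_ge_at_top[of k]]] by fastforce
  have "(\<Sum>a<i. (v (\<phi> a) g)\<^sup>2) = (\<Sum>a<k. (v (\<phi> a) g)\<^sup>2) + (\<Sum>a=k..<i. (v (\<phi> a) g)\<^sup>2)"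
    using i(2) by (metis atLeast0LessThan le0 sum.atLeastLessThan_concat)
  also have "(\<Sum>a=k..<i. (v (\<phi> a) g)\<^sup>2) \<le> (\<Sum>a=k..<i. \<rho> a * (v (\<phi> a) g)\<^sup>2 / R)"
  proof (rule sum_mono)
    fix a assume "a \<in> {k..<i}"
    hence "R * (v (\<phi> a) g)\<^sup>2 \<le> \<rho> a * (v (\<phi> a) g)\<^sup>2" using R by (intro mult_right_mono) auto
    thus "(v (\<phi> a) g)\<^sup>2 \<le> \<rho> a * (v (\<phi> a) g)\<^sup>2 / R" using R by (simp add: field_simps)
  qed
  also have "(\<Sum>a=k..<i. \<rho> a * (v (\<phi> a) g)\<^sup>2 / R) \<le> (\<Sum>a<i. \<rho> a * (v (\<phi> a) g)\<^sup>2 / R)"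
    using \<rho> R by (intro sum_mono2) auto
  also have "\<dots> = (\<Sum>a<i. \<rho> a * (v (\<phi> a) g)\<^sup>2) / R" by (simp add: sum_divide_distrib)
  also have "\<dots> \<le> J g g / R"
    using J_parseval[of g i] J.pos[of "g - P i g"] R by (intro divide_right_mono) auto
  finally show "v g g \<le> (\<Sum>a<k. (v (\<phi> a) g)\<^sup>2) + J g g / R + e"
    using v_parseval[of g i] v_bound[of "g - P i g"] i(1) by linarith
qed

end

section \<open>Polynomial growth of the eigenvalues\<close>

text \<open>Comparison with an integral: the mean value theorem bounds each term by a difference of
  \<open>z powr (1 - r)\<close>, and the differences telescope.\<close>

lemma powr_tail_sum:
  assumes r: "r > (1::real)" and k: "k \<ge> 1"
  shows "(\<Sum>i=k..<m. real (Suc i) powr (- r)) \<le> real k powr (1 - r) / (r - 1)"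
proof -
  have step: "real (Suc i) powr (- r) \<le> (real i powr (1 - r) - real (Suc i) powr (1 - r)) / (r - 1)"
    if "i \<ge> 1" for i
  proof -
    have "\<exists>z. real i < z \<and> z < real (Suc i) \<and>
       real (Suc i) powr (1 - r) - real i powr (1 - r) = (real (Suc i) - real i) * ((1 - r) * z powr (1 - r - 1))"
    proof (rule MVT2)
      fix x assume x: "real i \<le> x"
      show "((\<lambda>a. a powr (1 - r)) has_real_derivative (1 - r) * x powr (1 - r - 1)) (at x)"
        by (rule has_real_derivative_powr) (use x that in simp)
    qed simp
    then obtain z where z: "real i < z" "z < real (Suc i)"
      "real (Suc i) powr (1 - r) - real i powr (1 - r) = (1 - r) * z powr (- r)" by auto
    have "real (Suc i) powr (- r) \<le> z powr (- r)" using z that r by (intro powr_mono2') auto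
    hence "(r - 1) * real (Suc i) powr (- r) \<le> (r - 1) * z powr (- r)" using r by (intro mult_left_mono) auto
    also have "\<dots> = real i powr (1 - r) - real (Suc i) powr (1 - r)" using z(3) by (simp add: algebra_simps)
    finally show ?thesis using r by (simp add: field_simps)
  qed
  show ?thesis
  proof (cases "k \<le> m")
    case True
    have "(\<Sum>i=k..<m. real (Suc i) powr (- r))
        \<le> (\<Sum>i=k..<m. (real i powr (1 - r) - real (Suc i) powr (1 - r)) / (r - 1))"
      using k by (intro sum_mono step) auto
    also have "\<dots> = - (\<Sum>i=k..<m. real (Suc i) powr (1 - r) - real i powr (1 - r)) / (r - 1)"
      by (simp add: sum_divide_distrib[symmetric] sum_negf[symmetric])
    also have "\<dots> = (real k powr (1 - r) - real m powr (1 - r)) / (r - 1)"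
      using True by (subst sum_Suc_diff') auto
    also have "\<dots> \<le> real k powr (1 - r) / (r - 1)" using r by (intro divide_right_mono) auto
    finally show ?thesis .
  qed (use r in simp)
qed

text \<open>\<open>l * \<rho> i\<close> reaches order 1 near \<open>i = l powr (- 1 / r)\<close>.
  Each earlier index contributes at most 1 to the trace, and the later ones form a convergent tail
  of the same order.\<close>

lemma effective_dimension:
  assumes r: "r > (1::real)" and \<beta>: "\<beta> > 0" and \<rho>: "\<And>i :: nat. \<rho> i \<ge> \<beta> * real (Suc i) powr r"
  shows "\<exists>C>0. \<forall>l. 0 < l \<longrightarrow> l \<le> 1 \<longrightarrow>
    (\<forall>m. (\<Sum>i<m. 1 / (1 + l * \<rho> i)) \<le> C * l powr (- 1 / r)) \<and>
    (\<exists>k. real k \<le> C * l powr (- 1 / r) \<and> (\<forall>i\<ge>k. l * \<rho> i \<ge> 1))"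
proof -
  \<comment> \<open>The 2 absorbs rounding up, because \<open>d \<ge> 1\<close>; the second summand
    is the tail of the trace and the third the cut-off index.\<close>
  define C where "C = 2 + 1 / (\<beta> * (r - 1)) + \<beta> powr (- 1 / r)"
  have C: "C > 0" using r \<beta> by (simp add: C_def add_pos_pos)
  have "(\<forall>m. (\<Sum>i<m. 1 / (1 + l * \<rho> i)) \<le> C * l powr (- 1 / r)) \<and>
    (\<exists>k. real k \<le> C * l powr (- 1 / r) \<and> (\<forall>i\<ge>k. l * \<rho> i \<ge> 1))" if l: "0 < l" "l \<le> 1" for l
  proof
    define d where "d = l powr (- 1 / r)"
    have d: "d \<ge> 1"
    proof -
      have "1 powr (- 1 / r) \<le> l powr (- 1 / r)" using l r by (intro powr_mono2') auto
      thus ?thesis by (simp add: d_def)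
    qed
    have ld: "l = d powr (- r)" using l r by (simp add: d_def powr_powr)
    have \<rho>pos: "\<rho> i > 0" for i using \<rho>[of i] \<beta> by (smt (verit) mult_pos_pos of_nat_0_less_iff powr_gt_zero zero_less_Suc)
    define k where "k = nat \<lceil>d\<rceil>"
    have k: "k \<ge> 1" "d \<le> real k" "real k \<le> d + 1" using d unfolding k_def by linarith+
    show "\<forall>m. (\<Sum>i<m. 1 / (1 + l * \<rho> i)) \<le> C * l powr (- 1 / r)"
    proof
      fix m
      have "(\<Sum>i<m. 1 / (1 + l * \<rho> i)) \<le> (\<Sum>i<max k m. 1 / (1 + l * \<rho> i))"
        using l \<rho>pos by (intro sum_mono2) (auto simp: less_imp_le add_pos_pos)
      also have "\<dots> = (\<Sum>i<k. 1 / (1 + l * \<rho> i)) + (\<Sum>i=k..<max k m. 1 / (1 + l * \<rho> i))"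
        by (metis atLeast0LessThan le0 max.cobounded1 sum.atLeastLessThan_concat)
      also have "(\<Sum>i<k. 1 / (1 + l * \<rho> i)) \<le> (\<Sum>i<k. 1)"
        using l \<rho>pos by (intro sum_mono) (simp add: divide_le_eq less_imp_le add_pos_pos)
      also have "(\<Sum>i=k..<max k m. 1 / (1 + l * \<rho> i)) \<le> (\<Sum>i=k..<max k m. d powr r / \<beta> * real (Suc i) powr (- r))"
      proof (rule sum_mono)
        fix i
        have "1 / (1 + l * \<rho> i) \<le> 1 / (l * (\<beta> * real (Suc i) powr r))"
        proof (rule divide_left_mono)
          show "l * (\<beta> * real (Suc i) powr r) \<le> 1 + l * \<rho> i"
            using mult_left_mono[OF \<rho>[of i], of l] l by linarith
        qed (use l \<beta> \<rho>pos[of i] in \<open>auto intro!: mult_pos_pos add_pos_pos\<close>)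
        also have "\<dots> = d powr r / \<beta> * real (Suc i) powr (- r)"
          unfolding ld by (simp add: powr_minus field_simps)
        finally show "1 / (1 + l * \<rho> i) \<le> d powr r / \<beta> * real (Suc i) powr (- r)" .
      qed
      also have "\<dots> = d powr r / \<beta> * (\<Sum>i=k..<max k m. real (Suc i) powr (- r))"
        by (simp add: sum_distrib_left)
      also have "\<dots> \<le> d powr r / \<beta> * (real k powr (1 - r) / (r - 1))"
        using \<beta> by (intro mult_left_mono powr_tail_sum r k) auto
      also have "real k powr (1 - r) / (r - 1) \<le> d powr (1 - r) / (r - 1)"
        using k d r by (intro divide_right_mono powr_mono2') auto
      also have "d powr r / \<beta> * (d powr (1 - r) / (r - 1)) = d / (\<beta> * (r - 1))"
        using d by (simp add: powr_add[symmetric])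
      finally have "(\<Sum>i<m. 1 / (1 + l * \<rho> i)) \<le> real k + d / (\<beta> * (r - 1))"
        using \<beta> by (simp add: mult_left_mono divide_right_mono)
      also have "\<dots> \<le> 2 * d + 1 / (\<beta> * (r - 1)) * d" using k d by simp
      also have "\<dots> \<le> C * d" unfolding C_def using d by (simp add: distrib_right)
      finally show "(\<Sum>i<m. 1 / (1 + l * \<rho> i)) \<le> C * l powr (- 1 / r)" by (simp add: d_def)
    qed
    define k' where "k' = nat \<lceil>\<beta> powr (- 1 / r) * d\<rceil>"
    have kk: "real k' \<le> \<beta> powr (- 1 / r) * d + 1" "\<beta> powr (- 1 / r) * d \<le> real k'"
      using d unfolding k'_def by (auto simp: of_nat_ceiling)
    moreover note kk(1)
    moreover have "l * \<rho> i \<ge> 1" if "i \<ge> k'" for i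
    proof -
      have "1 = l * (\<beta> * (\<beta> powr (- 1 / r) * d) powr r)"
      proof -
        have "(\<beta> powr (- 1 / r)) powr r = \<beta> powr (- 1)" unfolding powr_powr using r by simp
        also have "\<dots> = 1 / \<beta>" using \<beta> by (simp add: powr_minus_divide)
        finally have "(\<beta> powr (- 1 / r) * d) powr r = d powr r / \<beta>" using d by (simp add: powr_mult)
        thus ?thesis unfolding ld using d \<beta> by (simp add: powr_minus_divide)
      qed
      also have "\<dots> \<le> l * (\<beta> * real (Suc i) powr r)"
        using l \<beta> that r d kk(2) by (intro mult_left_mono powr_mono2) auto
      also have "\<dots> \<le> l * \<rho> i" using l \<rho> by (intro mult_left_mono) auto
      finally show ?thesis .
    qed
    moreover have "\<beta> powr (- 1 / r) * d + 1 \<le> C * d"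
    proof -
      have "0 \<le> 1 / (\<beta> * (r - 1)) * d" using r \<beta> d by simp
      thus ?thesis unfolding C_def using d by (simp add: distrib_right)
    qed
    ultimately show "\<exists>k. real k \<le> C * l powr (- 1 / r) \<and> (\<forall>i\<ge>k. l * \<rho> i \<ge> 1)"
      unfolding d_def[symmetric] by (intro exI[of _ k']) auto
  qed
  with C show ?thesis by blast
qed

section \<open>Counting lattice points and nets in coordinates\<close>

lemma sum_half_power: "(\<Sum>z\<in>{- int n..int n}. (1 / 2 :: real) ^ nat \<bar>z\<bar>) \<le> 3"
proof -
  have "(\<Sum>z\<in>{- int n..int n}. (1 / 2 :: real) ^ nat \<bar>z\<bar>) = 3 - 2 * (1 / 2) ^ n"
  proof (induction n)
    case (Suc n)
    have "{- int (Suc n)..int (Suc n)} = insert (- int (Suc n)) (insert (int (Suc n)) {- int n..int n})" by auto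
    thus ?case using Suc by (simp add: nat_add_distrib)
  qed simp
  thus ?thesis by simp
qed

lemma int_abs_le_square: "real_of_int \<bar>z\<bar> \<le> (real_of_int z)\<^sup>2"
proof (cases "z = 0")
  case False
  hence "\<bar>z\<bar> * 1 \<le> \<bar>z\<bar> * \<bar>z\<bar>" by (intro mult_left_mono) auto
  hence "\<bar>z\<bar> \<le> z\<^sup>2" by (simp add: power2_eq_square)
  thus ?thesis by (metis of_int_le_iff of_int_power)
qed simp

text \<open>A Chernoff-type count: every admissible \<open>z\<close> has weight
  \<open>exp (\<Sum> (B - z\<^sup>2))\<close> at least 1, and the total weight factorises over
  coordinates. A box of radius \<open>sqrt (B * k)\<close> would give a base growing with
  \<open>k\<close>, hence an additional logarithm in the entropy. The number \<open>n\<close> only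
  makes the box finite.\<close>

lemma card_integer_ball:
  fixes A :: "(nat \<Rightarrow> int) set"
  assumes A: "A \<subseteq> extensional {..<k}" "\<And>z. z \<in> A \<Longrightarrow> (\<Sum>a<k. (real_of_int (z a))\<^sup>2) \<le> B * real k"
  shows "finite A" "real (card A) \<le> (3 * exp B) ^ k"
proof -
  define n where "n = nat \<lceil>B * real k\<rceil>"
  let ?F = "PiE {..<k} (\<lambda>_. {- int n..int n})"
  have sub: "A \<subseteq> ?F"
  proof
    fix z assume z: "z \<in> A"
    have "z a \<in> {- int n..int n}" if a: "a < k" for a
    proof -
      have "real_of_int (\<bar>z a\<bar>) \<le> (real_of_int (z a))\<^sup>2"
        by (rule int_abs_le_square)
      also have "\<dots> \<le> (\<Sum>a<k. (real_of_int (z a))\<^sup>2)"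
        using a by (intro member_le_sum) auto
      also have "\<dots> \<le> B * real k" by (rule A(2)[OF z])
      finally have "\<bar>z a\<bar> \<le> int n" unfolding n_def by linarith
      thus ?thesis by auto
    qed
    thus "z \<in> ?F" using z A(1) by (auto simp: PiE_def)
  qed
  have fin: "finite ?F" by (simp add: finite_PiE)
  thus "finite A" using sub finite_subset by blast
  have sq: "exp (- (real_of_int z)\<^sup>2) \<le> (1 / 2) ^ nat \<bar>z\<bar>" for z
  proof -
    have "real (nat \<bar>z\<bar>) \<le> (real_of_int z)\<^sup>2" using int_abs_le_square[of z] by simp
    hence "exp (- (real_of_int z)\<^sup>2) \<le> exp (- real (nat \<bar>z\<bar>))" by simp
    also have "\<dots> = exp (- 1) ^ nat \<bar>z\<bar>" by (simp add: exp_of_nat_mult[symmetric])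
    also have "\<dots> \<le> (1 / 2) ^ nat \<bar>z\<bar>"
    proof (rule power_mono)
      have "2 \<le> exp (1::real)" using exp_ge_add_one_self[of 1] by simp
      thus "exp (- 1) \<le> (1 / 2 :: real)" by (simp add: exp_minus field_simps)
    qed simp
    finally show ?thesis .
  qed
  have "real (card A) = (\<Sum>z\<in>A. 1)" by simp
  also have "\<dots> \<le> (\<Sum>z\<in>A. \<Prod>a<k. exp (B - (real_of_int (z a))\<^sup>2))"
  proof (rule sum_mono)
    fix z assume z: "z \<in> A"
    have "0 \<le> (\<Sum>a<k. B - (real_of_int (z a))\<^sup>2)" using A(2)[OF z] by (simp add: sum_subtractf mult.commute)
    thus "1 \<le> (\<Prod>a<k. exp (B - (real_of_int (z a))\<^sup>2))" by (simp add: exp_sum[symmetric])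
  qed
  also have "\<dots> \<le> (\<Sum>z\<in>?F. \<Prod>a<k. exp (B - (real_of_int (z a))\<^sup>2))"
    using sub fin by (intro sum_mono2) (auto intro: prod_nonneg)
  also have "\<dots> = (\<Prod>a<k. \<Sum>z\<in>{- int n..int n}. exp (B - (real_of_int z)\<^sup>2))"
    by (subst prod_sum_PiE) auto
  also have "\<dots> = (\<Sum>z\<in>{- int n..int n}. exp (B - (real_of_int z)\<^sup>2)) ^ k" by simp
  also have "\<dots> \<le> (3 * exp B) ^ k"
  proof (intro power_mono sum_nonneg)
    have "(\<Sum>z\<in>{- int n..int n}. exp (B - (real_of_int z)\<^sup>2)) \<le> (\<Sum>z\<in>{- int n..int n}. exp B * (1 / 2) ^ nat \<bar>z\<bar>)"
    proof (rule sum_mono)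
      fix z
      show "exp (B - (real_of_int z)\<^sup>2) \<le> exp B * (1 / 2) ^ nat \<bar>z\<bar>"
        using mult_left_mono[OF sq[of z], of "exp B"] by (simp add: exp_diff exp_minus field_simps)
    qed
    also have "\<dots> \<le> exp B * 3" using sum_half_power[of n] by (simp add: sum_distrib_left[symmetric])
    finally show "(\<Sum>z\<in>{- int n..int n}. exp (B - (real_of_int z)\<^sup>2)) \<le> 3 * exp B" by simp
  qed auto
  finally show "real (card A) \<le> (3 * exp B) ^ k" .
qed

text \<open>Coordinates are rounded to a grid of mesh \<open>s\<close>, chosen so that two points of
  one cell differ by at most \<open>\<theta> * V\<close> in the sum of squares. The rounded vectors
  lie in an integer ball of squared radius proportional to \<open>k\<close>, and one point of
  \<open>A\<close> represents each occupied cell.\<close>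

lemma coordinate_net:
  fixes f :: "nat \<Rightarrow> 'q \<Rightarrow> real"
  assumes le: "\<And>x. x \<in> A \<Longrightarrow> (\<Sum>a<k. (f a x)\<^sup>2) \<le> V" and V: "V > 0" and \<theta>: "\<theta> > 0" and k: "k > 0"
  shows "\<exists>N\<subseteq>A. finite N \<and> real (card N) \<le> (3 * exp (2 / \<theta> + 2)) ^ k \<and>
    (\<forall>x\<in>A. \<exists>d\<in>N. (\<Sum>a<k. (f a x - f a d)\<^sup>2) \<le> \<theta> * V)"
proof -
  define s where "s = sqrt (\<theta> * V / real k)"
  have s: "s > 0" using \<theta> V k by (simp add: s_def)
  have s2: "s\<^sup>2 = \<theta> * V / real k" using \<theta> V by (simp add: s_def)
  define z where "z x = (\<lambda>a\<in>{..<k}. \<lfloor>f a x / s\<rfloor>)" for x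
  have bound: "(\<Sum>a<k. (real_of_int (z x a))\<^sup>2) \<le> (2 / \<theta> + 2) * real k" if x: "x \<in> A" for x
  proof -
    have "(real_of_int \<lfloor>y\<rfloor>)\<^sup>2 \<le> 2 * y\<^sup>2 + 2" for y :: real
    proof -
      have "\<bar>real_of_int \<lfloor>y\<rfloor>\<bar> \<le> \<bar>y\<bar> + 1" by linarith
      hence "\<bar>real_of_int \<lfloor>y\<rfloor>\<bar>\<^sup>2 \<le> (\<bar>y\<bar> + 1)\<^sup>2" by (intro power_mono) auto
      also have "\<dots> \<le> 2 * y\<^sup>2 + 2" using zero_le_power2[of "\<bar>y\<bar> - 1"] by (simp add: power2_eq_square algebra_simps)
      finally show ?thesis by simp
    qed
    hence "(\<Sum>a<k. (real_of_int (z x a))\<^sup>2) \<le> (\<Sum>a<k. 2 * (f a x / s)\<^sup>2 + 2)"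
      by (intro sum_mono) (simp add: z_def)
    also have "\<dots> = 2 * (\<Sum>a<k. (f a x)\<^sup>2) / s\<^sup>2 + 2 * real k"
      by (simp add: sum.distrib sum_divide_distrib sum_distrib_left power_divide)
    also have "\<dots> \<le> 2 * V / s\<^sup>2 + 2 * real k"
      using le[OF x] by (intro add_right_mono divide_right_mono mult_left_mono) auto
    also have "\<dots> = (2 / \<theta> + 2) * real k" using V k \<theta> by (simp add: s2 field_simps)
    finally show ?thesis .
  qed
  note card = card_integer_ball[of "z ` A" k "2 / \<theta> + 2"]
  have fin: "finite (z ` A)" "real (card (z ` A)) \<le> (3 * exp (2 / \<theta> + 2)) ^ k"
    using bound by (intro card; auto simp: z_def)+
  define N where "N = (\<lambda>w. SOME x. x \<in> A \<and> z x = w) ` (z ` A)"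
  have rep: "(SOME y. y \<in> A \<and> z y = z x) \<in> A \<and> z (SOME y. y \<in> A \<and> z y = z x) = z x" if "x \<in> A" for x
    using someI[of "\<lambda>y. y \<in> A \<and> z y = z x" x] that by simp
  have "N \<subseteq> A" using rep by (auto simp: N_def)
  moreover have "finite N" "real (card N) \<le> (3 * exp (2 / \<theta> + 2)) ^ k"
    using fin card_image_le[OF fin(1), of "\<lambda>w. SOME x. x \<in> A \<and> z x = w"]
    unfolding N_def by (simp, linarith)
  moreover have "\<exists>d\<in>N. (\<Sum>a<k. (f a x - f a d)\<^sup>2) \<le> \<theta> * V" if x: "x \<in> A" for x
  proof -
    define d where "d = (SOME y. y \<in> A \<and> z y = z x)"
    have d: "d \<in> N" "z d = z x" using rep[OF x] x by (auto simp: N_def d_def)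
    have "(f a x - f a d)\<^sup>2 \<le> s\<^sup>2" if "a < k" for a
    proof -
      have "\<lfloor>f a x / s\<rfloor> = \<lfloor>f a d / s\<rfloor>" using fun_cong[OF d(2), of a] that by (simp add: z_def)
      hence "\<bar>f a x / s - f a d / s\<bar> \<le> 1" by linarith
      hence "\<bar>f a x - f a d\<bar> \<le> s" using s by (simp add: diff_divide_distrib[symmetric])
      hence "\<bar>f a x - f a d\<bar>\<^sup>2 \<le> s\<^sup>2" by (intro power_mono) auto
      thus ?thesis by simp
    qed
    hence "(\<Sum>a<k. (f a x - f a d)\<^sup>2) \<le> (\<Sum>a<k. s\<^sup>2)" by (intro sum_mono) auto
    also have "\<dots> = \<theta> * V" using k by (simp add: s2)
    finally show ?thesis using d by blast
  qed
  ultimately show ?thesis by blast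
qed

section \<open>Deviation of the estimator\<close>

text \<open>The good events for different truncation levels need not be nested. Their limit superior
  keeps the probability, by continuity along the decreasing unions.\<close>

lemma (in prob_space) frequently_prob_ge:
  assumes A: "\<And>k :: nat. A k \<in> events" and p: "\<And>k. prob (A k) \<ge> p"
  shows "(\<Inter>k. \<Union>i\<in>{k..}. A i) \<in> events" "prob (\<Inter>k. \<Union>i\<in>{k..}. A i) \<ge> p"
proof -
  let ?U = "\<lambda>k. \<Union>i\<in>{k..}. A i"
  have U: "?U k \<in> events" for k using A by (intro sets.countable_UN'') auto
  show "(\<Inter>k. ?U k) \<in> events" using U by (intro sets.countable_INT) auto
  have "decseq ?U" unfolding decseq_def by (intro allI impI UN_mono) auto
  hence "(\<lambda>k. prob (?U k)) \<longlonglongrightarrow> prob (\<Inter>k. ?U k)"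
    using U by (intro finite_Lim_measure_decseq) auto
  moreover have "prob (?U k) \<ge> p" for k
    using p[of k] U by (intro order.trans[OF p[of k]] finite_measure_mono) auto
  ultimately show "prob (\<Inter>k. ?U k) \<ge> p" by (intro LIMSEQ_le_const) auto
qed

lemma (in prob_space) prob_ge_AE:
  assumes A: "A \<in> events" "prob A \<ge> p" and G: "AE \<omega> in M. G \<omega>"
  obtains A' where "A' \<in> events" "A' \<subseteq> A" "prob A' \<ge> p" "\<And>\<omega>. \<omega> \<in> A' \<Longrightarrow> G \<omega>"
proof -
  obtain N where N: "{\<omega> \<in> space M. \<not> G \<omega>} \<subseteq> N" "N \<in> events" "emeasure M N = 0"
    using G by (auto elim!: AE_E)
  have "prob (A - N) = prob A"
    using A N by (intro measure_Diff_null_set) (auto simp: null_sets_def)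
  moreover have "G \<omega>" if "\<omega> \<in> A - N" for \<omega>
    using that N(1) sets.sets_into_space[OF A(1)] by blast
  ultimately show ?thesis using A N by (intro that[of "A - N"]) auto
qed

text \<open>Adds coordinates in which the penalty is controlled by the weights
  \<open>\<rho>\<close>. The Euclidean and the functional part may be correlated in
  \<open>q\<close>, so the coordinates are not \<open>q\<close>-orthonormal; inequalities with the
  constant \<open>CL\<close> take the place of Parseval's identity.\<close>

locale graded_family = convex_family Q h D S q C1 C2 \<kappa> + B: psd_form B + j: psd_form j
  for Q :: "'x measure" and h :: "'q::real_normed_vector \<Rightarrow> 'x \<Rightarrow> real" and D S q C1 C2 \<kappa>
    and B j :: "'q \<Rightarrow> 'q \<Rightarrow> real" +
  fixes c :: "nat \<Rightarrow> 'q \<Rightarrow> real" and b :: "nat \<Rightarrow> 'q" and \<rho> :: "nat \<Rightarrow> real" and CL :: real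
  assumes q_eq: "\<And>u. q u = B u u"
    and c_lin: "\<And>a. linear (c a)"
    and expansion: "\<And>u. (\<lambda>k. \<Sum>a<k. c a u *\<^sub>R b a) \<longlonglongrightarrow> u"
    and \<rho>: "\<And>a. \<rho> a \<ge> 0" and CL: "CL \<ge> 1"
    and bessel_q: "\<And>k u. (\<Sum>a<k. (c a u)\<^sup>2) \<le> CL * q u"
    and bessel_j: "\<And>k u. (\<Sum>a<k. \<rho> a * (c a u)\<^sup>2) \<le> j u u"
    and q_tail: "\<And>k R u. R > 0 \<Longrightarrow> (\<And>a. a \<ge> k \<Longrightarrow> \<rho> a \<ge> R) \<Longrightarrow>
        q u \<le> CL * ((\<Sum>a<k. (c a u)\<^sup>2) + j u u / R)"
    and q_b: "\<And>a. q (b a) \<le> CL"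
begin

lemma q_tendsto:
  assumes u: "u \<longlonglongrightarrow> (l :: 'q)" shows "(\<lambda>k. q (u k)) \<longlonglongrightarrow> q l"
proof -
  obtain C where C: "\<And>u. q u \<le> C * (norm u)\<^sup>2" using q_le by blast
  have eq: "q (u k) = q l + (2 * B l (u k - l) + q (u k - l))" for k
    by (simp add: q_eq B.bilinear B.sym[of "u k" l])
  have n0: "(\<lambda>k. norm (u k - l)) \<longlonglongrightarrow> 0" using u by (simp add: LIM_zero tendsto_norm_zero)
  have "(\<lambda>k. q (u k - l)) \<longlonglongrightarrow> 0"
  proof (rule tendsto_sandwich[OF _ _ tendsto_const])
    show "(\<lambda>k. C * (norm (u k - l))\<^sup>2) \<longlonglongrightarrow> 0" using tendsto_mult[OF tendsto_const tendsto_power[OF n0, of 2], of C] by simp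
  qed (use C q_nonneg in auto)
  moreover from this have "(\<lambda>k. 2 * B l (u k - l)) \<longlonglongrightarrow> 0"
  proof -
    have "(\<lambda>k. 2 * (sqrt (q l) * sqrt (q (u k - l)))) \<longlonglongrightarrow> 2 * (sqrt (q l) * sqrt 0)"
      by (intro tendsto_intros \<open>(\<lambda>k. q (u k - l)) \<longlonglongrightarrow> 0\<close>)
    hence lim0: "(\<lambda>k. 2 * (sqrt (q l) * sqrt (q (u k - l)))) \<longlonglongrightarrow> 0" by simp
    have "norm (2 * B l (u k - l)) \<le> 2 * (sqrt (q l) * sqrt (q (u k - l)))" for k
      using B.cauchy_schwarz[of l "u k - l"] unfolding q_eq[symmetric] by (simp add: abs_mult)
    thus ?thesis by (intro Lim_null_comparison[OF _ lim0] always_eventually allI)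
  qed
  ultimately have "(\<lambda>k. q l + (2 * B l (u k - l) + q (u k - l))) \<longlonglongrightarrow> q l + (0 + 0)"
    by (intro tendsto_intros)
  thus ?thesis unfolding eq[symmetric] by simp
qed

text \<open>The PAC-Bayes bound is applied at each net point \<open>d\<close> and truncation level
  \<open>k\<close>; the tilts are the rescaled coordinates of \<open>u\<close>. The error terms
  come, in this order, from the second moment of the tangent, the trace of the prior covariance, the
  relative entropy, and the union over \<open>F\<close> together with the error probability.\<close>

lemma sample_lower_bound:
  fixes X :: "nat \<Rightarrow> 'w \<Rightarrow> 'x"
  assumes P: "prob_space P" and indep: "prob_space.indep_vars P (\<lambda>_. N) X UNIV"
    and X: "\<And>i. distr P N (X i) = Q" and QN: "sets Q = sets N"
    and n: "n \<ge> 1" and l: "l > 0" and F: "finite F" "F \<noteq> {}" "F \<subseteq> S"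
    and dim: "\<And>k. (\<Sum>a<k. 1 / (1 + l * \<rho> a)) \<le> w"
    and \<beta>: "\<beta> > 0" "\<beta> * (2 * ln \<kappa>) \<le> 1" and s: "s > 0" and \<epsilon>: "\<epsilon> > 0" "\<epsilon> \<le> 1"
  obtains A where "A \<in> sets P" "measure P A \<ge> 1 - \<epsilon>"
    "\<And>\<omega> d u. \<omega> \<in> A \<Longrightarrow> d \<in> F \<Longrightarrow> d + u \<in> S \<Longrightarrow> q u + l * j u u \<le> r2 \<Longrightarrow>
      (\<Sum>i<n. \<psi> (d + u) (X i \<omega>) - \<psi> d (X i \<omega>)) \<ge> real n * m d u
        - (7 * real n * \<beta> * CY * r2 + 13 * \<beta> * s * CY * CL * w + real n * CL * r2 / (s * \<beta>)
           + ln (real (card F) / \<epsilon>) / \<beta>)"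
proof -
  interpret P: prob_space P by (rule P)
  have XM: "X i \<in> measurable P N" for i using indep by (auto simp: P.indep_vars_def)
  note [measurable] = XM
  have n0: "real n > 0" using n by simp
  \<comment> \<open>The prior scale follows the penalised form:
    \<open>(c a u / \<sigma> a)\<^sup>2\<close> is \<open>n / s\<close> times
    \<open>(1 + l * \<rho> a) * (c a u)\<^sup>2\<close>, so the entropy is controlled by
    \<open>q u + l * j u u\<close>, while the squares of \<open>\<sigma>\<close> sum to
    \<open>s / n\<close> times the effective dimension.\<close>
  define \<sigma> where "\<sigma> a = sqrt (s / (real n * (1 + l * \<rho> a)))" for a
  have lp: "1 + l * \<rho> a > 0" for a using l \<rho>[of a] by (simp add: add_pos_nonneg)
  have \<sigma>: "\<sigma> a > 0" for a using s n0 lp by (simp add: \<sigma>_def)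
  have \<sigma>2: "(\<sigma> a)\<^sup>2 = s / (real n * (1 + l * \<rho> a))" for a
    using s n0 lp[of a] by (simp add: \<sigma>_def less_imp_le)
  define z where "z d a x = \<beta> * \<sigma> a * Y d (b a) x" for d a x
  define R where "R = real n / s * CL * r2"
  have zN: "z d a \<in> borel_measurable N" "integrable Q (\<lambda>x. (z d a x)\<^sup>2)" if "d \<in> F" for d a
  proof -
    have dS: "d \<in> S" using that F by auto
    have "z d a \<in> borel_measurable Q" unfolding z_def using Y_meas[OF dS] by measurable
    thus "z d a \<in> borel_measurable N" using QN by (simp cong: measurable_cong_sets)
    show "integrable Q (\<lambda>x. (z d a x)\<^sup>2)" unfolding z_def power_mult_distrib using Y_sq(1)[OF dS] by simp
  qed
  define good where "good d k T \<longleftrightarrow> T \<in> borel_measurable P \<and> (\<forall>\<omega>. T \<omega> > 0) \<and> (\<integral>\<^sup>+\<omega>. ennreal (T \<omega>) \<partial>P) \<le> 1 \<and>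
    (\<forall>\<omega> t. (\<Sum>a<k. (t a)\<^sup>2) \<le> R \<longrightarrow>
       (\<Sum>i<n. max (\<Sum>a<k. t a * z d a (X i \<omega>)) (-1))
       \<ge> real n * (\<Sum>a<k. t a * (\<integral>x. z d a x \<partial>Q)) - 7 * real n * (\<integral>x. (\<Sum>a<k. t a * z d a x)\<^sup>2 \<partial>Q)
         - 13 * real n * (\<Sum>a<k. \<integral>x. (z d a x)\<^sup>2 \<partial>Q) - (\<Sum>a<k. (t a)\<^sup>2) - ln (T \<omega>))"
    for d :: 'q and k and T :: "'w \<Rightarrow> real"
  have "\<exists>T. good d k T" if "d \<in> F" for d k
    by (rule P.pac_bayes_linear[where I = "{..<k}" and N = N and X = X and Q = Q and z = "z d" and R = R and n = n,
          OF _ indep X QN]) (simp_all add: zN[OF that], unfold good_def, blast)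
  hence "\<forall>d k. \<exists>T. d \<in> F \<longrightarrow> good d k T" by blast
  then obtain T where "\<forall>d k. d \<in> F \<longrightarrow> good d k (T d k)" by metis
  hence gT: "good d k (T d k)" if "d \<in> F" for d k using that by blast
  have T: "T d k \<in> borel_measurable P" "T d k \<omega> > 0" "(\<integral>\<^sup>+\<omega>. ennreal (T d k \<omega>) \<partial>P) \<le> 1"
    if "d \<in> F" for d k \<omega>
    using gT[OF that, of k] unfolding good_def by simp_all
  have pac: "(\<Sum>i<n. max (\<Sum>a<k. t a * z d a (X i \<omega>)) (-1))
       \<ge> real n * (\<Sum>a<k. t a * (\<integral>x. z d a x \<partial>Q)) - 7 * real n * (\<integral>x. (\<Sum>a<k. t a * z d a x)\<^sup>2 \<partial>Q)
         - 13 * real n * (\<Sum>a<k. \<integral>x. (z d a x)\<^sup>2 \<partial>Q) - (\<Sum>a<k. (t a)\<^sup>2) - ln (T d k \<omega>)"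
    if "d \<in> F" "(\<Sum>a<k. (t a)\<^sup>2) \<le> R" for d k \<omega> t
    using gT[OF that(1), of k, unfolded good_def, THEN conjunct2, THEN conjunct2, THEN conjunct2, rule_format, OF that(2)] .
  \<comment> \<open>Each \<open>T d k\<close> has mean at most 1, so by Markov's inequality their
    sum over \<open>F\<close> exceeds this level with probability at most
    \<open>\<epsilon>\<close>.\<close>
  define c0 where "c0 = real (card F) / \<epsilon>"
  have c0: "c0 > 0" using F \<epsilon> by (simp add: c0_def card_gt_0_iff)
  define A where "A k = {\<omega> \<in> space P. (\<Sum>d\<in>F. T d k \<omega>) \<le> c0}" for k
  have Am: "A k \<in> sets P" for k unfolding A_def using T(1) by measurable
  have Ap: "measure P (A k) \<ge> 1 - \<epsilon>" for k
  proof -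
    have int: "integrable P (T d k)" "(\<integral>\<omega>. T d k \<omega> \<partial>P) \<le> 1" if d: "d \<in> F" for d
    proof -
      show i: "integrable P (T d k)"
        using T[OF d] by (intro integrableI_nonneg) (auto simp: less_imp_le intro: le_less_trans[of _ 1])
      have "ennreal (\<integral>\<omega>. T d k \<omega> \<partial>P) = (\<integral>\<^sup>+\<omega>. ennreal (T d k \<omega>) \<partial>P)"
        using T(2)[OF d] by (intro nn_integral_eq_integral[symmetric] i) (auto simp: less_imp_le)
      also have "\<dots> \<le> 1" by (rule T(3)[OF d])
      finally show "(\<integral>\<omega>. T d k \<omega> \<partial>P) \<le> 1" by simp
    qed
    have "measure P {\<omega> \<in> space P. (\<Sum>d\<in>F. T d k \<omega>) \<ge> c0} \<le> (\<integral>\<omega>. (\<Sum>d\<in>F. T d k \<omega>) \<partial>P) / c0"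
      using int c0 T(2) by (intro integral_Markov_inequality_measure[where A = "{}"])
        (auto intro!: sum_nonneg simp: less_imp_le)
    also have "(\<integral>\<omega>. (\<Sum>d\<in>F. T d k \<omega>) \<partial>P) = (\<Sum>d\<in>F. \<integral>\<omega>. T d k \<omega> \<partial>P)" using int by simp
    also have "\<dots> / c0 \<le> (\<Sum>d\<in>F. 1) / c0" using int c0 by (intro divide_right_mono sum_mono) auto
    also have "\<dots> = \<epsilon>" using F \<epsilon> by (simp add: c0_def)
    finally have 1: "measure P {\<omega> \<in> space P. (\<Sum>d\<in>F. T d k \<omega>) \<ge> c0} \<le> \<epsilon>" .
    have "1 - measure P (A k) = measure P (space P - A k)" using P.prob_compl[OF Am] by simp
    also have "\<dots> \<le> measure P {\<omega> \<in> space P. (\<Sum>d\<in>F. T d k \<omega>) \<ge> c0}"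
      using T(1) by (intro P.finite_measure_mono) (auto simp: A_def)
    finally show ?thesis using 1 by simp
  qed
  define nice where "nice d x \<longleftrightarrow> bounded_linear (\<lambda>u. D d u x) \<and>
     (\<forall>v\<in>S. \<psi> v x - \<psi> d x \<ge> max (Y d (v - d) x) (- 2 * ln \<kappa>))" for d x
  have nice: "AE x in Q. nice d x" if "d \<in> F" for d
  proof -
    have d: "d \<in> S" using that F by auto
    show ?thesis using deriv uniform_tangent[OF d]
      by eventually_elim (use d in \<open>auto simp: nice_def intro: has_derivative_bounded_linear\<close>)
  qed
  have ae: "AE \<omega> in P. \<forall>i\<in>{..<n}. \<forall>d\<in>F. nice d (X i \<omega>)"
  proof (subst AE_ball_countable, simp, intro ballI, subst AE_ball_countable)
    show "countable F" using F by (simp add: countable_finite)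
    fix i show "\<forall>d\<in>F. AE \<omega> in P. nice d (X i \<omega>)"
      using nice AE_distrD[OF XM[of i]] X[of i] by auto
  qed
  obtain A' where A': "A' \<in> sets P" "A' \<subseteq> (\<Inter>k. \<Union>i\<in>{k..}. A i)" "measure P A' \<ge> 1 - \<epsilon>"
    and A'nice: "\<And>\<omega>. \<omega> \<in> A' \<Longrightarrow> \<forall>i\<in>{..<n}. \<forall>d\<in>F. nice d (X i \<omega>)"
    by (rule P.prob_ge_AE[OF P.frequently_prob_ge(1)[of A, OF Am Ap] P.frequently_prob_ge(2)[of A, OF Am Ap] ae])
      (rule that)
  show ?thesis
  proof (rule that[OF A'(1,3)])
    fix \<omega> d u assume \<omega>: "\<omega> \<in> A'" and d: "d \<in> F" and du: "d + u \<in> S" and r2: "q u + l * j u u \<le> r2"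
    have dS: "d \<in> S" using d F by auto
    define p where "p k = (\<Sum>a<k. c a u *\<^sub>R b a)" for k
    have p: "p \<longlonglongrightarrow> u" unfolding p_def by (rule expansion)
    define t where "t a = c a u / \<sigma> a" for a
    have t2: "(\<Sum>a<k. (t a)\<^sup>2) \<le> R" for k
    proof -
      have "(\<Sum>a<k. (t a)\<^sup>2) = (\<Sum>a<k. real n / s * ((c a u)\<^sup>2 + l * (\<rho> a * (c a u)\<^sup>2)))"
        using s n0 lp by (intro sum.cong refl) (simp add: t_def power_divide \<sigma>2 field_simps)
      also have "\<dots> = real n / s * ((\<Sum>a<k. (c a u)\<^sup>2) + l * (\<Sum>a<k. \<rho> a * (c a u)\<^sup>2))"
        by (simp only: sum_distrib_left[symmetric] sum.distrib)
      also have "\<dots> \<le> real n / s * (CL * q u + l * (CL * j u u))"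
      proof -
        have "1 * j u u \<le> CL * j u u" using CL j.pos by (intro mult_right_mono) auto
        hence "(\<Sum>a<k. \<rho> a * (c a u)\<^sup>2) \<le> CL * j u u" using bessel_j[where k = k and u = u] by linarith
        thus ?thesis using s n0 l bessel_q[where k = k and u = u] by (intro mult_left_mono add_mono) auto
      qed
      also have "\<dots> = real n / s * CL * (q u + l * j u u)" by (simp add: algebra_simps)
      also have "\<dots> \<le> R" unfolding R_def using s n0 CL r2 by (intro mult_left_mono) auto
      finally show ?thesis .
    qed
    have Ylin: "(\<Sum>a<k. t a * z d a x) = \<beta> * Y d (p k) x" if "nice d x" for x k
    proof -
      have l1: "linear (\<lambda>u. D d u x)" using that by (simp add: nice_def bounded_linear.linear)
      have "(\<Sum>a<k. t a * z d a x) = \<beta> * ((\<Sum>a<k. c a u * m d (b a)) - (\<Sum>a<k. c a u * D d (b a) x))"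
        using \<sigma> by (simp add: t_def z_def Y_def sum_distrib_left right_diff_distrib sum_subtractf less_imp_neq[THEN not_sym] mult_ac)
      thus ?thesis
        by (simp add: Y_def p_def linear_sum[OF l1] linear_cmul[OF l1] linear_sum[OF m_linear[OF dS]] linear_cmul[OF m_linear[OF dS]])
    qed
    have mlin: "(\<Sum>a<k. t a * (\<integral>x. z d a x \<partial>Q)) = \<beta> * m d (p k)" for k
    proof -
      have "(\<Sum>a<k. t a * (\<integral>x. z d a x \<partial>Q)) = \<beta> * (\<Sum>a<k. c a u * m d (b a))"
        using \<sigma> by (simp add: t_def z_def Y_mean[OF dS] sum_distrib_left less_imp_neq[THEN not_sym] mult_ac)
      thus ?thesis by (simp add: p_def linear_sum[OF m_linear[OF dS]] linear_cmul[OF m_linear[OF dS]])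
    qed
    have sq: "(\<integral>x. (\<Sum>a<k. t a * z d a x)\<^sup>2 \<partial>Q) \<le> \<beta>\<^sup>2 * (CY * q (p k))" for k
    proof -
      have "(\<integral>x. (\<Sum>a<k. t a * z d a x)\<^sup>2 \<partial>Q) = (\<integral>x. \<beta>\<^sup>2 * (Y d (p k) x)\<^sup>2 \<partial>Q)"
      proof (rule integral_cong_AE)
        have "z d a \<in> borel_measurable Q" for a using zN(1)[OF d] QN by (simp cong: measurable_cong_sets)
        thus "(\<lambda>x. (\<Sum>a<k. t a * z d a x)\<^sup>2) \<in> borel_measurable Q" by measurable
        show "(\<lambda>x. \<beta>\<^sup>2 * (Y d (p k) x)\<^sup>2) \<in> borel_measurable Q" using Y_meas[OF dS] by measurable
        show "AE x in Q. (\<Sum>a<k. t a * z d a x)\<^sup>2 = \<beta>\<^sup>2 * (Y d (p k) x)\<^sup>2"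
          using nice[OF d] by eventually_elim (simp add: Ylin power_mult_distrib)
      qed
      also have "\<dots> = \<beta>\<^sup>2 * (\<integral>x. (Y d (p k) x)\<^sup>2 \<partial>Q)" by simp
      also have "\<dots> \<le> \<beta>\<^sup>2 * (CY * q (p k))" using Y_sq(2)[OF dS] by (intro mult_left_mono) auto
      finally show ?thesis .
    qed
    have tr: "(\<Sum>a<k. \<integral>x. (z d a x)\<^sup>2 \<partial>Q) \<le> \<beta>\<^sup>2 * CY * CL * s * w / real n" for k
    proof -
      have "(\<Sum>a<k. \<integral>x. (z d a x)\<^sup>2 \<partial>Q) \<le> (\<Sum>a<k. \<beta>\<^sup>2 * CY * CL * s / real n * (1 / (1 + l * \<rho> a)))"
      proof (rule sum_mono)
        fix a
        have "(\<integral>x. (z d a x)\<^sup>2 \<partial>Q) = \<beta>\<^sup>2 * (\<sigma> a)\<^sup>2 * (\<integral>x. (Y d (b a) x)\<^sup>2 \<partial>Q)"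
          by (simp add: z_def power_mult_distrib)
        also have "\<dots> \<le> \<beta>\<^sup>2 * (\<sigma> a)\<^sup>2 * (CY * CL)"
          using Y_sq(2)[OF dS, of "b a"] q_b[of a] CY
          by (intro mult_left_mono) (auto intro: order.trans[OF _ mult_left_mono])
        finally show "(\<integral>x. (z d a x)\<^sup>2 \<partial>Q) \<le> \<beta>\<^sup>2 * CY * CL * s / real n * (1 / (1 + l * \<rho> a))"
          by (simp add: \<sigma>2 mult_ac)
      qed
      also have "\<dots> = \<beta>\<^sup>2 * CY * CL * s / real n * (\<Sum>a<k. 1 / (1 + l * \<rho> a))" by (simp add: sum_distrib_left)
      also have "\<dots> \<le> \<beta>\<^sup>2 * CY * CL * s / real n * w"
        using dim CY CL s n0 by (intro mult_left_mono) auto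
      finally show ?thesis by simp
    qed
    define Fk where "Fk k = (\<Sum>i<n. max (\<beta> * Y d (p k) (X i \<omega>)) (-1)) - real n * (\<beta> * m d (p k)) + 7 * real n * (\<beta>\<^sup>2 * (CY * q (p k)))" for k
    define Flim where "Flim = (\<Sum>i<n. max (\<beta> * Y d u (X i \<omega>)) (-1)) - real n * (\<beta> * m d u) + 7 * real n * (\<beta>\<^sup>2 * (CY * q u))"
    define E where "E = 13 * (\<beta>\<^sup>2 * CY * CL * s * w) + R"
    have nX: "nice d (X i \<omega>)" if "i < n" for i using A'nice[OF \<omega>] d that by auto
    have Fk_ge: "Fk k \<ge> - E - ln (T d k \<omega>)" for k
    proof -
      have 1: "(\<Sum>i<n. max (\<Sum>a<k. t a * z d a (X i \<omega>)) (-1)) = (\<Sum>i<n. max (\<beta> * Y d (p k) (X i \<omega>)) (-1))"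
        using Ylin nX by (intro sum.cong) auto
      have 2: "7 * real n * (\<integral>x. (\<Sum>a<k. t a * z d a x)\<^sup>2 \<partial>Q) \<le> 7 * real n * (\<beta>\<^sup>2 * (CY * q (p k)))"
        by (intro mult_left_mono sq) simp
      have 3: "13 * real n * (\<Sum>a<k. \<integral>x. (z d a x)\<^sup>2 \<partial>Q) \<le> 13 * real n * (\<beta>\<^sup>2 * CY * CL * s * w / real n)"
        by (intro mult_left_mono tr) simp
      have 4: "13 * real n * (\<beta>\<^sup>2 * CY * CL * s * w / real n) = 13 * (\<beta>\<^sup>2 * CY * CL * s * w)" using n0 by simp
      show ?thesis using pac[OF d t2[of k], of \<omega>] 2 3 t2[of k] unfolding 1 mlin 4 Fk_def E_def by linarith
    qed
    have lim: "Fk \<longlonglongrightarrow> Flim"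
    proof -
      have "(\<lambda>k. Y d (p k) (X i \<omega>)) \<longlonglongrightarrow> Y d u (X i \<omega>)" if "i < n" for i
        unfolding Y_def using p nX[OF that] m_bounded_linear[OF dS]
        by (intro tendsto_diff bounded_linear.tendsto[of "m d"] bounded_linear.tendsto[of "\<lambda>u. D d u (X i \<omega>)"])
          (auto simp: nice_def)
      moreover have "(\<lambda>k. m d (p k)) \<longlonglongrightarrow> m d u" by (rule bounded_linear.tendsto[OF m_bounded_linear[OF dS] p])
      ultimately show ?thesis unfolding Fk_def[abs_def] Flim_def
        by (intro tendsto_add tendsto_diff tendsto_sum tendsto_max tendsto_mult tendsto_const q_tendsto[OF p]) auto
    qed
    \<comment> \<open>\<open>Fk\<close> converges, and \<open>\<omega>\<close> lies in
      \<open>A k\<close> for arbitrarily large \<open>k\<close>; the bound at those \<open>k\<close>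
      suffices for the limit.\<close>
    have Flim: "Flim \<ge> - E - ln c0"
    proof (rule ccontr)
      assume "\<not> ?thesis"
      hence "eventually (\<lambda>k. Fk k < - E - ln c0) sequentially" using lim by (intro order_tendstoD(2)) auto
      then obtain k0 where k0: "\<And>k. k \<ge> k0 \<Longrightarrow> Fk k < - E - ln c0" by (auto simp: eventually_sequentially)
      have "\<omega> \<in> (\<Union>i\<in>{k0..}. A i)" using \<omega> A'(2) by blast
      then obtain k where k: "k \<ge> k0" "\<omega> \<in> A k" by auto
      have "T d k \<omega> \<le> (\<Sum>d\<in>F. T d k \<omega>)" using d F T(2) by (intro member_le_sum) (auto simp: less_imp_le)
      also have "\<dots> \<le> c0" using k by (simp add: A_def)
      finally have "ln (T d k \<omega>) \<le> ln c0" using T(2)[OF d, of k \<omega>] c0 by simp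
      thus False using Fk_ge[of k] k0[OF k(1)] by linarith
    qed
    \<comment> \<open>\<open>\<beta>\<close> is small enough that the floor
      \<open>- 2 * ln \<kappa>\<close> of the loss differences, multiplied by
      \<open>\<beta>\<close>, lies above the truncation level -1.\<close>
    have "(\<Sum>i<n. max (\<beta> * Y d u (X i \<omega>)) (-1)) \<le> (\<Sum>i<n. \<beta> * (\<psi> (d + u) (X i \<omega>) - \<psi> d (X i \<omega>)))"
    proof (rule sum_mono)
      fix i assume "i \<in> {..<n}"
      hence "nice d (X i \<omega>)" using nX by simp
      hence "max (Y d (d + u - d) (X i \<omega>)) (- 2 * ln \<kappa>) \<le> \<psi> (d + u) (X i \<omega>) - \<psi> d (X i \<omega>)"
        using du unfolding nice_def by blast
      hence 1: "Y d u (X i \<omega>) \<le> \<psi> (d + u) (X i \<omega>) - \<psi> d (X i \<omega>)" "- 2 * ln \<kappa> \<le> \<psi> (d + u) (X i \<omega>) - \<psi> d (X i \<omega>)"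
        by simp_all
      have "\<beta> * Y d u (X i \<omega>) \<le> \<beta> * (\<psi> (d + u) (X i \<omega>) - \<psi> d (X i \<omega>))"
        using 1(1) \<beta> by (intro mult_left_mono) auto
      moreover have "\<beta> * (- 2 * ln \<kappa>) \<le> \<beta> * (\<psi> (d + u) (X i \<omega>) - \<psi> d (X i \<omega>))"
        using 1(2) \<beta> by (intro mult_left_mono) auto
      ultimately show "max (\<beta> * Y d u (X i \<omega>)) (-1) \<le> \<beta> * (\<psi> (d + u) (X i \<omega>) - \<psi> d (X i \<omega>))"
        using \<beta>(2) by simp
    qed
    also have "\<dots> = \<beta> * (\<Sum>i<n. \<psi> (d + u) (X i \<omega>) - \<psi> d (X i \<omega>))" by (simp add: sum_distrib_left)
    finally have fin: "\<beta> * (\<Sum>i<n. \<psi> (d + u) (X i \<omega>) - \<psi> d (X i \<omega>))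
      \<ge> real n * (\<beta> * m d u) - 7 * real n * (\<beta>\<^sup>2 * (CY * q u)) - E - ln c0"
      using Flim unfolding Flim_def by linarith
    have "q u \<le> r2" using r2 j.pos[of u] l by (smt (verit) mult_nonneg_nonneg)
    hence "7 * real n * (\<beta>\<^sup>2 * (CY * q u)) \<le> 7 * real n * (\<beta>\<^sup>2 * (CY * r2))"
      using CY by (intro mult_left_mono) auto
    with fin have "\<beta> * (\<Sum>i<n. \<psi> (d + u) (X i \<omega>) - \<psi> d (X i \<omega>))
      \<ge> real n * (\<beta> * m d u) - 7 * real n * (\<beta>\<^sup>2 * (CY * r2)) - E - ln c0" by linarith
    also have "real n * (\<beta> * m d u) - 7 * real n * (\<beta>\<^sup>2 * (CY * r2)) - E - ln c0
      = \<beta> * (real n * m d u - (7 * real n * \<beta> * CY * r2 + 13 * \<beta> * s * CY * CL * w + real n * CL * r2 / (s * \<beta>)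
           + ln (real (card F) / \<epsilon>) / \<beta>))"
      using \<beta>(1) s unfolding E_def R_def c0_def by (simp add: power2_eq_square field_simps)
    finally show "(\<Sum>i<n. \<psi> (d + u) (X i \<omega>) - \<psi> d (X i \<omega>)) \<ge> real n * m d u
        - (7 * real n * \<beta> * CY * r2 + 13 * \<beta> * s * CY * CL * w + real n * CL * r2 / (s * \<beta>)
           + ln (real (card F) / \<epsilon>) / \<beta>)"
      using \<beta>(1) by simp
  qed
qed

text \<open>The penalised criterion as a function of the deviation \<open>d\<close>, up to an
  additive constant; \<open>e\<close> stands for the true parameter, whose own penalty stays
  inside.\<close>

definition pen :: "nat \<Rightarrow> real \<Rightarrow> 'q \<Rightarrow> (nat \<Rightarrow> 'x) \<Rightarrow> 'q \<Rightarrow> real" where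
  "pen n l e xs d = (\<Sum>i<n. \<psi> d (xs i)) / real n + l / 2 * j (e + d) (e + d)"

text \<open>If the minimiser \<open>v\<close> were far from 0, compare the criterion at a net point \<open>d\<close> close to a
  shrunken \<open>v\<close> with its value slightly further towards \<open>v\<close>: it would have to increase.\<close>

lemma deviation_contradiction:
  assumes n: "n \<ge> 1" and l: "l > 0" and r2: "r2 > 0" and \<gamma>: "\<gamma> > 0"
    and v: "v \<in> S" and decr: "\<And>d t. d \<in> S \<Longrightarrow> 0 \<le> t \<Longrightarrow> t \<le> 1 \<Longrightarrow> pen n l e xs (d + t *\<^sub>R (v - d)) \<le> pen n l e xs d"
    and lower: "\<And>d u. d \<in> insert 0 F \<Longrightarrow> d + u \<in> S \<Longrightarrow> q u + l * j u u \<le> 4 * r2 \<Longrightarrow>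
       (\<Sum>i<n. \<psi> (d + u) (xs i) - \<psi> d (xs i)) / real n \<ge> m d u - \<gamma> * r2"
    and A_def: "A = {x \<in> S. q x + l * j x x = r2 \<and> l * j x x \<le> 4 * \<gamma> * r2}"
    and F: "F \<subseteq> A" and net: "\<And>x. x \<in> A \<Longrightarrow> \<exists>d\<in>F. (\<Sum>a<k. (c a x - c a d)\<^sup>2) \<le> \<gamma> * (CL * r2)"
    and k: "\<And>a. a \<ge> k \<Longrightarrow> l * \<rho> a \<ge> 1"
    and e: "l * j e e \<le> \<gamma>\<^sup>2 * r2"
    and small: "C1 / (16 * \<kappa> ^ 4) * (1 - 4 * \<gamma>) - 2 * \<kappa> * CY * sqrt (CL * (\<gamma> * CL + 16 * \<gamma>)) - 11 * \<gamma> > 0"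
  shows "q v + l * j v v \<le> 4 * r2"
proof (rule ccontr)
  assume "\<not> ?thesis"
  hence big: "q v + l * j v v > 4 * r2" by simp
  define Nq where "Nq u = q u + l * j u u" for u
  have q_scale: "q (t *\<^sub>R u) = t\<^sup>2 * q u" and j_scale: "j (t *\<^sub>R u) (t *\<^sub>R u) = t\<^sup>2 * j u u" for t u
    by (simp_all add: q_eq B.bilinear j.bilinear power2_eq_square)
  have q_diff: "q (a - b) \<le> 2 * q a + 2 * q b" for a b using B.diff_le by (simp add: q_eq)
  \<comment> \<open>Scales \<open>v\<close> onto the shell of squared radius \<open>r2\<close>. A
    squared radius above \<open>4 * r2\<close> gives \<open>t \<le> 1 / 2\<close> and keeps
    \<open>1 - t\<close> away from 0.\<close>
  define t where "t = sqrt (r2 / Nq v)"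
  have Nv: "Nq v > 0" using big r2 by (simp add: Nq_def)
  have t2: "t\<^sup>2 = r2 / Nq v" using r2 Nv by (simp add: t_def)
  have t0: "t \<ge> 0" using r2 Nv by (simp add: t_def)
  have "r2 / Nq v \<le> 1 / 4" using big Nv by (simp add: Nq_def divide_le_eq)
  hence "t\<^sup>2 \<le> (1/2)\<^sup>2" unfolding t2 by (simp add: power2_eq_square)
  hence t1: "t \<le> 1 / 2" by (rule power2_le_imp_le) simp
  define x where "x = t *\<^sub>R v"
  have xS: "x \<in> S" using convexD[OF S(1) S(2) v, of "1 - t" t] t0 t1 by (simp add: x_def)
  have Nx: "q x + l * j x x = r2"
  proof -
    have "q x + l * j x x = t\<^sup>2 * Nq v" by (simp add: x_def q_scale j_scale Nq_def algebra_simps)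
    thus ?thesis using Nv by (simp add: t2)
  qed
  have cs: "\<bar>l * j a b\<bar> \<le> sqrt (l * j a a) * sqrt (l * j b b)" for a b
  proof -
    have "\<bar>l * j a b\<bar> = l * \<bar>j a b\<bar>" using l by (simp add: abs_mult)
    also have "\<dots> \<le> l * (sqrt (j a a) * sqrt (j b b))" using l j.cauchy_schwarz by (intro mult_left_mono) auto
    also have "\<dots> = (sqrt l * sqrt l) * (sqrt (j a a) * sqrt (j b b))" using l by simp
    also have "\<dots> = sqrt (l * j a a) * sqrt (l * j b b)" by (simp add: real_sqrt_mult)
    finally show ?thesis .
  qed
  have se: "sqrt (l * j e e) \<le> \<gamma> * sqrt r2"
  proof -
    have "sqrt (l * j e e) \<le> sqrt (\<gamma>\<^sup>2 * r2)" by (intro real_sqrt_le_mono e)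
    thus ?thesis using \<gamma> by (simp add: real_sqrt_mult)
  qed
  have e_cross: "\<bar>l * j e u\<bar> \<le> \<gamma> * y * r2" if "l * j u u \<le> y\<^sup>2 * r2" "y \<ge> 0" for u y
  proof -
    have "sqrt (l * j u u) \<le> sqrt (y\<^sup>2 * r2)" by (intro real_sqrt_le_mono that)
    hence "sqrt (l * j u u) \<le> y * sqrt r2" using that by (simp add: real_sqrt_mult)
    hence "sqrt (l * j e e) * sqrt (l * j u u) \<le> (\<gamma> * sqrt r2) * (y * sqrt r2)"
      using se \<gamma> r2 l j.pos by (intro mult_mono) auto
    also have "\<dots> = \<gamma> * y * r2" using r2 by simp
    finally show ?thesis using cs[of e u] by linarith
  qed
  have m0: "m 0 u = 0" for u unfolding m_def using D_mean[OF S(2)] by (simp add: \<psi>_zero)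
  have pen_diff: "pen n l e xs (d + u) - pen n l e xs d
    = (\<Sum>i<n. \<psi> (d + u) (xs i) - \<psi> d (xs i)) / real n + (l * j e u + l * j d u + l * j u u / 2)" for d u
  proof -
    have "j (e + (d + u)) (e + (d + u)) = j (e + d) (e + d) + 2 * j e u + 2 * j d u + j u u"
      using j.sym[of u e] j.sym[of u d] j.sym[of d e] by (simp add: j.add_left j.add_right)
    thus ?thesis unfolding pen_def by (simp add: sum_subtractf diff_divide_distrib algebra_simps)
  qed
  \<comment> \<open>Comparison with the truth, where the mean slope vanishes: the sample part falls
    by at most \<open>\<gamma> * r2\<close>, the cross term with \<open>e\<close> by at most as much
    again. Half the penalty of \<open>x\<close> cannot exceed their sum, whence the 4.\<close>
  have jx: "l * j x x \<le> 4 * \<gamma> * r2"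
  proof -
    have "pen n l e xs (0 + x) - pen n l e xs 0 \<le> 0"
      using decr[OF S(2) t0] t1 by (simp add: x_def)
    moreover have "(\<Sum>i<n. \<psi> (0 + x) (xs i) - \<psi> 0 (xs i)) / real n \<ge> m 0 x - \<gamma> * r2"
      using lower[of 0 x] xS Nx r2 by simp
    moreover have "\<bar>l * j e x\<bar> \<le> \<gamma> * 1 * r2"
      using Nx q_nonneg[of x] by (intro e_cross) auto
    moreover have "j 0 x = 0" using j.scale_left[of 0 0 x] by simp
    ultimately show ?thesis unfolding pen_diff m0 by simp
  qed
  have xA: "x \<in> A" using xS Nx jx by (simp add: A_def)
  obtain d where d: "d \<in> F" "(\<Sum>a<k. (c a x - c a d)\<^sup>2) \<le> \<gamma> * (CL * r2)" using net[OF xA] by blast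
  have dA: "d \<in> S" "q d + l * j d d = r2" "l * j d d \<le> 4 * \<gamma> * r2" using d(1) F by (auto simp: A_def)
  define r where "r = d - x"
  \<comment> \<open>The move from \<open>d\<close> towards \<open>v\<close>. Up to the net error
    \<open>r\<close> it is a move outwards by \<open>1 - t\<close> times \<open>d\<close>, as
    \<open>u_eq2\<close> shows, and in that direction the mean slope is positive.\<close>
  define u where "u = t *\<^sub>R (v - d)"
  have u_eq: "u = x - t *\<^sub>R d" by (simp add: u_def x_def scaleR_diff_right)
  have u_eq2: "u = (1 - t) *\<^sub>R d - r" by (simp add: u_eq r_def algebra_simps)
  have tt: "t\<^sup>2 \<le> 1 / 4" using t0 t1 power_mono[of t "1/2" 2] by (simp add: power2_eq_square)
  have duS: "d + u \<in> S"
  proof -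
    have "d + u = (1 - t) *\<^sub>R d + t *\<^sub>R v" by (simp add: u_def algebra_simps)
    thus ?thesis using convexD[OF S(1) dA(1) v, of "1 - t" t] t0 t1 by simp
  qed
  have qu: "q u \<le> 2 * q x + 1 / 2 * q d"
  proof -
    have "t\<^sup>2 * q d \<le> 1 / 4 * q d" using tt q_nonneg by (intro mult_right_mono) auto
    thus ?thesis using q_diff[of x "t *\<^sub>R d"] unfolding u_eq by (simp add: q_scale)
  qed
  have ju: "l * j u u \<le> 2 * (l * j x x) + 1 / 2 * (l * j d d)"
  proof -
    have "t\<^sup>2 * j d d \<le> 1 / 4 * j d d" using tt j.pos by (intro mult_right_mono) auto
    hence "j u u \<le> 2 * j x x + 1 / 2 * j d d" using j.diff_le[of x "t *\<^sub>R d"] unfolding u_eq by (simp add: j_scale)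
    hence "l * j u u \<le> l * (2 * j x x + 1 / 2 * j d d)" using l by (intro mult_left_mono) auto
    thus ?thesis by (simp add: algebra_simps)
  qed
  have Nu: "q u + l * j u u \<le> 4 * r2" using qu ju Nx dA(2) r2 by linarith
  have ju': "l * j u u \<le> 16 * \<gamma> * r2" and ju'': "l * j u u \<le> 2\<^sup>2 * r2"
    using ju jx dA Nx mult_pos_pos[OF \<gamma> r2] q_nonneg[of x] q_nonneg[of d] r2 by auto
  have pen0: "pen n l e xs (d + u) - pen n l e xs d \<le> 0"
    using decr[OF dA(1) t0] t1 by (simp add: u_def)
  have low: "(\<Sum>i<n. \<psi> (d + u) (xs i) - \<psi> d (xs i)) / real n \<ge> m d u - \<gamma> * r2"
    using lower[of d u] d(1) duS Nu by simp
  have le: "\<bar>l * j e u\<bar> \<le> \<gamma> * 2 * r2" by (rule e_cross[OF ju'']) simp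
  have ld: "\<bar>l * j d u\<bar> \<le> 8 * \<gamma> * r2"
  proof -
    have "sqrt (l * j d d) * sqrt (l * j u u) \<le> sqrt (4 * \<gamma> * r2) * sqrt (16 * \<gamma> * r2)"
    proof (rule mult_mono)
      show "sqrt (l * j d d) \<le> sqrt (4 * \<gamma> * r2)" by (rule real_sqrt_le_mono[OF dA(3)])
      show "sqrt (l * j u u) \<le> sqrt (16 * \<gamma> * r2)" by (rule real_sqrt_le_mono[OF ju'])
    qed (use \<gamma> r2 l j.pos in auto)
    also have "\<dots> = sqrt ((8 * \<gamma> * r2)\<^sup>2)" by (simp add: real_sqrt_mult[symmetric] power2_eq_square mult_ac)
    also have "\<dots> = 8 * \<gamma> * r2" using \<gamma> r2 by simp
    finally show ?thesis using cs[of d u] by linarith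
  qed
  \<comment> \<open>The net controls the first \<open>k\<close> coordinates of \<open>r\<close>;
    beyond them \<open>l * \<rho> a \<ge> 1\<close>, so the small penalties of \<open>x\<close> and
    \<open>d\<close> control the rest.\<close>
  have qr: "q r \<le> CL * (\<gamma> * CL + 16 * \<gamma>) * r2"
  proof -
    have "c a r = - (c a x - c a d)" for a using linear_diff[OF c_lin] by (simp add: r_def)
    hence 1: "(\<Sum>a<k. (c a r)\<^sup>2) \<le> \<gamma> * (CL * r2)" using d(2) by (simp only: power2_minus)
    have "j r r \<le> 2 * j d d + 2 * j x x" unfolding r_def by (rule j.diff_le)
    hence "l * j r r \<le> l * (2 * j d d + 2 * j x x)" using l by (intro mult_left_mono) auto
    hence 2: "l * j r r \<le> 16 * \<gamma> * r2" using jx dA by (simp add: algebra_simps)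
    have "q r \<le> CL * ((\<Sum>a<k. (c a r)\<^sup>2) + j r r / (1 / l))"
      by (rule q_tail) (use l k in \<open>auto simp: field_simps\<close>)
    also have "j r r / (1 / l) = l * j r r" by simp
    also have "CL * ((\<Sum>a<k. (c a r)\<^sup>2) + l * j r r) \<le> CL * (\<gamma> * (CL * r2) + 16 * \<gamma> * r2)"
      using 1 2 CL by (intro mult_left_mono add_mono) auto
    finally show ?thesis by (simp add: algebra_simps)
  qed
  have mr: "\<bar>m d r\<bar> \<le> 2 * \<kappa> * CY * sqrt (CL * (\<gamma> * CL + 16 * \<gamma>)) * r2"
  proof -
    have "\<bar>m d r\<bar> \<le> 2 * \<kappa> * CY * (sqrt (q d) * sqrt (q r))" using m_le[OF dA(1), of r] by (simp add: mult_ac)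
    also have "\<dots> \<le> 2 * \<kappa> * CY * (sqrt r2 * sqrt (CL * (\<gamma> * CL + 16 * \<gamma>) * r2))"
    proof (intro mult_left_mono mult_mono real_sqrt_le_mono qr)
      show "q d \<le> r2" using dA(2) l j.pos[of d] by (smt (verit) mult_nonneg_nonneg)
    qed (use \<kappa> CY r2 q_nonneg in auto)
    also have "sqrt r2 * sqrt (CL * (\<gamma> * CL + 16 * \<gamma>) * r2) = sqrt (CL * (\<gamma> * CL + 16 * \<gamma>)) * r2"
      using r2 by (simp add: real_sqrt_mult)
    finally show ?thesis by (simp add: mult_ac)
  qed
  have md: "m d d \<ge> C1 / (8 * \<kappa> ^ 4) * (1 - 4 * \<gamma>) * r2"
  proof -
    have "(1 - 4 * \<gamma>) * r2 \<le> q d" using dA by (simp add: algebra_simps)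
    hence "C1 / (8 * \<kappa> ^ 4) * ((1 - 4 * \<gamma>) * r2) \<le> C1 / (8 * \<kappa> ^ 4) * q d"
      using C1 \<kappa> by (intro mult_left_mono) auto
    thus ?thesis using W_ge[OF dA(1)] W_le_m[OF dA(1)] by (simp add: mult_ac)
  qed
  have "m d u = (1 - t) * m d d - m d r"
    unfolding u_eq2 by (simp add: linear_diff[OF m_linear[OF dA(1)]] linear_cmul[OF m_linear[OF dA(1)]])
  moreover have "(1 - t) * m d d \<ge> 1 / 2 * m d d"
    using t1 W_nonneg[of d] W_le_m[OF dA(1)] by (intro mult_right_mono) auto
  moreover have "1 / 2 * (C1 / (8 * \<kappa> ^ 4) * (1 - 4 * \<gamma>) * r2) = C1 / (16 * \<kappa> ^ 4) * (1 - 4 * \<gamma>) * r2" by simp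
  ultimately have mdu: "m d u \<ge> C1 / (16 * \<kappa> ^ 4) * (1 - 4 * \<gamma>) * r2 - 2 * \<kappa> * CY * sqrt (CL * (\<gamma> * CL + 16 * \<gamma>)) * r2"
    using md mr by linarith
  have "l * j u u \<ge> 0" using l j.pos by simp
  \<comment> \<open>The error budget: 1 from the sample bound, 2 from the cross term with
    \<open>e\<close>, 8 from the cross term with \<open>d\<close>; together the 11 in
    \<open>small\<close>.\<close>
  hence "m d u - \<gamma> * r2 - \<gamma> * 2 * r2 - 8 * \<gamma> * r2 \<le> 0"
    using pen0 low le ld unfolding pen_diff by linarith
  hence "(C1 / (16 * \<kappa> ^ 4) * (1 - 4 * \<gamma>) - 2 * \<kappa> * CY * sqrt (CL * (\<gamma> * CL + 16 * \<gamma>)) - 11 * \<gamma>) * r2 \<le> 0"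
    using mdu by (simp add: algebra_simps)
  thus False using small r2 by (simp add: mult_le_0_iff)
qed

text \<open>\<open>\<gamma>\<close> is fixed for the contradiction, then \<open>\<beta>\<close> for
  the second-moment term, \<open>s\<close> for the entropy term, and \<open>K2\<close> for the
  trace, the net and the penalty of the truth. Each of the four sampling errors then takes at most a
  quarter of \<open>n * \<gamma> * r2\<close>. No choice depends on \<open>n\<close> or
  \<open>l\<close>, so one \<open>K\<close> serves them all.\<close>

lemma deviation_bound:
  fixes X :: "nat \<Rightarrow> 'w \<Rightarrow> 'x" and w :: "real \<Rightarrow> real"
  assumes P: "prob_space P" and indep: "prob_space.indep_vars P (\<lambda>_. N) X UNIV"
    and X: "\<And>i. distr P N (X i) = Q" and QN: "sets Q = sets N"
    and C\<rho>: "C\<rho> > 0" and w: "\<And>l. 0 < l \<Longrightarrow> l \<le> 1 \<Longrightarrow> w l \<ge> 1"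
    and dim: "\<And>l k. 0 < l \<Longrightarrow> l \<le> 1 \<Longrightarrow> (\<Sum>a<k. 1 / (1 + l * \<rho> a)) \<le> C\<rho> * w l"
    and cut: "\<And>l. 0 < l \<Longrightarrow> l \<le> 1 \<Longrightarrow> \<exists>k. real k \<le> C\<rho> * w l \<and> (\<forall>a\<ge>k. l * \<rho> a \<ge> 1)"
    and \<epsilon>: "\<epsilon> > 0" "\<epsilon> \<le> 1"
  shows "\<exists>K. \<forall>n l. n \<ge> 1 \<longrightarrow> 0 < l \<longrightarrow> l \<le> 1 \<longrightarrow> (\<exists>A\<in>sets P. measure P A \<ge> 1 - \<epsilon> \<and>
    (\<forall>\<omega>\<in>A. \<forall>v\<in>S. (\<forall>d\<in>S. \<forall>t\<in>{0..1}. pen n l e (\<lambda>i. X i \<omega>) (d + t *\<^sub>R (v - d)) \<le> pen n l e (\<lambda>i. X i \<omega>) d) \<longrightarrow>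
       q v + l * j v v \<le> K * (w l / real n + l)))"
proof -
  let ?f = "\<lambda>\<gamma>. C1 / (16 * \<kappa> ^ 4) * (1 - 4 * \<gamma>) - 2 * \<kappa> * CY * sqrt (CL * (\<gamma> * CL + 16 * \<gamma>)) - 11 * \<gamma>"
  \<comment> \<open>At \<open>\<gamma> = 0\<close> only the positive curvature term survives, so
    continuity supplies a small positive \<open>\<gamma>\<close>.\<close>
  have "(?f \<longlongrightarrow> ?f 0) (at_right 0)" by (intro tendsto_intros)
  moreover have "?f 0 > 0" using C1 \<kappa> by simp
  ultimately have "eventually (\<lambda>\<gamma>. ?f \<gamma> > 0) (at_right 0)" by (rule order_tendstoD(1))
  from eventually_happens[OF eventually_conj[OF this eventually_at_right_less[of 0]]]
  obtain \<gamma> where \<gamma>: "\<gamma> > 0" and small: "?f \<gamma> > 0" by auto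
  define \<beta> where "\<beta> = min (\<gamma> / (112 * CY)) (1 / (2 * ln \<kappa> + 1))"
  have lk: "ln \<kappa> \<ge> 0" using \<kappa> by simp
  have \<beta>0: "\<beta> > 0" using \<gamma> CY lk by (simp add: \<beta>_def)
  have \<beta>1: "112 * \<beta> * CY \<le> \<gamma>"
  proof -
    have "\<beta> \<le> \<gamma> / (112 * CY)" by (simp add: \<beta>_def)
    thus ?thesis using CY by (simp add: field_simps)
  qed
  have \<beta>2: "\<beta> * (2 * ln \<kappa>) \<le> 1"
  proof -
    have "\<beta> * (2 * ln \<kappa>) \<le> 1 / (2 * ln \<kappa> + 1) * (2 * ln \<kappa>)" using lk by (intro mult_right_mono) (auto simp: \<beta>_def)
    also have "\<dots> \<le> 1" using lk by (simp add: divide_le_eq)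
    finally show ?thesis .
  qed
  define s where "s = 16 * CL / (\<gamma> * \<beta>)"
  have s: "s > 0" using CL \<gamma> \<beta>0 by (simp add: s_def)
  have s_eq: "CL * 4 / (s * \<beta>) = \<gamma> / 4" using CL \<gamma> \<beta>0 by (simp add: s_def)
  \<comment> \<open>The entropy of the net per coordinate; \<open>L\<close> adds the origin and the
    error probability to it.\<close>
  define a0 where "a0 = ln (3 * exp (2 / \<gamma> + 2))"
  define L where "L = 1 + a0 * (C\<rho> + 1) + \<bar>ln \<epsilon>\<bar>"
  have "1 \<le> exp (2 / \<gamma> + 2)" using \<gamma> by simp
  hence "1 < 3 * exp (2 / \<gamma> + 2)" by linarith
  hence a0: "a0 > 0" unfolding a0_def by (rule ln_gt_zero)
  have L: "L > 0" using a0 C\<rho> unfolding L_def by (smt (verit) mult_pos_pos)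
  define K2 where "K2 = 52 * \<beta> * s * CY * CL * C\<rho> / \<gamma> + 4 * L / (\<gamma> * \<beta>) + j e e / \<gamma>\<^sup>2 + 1"
  have Kparts: "52 * \<beta> * s * CY * CL * C\<rho> / \<gamma> > 0" "4 * L / (\<gamma> * \<beta>) > 0" "j e e / \<gamma>\<^sup>2 \<ge> 0"
    using \<beta>0 s CY CL C\<rho> \<gamma> L j.pos by auto
  have K2: "K2 > 0" "K2 \<ge> 52 * \<beta> * s * CY * CL * C\<rho> / \<gamma>" "K2 \<ge> 4 * L / (\<gamma> * \<beta>)" "K2 \<ge> j e e / \<gamma>\<^sup>2"
    unfolding K2_def using Kparts by linarith+
  have "\<exists>A\<in>sets P. measure P A \<ge> 1 - \<epsilon> \<and>
    (\<forall>\<omega>\<in>A. \<forall>v\<in>S. (\<forall>d\<in>S. \<forall>t\<in>{0..1}. pen n l e (\<lambda>i. X i \<omega>) (d + t *\<^sub>R (v - d)) \<le> pen n l e (\<lambda>i. X i \<omega>) d) \<longrightarrow>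
       q v + l * j v v \<le> 4 * K2 * (w l / real n + l))"
    if n: "n \<ge> 1" and l: "0 < l" "l \<le> 1" for n l
  proof -
    have n0: "real n > 0" using n by simp
    define \<delta>2 where "\<delta>2 = w l / real n + l"
    define r2 where "r2 = K2 * \<delta>2"
    have wl: "w l \<ge> 1" by (rule w[OF l])
    have \<delta>2: "\<delta>2 > 0" "w l / real n \<le> \<delta>2" "l \<le> \<delta>2" using wl n0 l by (auto simp: \<delta>2_def add_nonneg_pos)
    have r2: "r2 > 0" using K2 \<delta>2 by (simp add: r2_def)
    obtain k0 where k0: "real k0 \<le> C\<rho> * w l" "\<And>a. a \<ge> k0 \<Longrightarrow> l * \<rho> a \<ge> 1" using cut[OF l] by blast
    \<comment> \<open>The mesh of the net divides by \<open>k\<close>, so a zero cut-off is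
      avoided.\<close>
    define k where "k = k0 + 1"
    have k: "k > 0" "real k \<le> (C\<rho> + 1) * w l" "\<And>a. a \<ge> k \<Longrightarrow> l * \<rho> a \<ge> 1"
      using k0 wl by (auto simp: k_def algebra_simps)
    define A0 where "A0 = {x \<in> S. q x + l * j x x = r2 \<and> l * j x x \<le> 4 * \<gamma> * r2}"
    have bound: "(\<Sum>a<k. (c a x)\<^sup>2) \<le> CL * r2" if "x \<in> A0" for x
    proof -
      have "q x \<le> r2" using that l j.pos[of x] by (smt (verit) A0_def mem_Collect_eq mult_nonneg_nonneg)
      hence "CL * q x \<le> CL * r2" using CL by (intro mult_left_mono) auto
      thus ?thesis using bessel_q[where k = k and u = x] by linarith
    qed
    have "\<exists>F\<subseteq>A0. finite F \<and> real (card F) \<le> (3 * exp (2 / \<gamma> + 2)) ^ k \<and>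
       (\<forall>x\<in>A0. \<exists>d\<in>F. (\<Sum>a<k. (c a x - c a d)\<^sup>2) \<le> \<gamma> * (CL * r2))"
    proof (rule coordinate_net)
      show "(\<Sum>a<k. (c a x)\<^sup>2) \<le> CL * r2" if "x \<in> A0" for x by (rule bound[OF that])
    qed (use CL r2 \<gamma> k in auto)
    then obtain F where F: "F \<subseteq> A0" "finite F" "real (card F) \<le> (3 * exp (2 / \<gamma> + 2)) ^ k"
      and net: "\<And>x. x \<in> A0 \<Longrightarrow> \<exists>d\<in>F. (\<Sum>a<k. (c a x - c a d)\<^sup>2) \<le> \<gamma> * (CL * r2)" by blast
    \<comment> \<open>The truth joins the net because the bound on the penalty of the shrunken
      minimiser compares with it.\<close>
    let ?F = "insert 0 F"
    have FS: "finite ?F" "?F \<noteq> {}" "?F \<subseteq> S" using F S(2) by (auto simp: A0_def)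
    have card: "ln (real (card ?F) / \<epsilon>) \<le> L * w l"
    proof -
      have b: "3 * exp (2 / \<gamma> + 2) = exp a0" by (simp add: a0_def)
      have "real (card ?F) \<le> exp (a0 * real k) + 1"
        using F(2,3) card_insert_le_m1 unfolding b
        by (simp add: card_insert_if exp_of_nat_mult[symmetric] mult.commute)
      also have "\<dots> \<le> exp (a0 * real k) * 2" using a0 by simp
      also have "\<dots> \<le> exp (a0 * real k) * exp 1"
        using exp_ge_add_one_self[of 1] by (intro mult_left_mono) auto
      finally have "real (card ?F) \<le> exp (a0 * real k + 1)" by (simp add: exp_add)
      moreover have "real (card ?F) > 0" using FS by (simp add: card_gt_0_iff)
      ultimately have "ln (real (card ?F)) \<le> a0 * real k + 1" by (metis ln_exp ln_le_cancel_iff exp_gt_zero)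
      also have "a0 * real k \<le> a0 * ((C\<rho> + 1) * w l)" using a0 k by (intro mult_left_mono) auto
      finally have "ln (real (card ?F)) \<le> a0 * ((C\<rho> + 1) * w l) + 1" by simp
      moreover have "ln (real (card ?F) / \<epsilon>) = ln (real (card ?F)) - ln \<epsilon>"
        using \<epsilon> \<open>real (card ?F) > 0\<close> by (simp add: ln_div)
      moreover have "1 * \<bar>ln \<epsilon>\<bar> \<le> w l * \<bar>ln \<epsilon>\<bar>" using wl by (intro mult_right_mono) auto
      ultimately show ?thesis using wl unfolding L_def by (simp add: algebra_simps)
    qed
    obtain A where A: "A \<in> sets P" "measure P A \<ge> 1 - \<epsilon>"
      and low: "\<And>\<omega> d u. \<omega> \<in> A \<Longrightarrow> d \<in> ?F \<Longrightarrow> d + u \<in> S \<Longrightarrow> q u + l * j u u \<le> 4 * r2 \<Longrightarrow>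
        (\<Sum>i<n. \<psi> (d + u) (X i \<omega>) - \<psi> d (X i \<omega>)) \<ge> real n * m d u
        - (7 * real n * \<beta> * CY * (4 * r2) + 13 * \<beta> * s * CY * CL * (C\<rho> * w l) + real n * CL * (4 * r2) / (s * \<beta>)
           + ln (real (card ?F) / \<epsilon>) / \<beta>)"
      by (rule sample_lower_bound[where ?r2.0 = "4 * r2", OF P indep X QN n l(1) FS dim[OF l] \<beta>0 \<beta>2 s \<epsilon>]) (rule that)
    have err: "7 * real n * \<beta> * CY * (4 * r2) + 13 * \<beta> * s * CY * CL * (C\<rho> * w l) + real n * CL * (4 * r2) / (s * \<beta>)
           + ln (real (card ?F) / \<epsilon>) / \<beta> \<le> real n * (\<gamma> * r2)"
    proof -
      have wn: "w l \<le> real n * \<delta>2" using \<delta>2(2) n0 by (simp add: field_simps)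
      have 1: "7 * real n * \<beta> * CY * (4 * r2) \<le> real n * (\<gamma> * r2) / 4"
      proof -
        have "28 * \<beta> * CY * (real n * r2) \<le> \<gamma> / 4 * (real n * r2)" using \<beta>1 n0 r2 by (intro mult_right_mono) auto
        thus ?thesis by (simp add: mult_ac)
      qed
      have 2: "13 * \<beta> * s * CY * CL * (C\<rho> * w l) \<le> real n * (\<gamma> * r2) / 4"
      proof -
        have "13 * \<beta> * s * CY * CL * (C\<rho> * w l) \<le> 13 * \<beta> * s * CY * CL * (C\<rho> * (real n * \<delta>2))"
          using wn \<beta>0 s CY CL C\<rho> by (intro mult_left_mono) auto
        also have "\<dots> = (\<gamma> / 4 * (52 * \<beta> * s * CY * CL * C\<rho> / \<gamma>)) * (real n * \<delta>2)" using \<gamma> by simp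
        also have "\<dots> \<le> (\<gamma> / 4 * K2) * (real n * \<delta>2)"
          using K2(2) \<gamma> n0 \<delta>2 by (intro mult_right_mono mult_left_mono) auto
        finally show ?thesis by (simp add: r2_def mult_ac)
      qed
      have 3: "real n * CL * (4 * r2) / (s * \<beta>) = real n * (\<gamma> * r2) / 4"
      proof -
        have "real n * CL * (4 * r2) / (s * \<beta>) = real n * r2 * (CL * 4 / (s * \<beta>))" by simp
        thus ?thesis unfolding s_eq by simp
      qed
      have 4: "ln (real (card ?F) / \<epsilon>) / \<beta> \<le> real n * (\<gamma> * r2) / 4"
      proof -
        have "ln (real (card ?F) / \<epsilon>) \<le> L * (real n * \<delta>2)" using card mult_left_mono[OF wn, of L] L by linarith
        hence "ln (real (card ?F) / \<epsilon>) / \<beta> \<le> L * (real n * \<delta>2) / \<beta>" using \<beta>0 by (intro divide_right_mono) auto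
        also have "\<dots> = (\<gamma> / 4 * (4 * L / (\<gamma> * \<beta>))) * (real n * \<delta>2)" using \<gamma> by simp
        also have "\<dots> \<le> (\<gamma> / 4 * K2) * (real n * \<delta>2)"
          using K2(3) \<gamma> n0 \<delta>2 by (intro mult_right_mono mult_left_mono) auto
        finally show ?thesis by (simp add: r2_def mult_ac)
      qed
      have "a + b + c + d \<le> x" if "a \<le> x / 4" "b \<le> x / 4" "c = x / 4" "d \<le> x / 4" for a b c d x :: real
        using that by linarith
      from this[OF 1 2 3 4] show ?thesis .
    qed
    have e: "l * j e e \<le> \<gamma>\<^sup>2 * r2"
    proof -
      have "j e e \<le> \<gamma>\<^sup>2 * K2" using K2(4) \<gamma> by (simp add: field_simps)
      hence "l * j e e \<le> \<delta>2 * (\<gamma>\<^sup>2 * K2)" using \<delta>2 l j.pos by (intro mult_mono) auto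
      thus ?thesis by (simp add: r2_def mult_ac)
    qed
    show ?thesis
    proof (rule bexI[OF _ A(1)], intro conjI A(2) ballI impI)
      fix \<omega> v assume \<omega>: "\<omega> \<in> A" and v: "v \<in> S"
        and decr: "\<forall>d\<in>S. \<forall>t\<in>{0..1}. pen n l e (\<lambda>i. X i \<omega>) (d + t *\<^sub>R (v - d)) \<le> pen n l e (\<lambda>i. X i \<omega>) d"
      have "q v + l * j v v \<le> 4 * r2"
      proof (rule deviation_contradiction[OF n l(1) r2 \<gamma> v _ _ A0_def F(1) net k(3) e small])
        show "pen n l e (\<lambda>i. X i \<omega>) (d + t *\<^sub>R (v - d)) \<le> pen n l e (\<lambda>i. X i \<omega>) d"
          if "d \<in> S" "0 \<le> t" "t \<le> 1" for d t using decr that by simp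
        show "(\<Sum>i<n. \<psi> (d + u) (X i \<omega>) - \<psi> d (X i \<omega>)) / real n \<ge> m d u - \<gamma> * r2"
          if "d \<in> insert 0 F" "d + u \<in> S" "q u + l * j u u \<le> 4 * r2" for d u
        proof -
          have "real n * (m d u - \<gamma> * r2) \<le> (\<Sum>i<n. \<psi> (d + u) (X i \<omega>) - \<psi> d (X i \<omega>))"
            using low[OF \<omega> that] err by (simp add: right_diff_distrib)
          thus ?thesis using n0 by (simp add: pos_le_divide_eq mult.commute)
        qed
      qed
      thus "q v + l * j v v \<le> 4 * K2 * (w l / real n + l)" by (simp add: r2_def \<delta>2_def)
    qed
  qed
  thus ?thesis by blast
qed

end

section \<open>Coordinates on the product space and the base measure\<close>

text \<open>Finite combinations of \<open>b\<close> with rational coefficients are countable and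
  dense, but may lie outside \<open>S\<close>. For each of them and each radius
  \<open>1 / (n + 1)\<close>, one nearby point of \<open>S\<close> is picked whenever there is
  one.\<close>

lemma countable_dense_subset:
  fixes S :: "'q::real_normed_vector set" and c :: "nat \<Rightarrow> 'q \<Rightarrow> real" and b :: "nat \<Rightarrow> 'q"
  assumes expansion: "\<And>u. (\<lambda>k. \<Sum>a<k. c a u *\<^sub>R b a) \<longlonglongrightarrow> u"
  shows "\<exists>T. countable T \<and> T \<subseteq> S \<and> S \<subseteq> closure T"
proof -
  define f where "f rs = (\<Sum>a<length rs. real_of_rat (rs ! a) *\<^sub>R b a)" for rs
  define E where "E = range f"
  have E: "countable E" unfolding E_def by simp
  have dense: "\<exists>y\<in>E. dist y u < e" if e: "e > 0" for u and e :: real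
  proof -
    have "eventually (\<lambda>k. dist (\<Sum>a<k. c a u *\<^sub>R b a) u < e / 2) sequentially"
      using expansion[of u] e by (intro tendstoD) auto
    then obtain k where k: "dist (\<Sum>a<k. c a u *\<^sub>R b a) u < e / 2"
      by (auto simp: eventually_sequentially)
    define s where "s a = e / (2 * (real k + 1)) / (norm (b a) + 1)" for a
    have s: "s a > 0" for a using e unfolding s_def by (intro divide_pos_pos mult_pos_pos add_nonneg_pos) auto
    have "\<exists>r. \<bar>real_of_rat r - c a u\<bar> < s a" for a
    proof -
      obtain r where "c a u - s a < real_of_rat r" "real_of_rat r < c a u + s a"
        using of_rat_dense[of "c a u - s a" "c a u + s a"] s[of a] by auto
      thus ?thesis by (intro exI[of _ r]) linarith
    qed
    then obtain r where r: "\<And>a. \<bar>real_of_rat (r a) - c a u\<bar> < s a" by metis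
    define rs where "rs = map r [0..<k]"
    have "f rs = (\<Sum>a<k. real_of_rat (r a) *\<^sub>R b a)" by (simp add: f_def rs_def)
    hence "f rs - (\<Sum>a<k. c a u *\<^sub>R b a) = (\<Sum>a<k. (real_of_rat (r a) - c a u) *\<^sub>R b a)"
      by (simp add: sum_subtractf scaleR_diff_left)
    hence "dist (f rs) (\<Sum>a<k. c a u *\<^sub>R b a) \<le> (\<Sum>a<k. \<bar>real_of_rat (r a) - c a u\<bar> * norm (b a))"
      unfolding dist_norm by (auto intro!: order.trans[OF norm_sum])
    also have "\<dots> \<le> (\<Sum>a<k. e / (2 * (real k + 1)))"
    proof (rule sum_mono)
      fix a
      have "\<bar>real_of_rat (r a) - c a u\<bar> * norm (b a) \<le> s a * (norm (b a) + 1)"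
        using r[of a] s[of a] by (intro mult_mono) auto
      also have "norm (b a) + 1 \<noteq> 0" by (metis add_nonneg_pos norm_ge_zero zero_less_one less_irrefl)
      hence "s a * (norm (b a) + 1) = e / (2 * (real k + 1))" unfolding s_def by simp
      finally show "\<bar>real_of_rat (r a) - c a u\<bar> * norm (b a) \<le> e / (2 * (real k + 1))" .
    qed
    also have "\<dots> = e / 2 * (real k / (real k + 1))" by simp
    also have "\<dots> \<le> e / 2 * 1" using e by (intro mult_left_mono) auto
    finally have "dist (f rs) (\<Sum>a<k. c a u *\<^sub>R b a) \<le> e / 2" by simp
    hence "dist (f rs) u < e" using k dist_triangle[of "f rs" u "\<Sum>a<k. c a u *\<^sub>R b a"] by linarith
    thus ?thesis by (auto simp: E_def)
  qed
  define I where "I = {(y, n). y \<in> E \<and> (\<exists>x\<in>S. dist y x < inverse (real (Suc n)))}"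
  define pick where "pick = (\<lambda>(y, n). SOME x. x \<in> S \<and> dist y x < inverse (real (Suc n)))"
  have pick: "pick (y, n) \<in> S \<and> dist y (pick (y, n)) < inverse (real (Suc n))" if "(y, n) \<in> I" for y n
    using that unfolding I_def pick_def by (auto intro: someI2)
  have "I \<subseteq> E \<times> UNIV" by (auto simp: I_def)
  hence "countable I" by (rule countable_subset) (use E in simp)
  moreover have "pick ` I \<subseteq> S" using pick by auto
  moreover have "S \<subseteq> closure (pick ` I)"
  proof
    fix x assume x: "x \<in> S"
    show "x \<in> closure (pick ` I)"
      unfolding closure_approachable
    proof (intro allI impI)
      fix e :: real assume e: "e > 0"
      obtain n where n: "inverse (real (Suc n)) < e / 2" using reals_Archimedean[of "e / 2"] e by auto
      obtain y where y: "y \<in> E" "dist y x < inverse (real (Suc n))" using dense[of "inverse (real (Suc n))" x] by auto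
      have yn: "(y, n) \<in> I" using x y by (auto simp: I_def)
      have "dist (pick (y, n)) x < e"
        using pick[OF yn] y(2) n dist_triangle[of "pick (y, n)" x y] by (simp add: dist_commute)
      thus "\<exists>z\<in>pick ` I. dist z x < e" using yn by blast
    qed
  qed
  ultimately show ?thesis by (intro exI[of _ "pick ` I"]) auto
qed

section \<open>Joint coordinates for the Euclidean and the functional parameter\<close>

definition index_of :: "nat \<Rightarrow> 'p::finite" where
  "index_of = (SOME s. bij_betw s {..<CARD('p)} UNIV)"

lemma index_of: "bij_betw (index_of :: nat \<Rightarrow> 'p::finite) {..<CARD('p)} UNIV"
proof -
  have "\<exists>s. bij_betw s {..<CARD('p)} (UNIV :: 'p set)"
    using ex_bij_betw_nat_finite[of "UNIV :: 'p set"] by (simp add: atLeast0LessThan)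
  thus ?thesis unfolding index_of_def by (rule someI_ex)
qed

lemma sum_index_of: "(\<Sum>a<CARD('p). f (index_of a :: 'p::finite)) = (\<Sum>i\<in>UNIV. f i)"
  by (rule sum.reindex_bij_betw[OF index_of])

lemma vec_norm_sq: "(norm (x :: real ^ 'p))\<^sup>2 = (\<Sum>i\<in>UNIV. (x $ i)\<^sup>2)"
  by (simp add: norm_vec_def L2_set_def sum_nonneg)

lemma sum_lessThan_split: "(\<Sum>a<p + k. f a) = (\<Sum>a<p. f a) + (\<Sum>a<k. f (p + a))"
  for f :: "nat \<Rightarrow> 'a::comm_monoid_add"
  by (induction k) (simp_all add: add.assoc)

context eigenbasis
begin

definition coord :: "nat \<Rightarrow> (real ^ 'p::finite) \<times> 'h \<Rightarrow> real" where
  "coord a u = (if a < CARD('p) then fst u $ index_of a else v (\<phi> (a - CARD('p))) (snd u))"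

definition bvec :: "nat \<Rightarrow> (real ^ 'p::finite) \<times> 'h" where
  "bvec a = (if a < CARD('p) then (axis (index_of a) 1, 0) else (0, \<phi> (a - CARD('p))))"

text \<open>Penalty weights in joint coordinates: the first \<open>p\<close> are the Euclidean ones,
  which are not penalised and get weight 0.\<close>

definition weight :: "nat \<Rightarrow> nat \<Rightarrow> real" where
  "weight p a = (if a < p then 0 else \<rho> (a - p))"

lemma coord_linear: "linear (coord a :: (real ^ 'p::finite) \<times> 'h \<Rightarrow> real)"
  by (rule linearI) (auto simp: coord_def v.add_right v.scale_right)

lemma coord_sum:
  "(\<Sum>a<CARD('p) + k. f a (coord a (u :: (real ^ 'p::finite) \<times> 'h)))
   = (\<Sum>a<CARD('p). f a (fst u $ index_of a)) + (\<Sum>a<k. f (CARD('p) + a) (v (\<phi> a) (snd u)))"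
  for f :: "nat \<Rightarrow> real \<Rightarrow> real"
  unfolding sum_lessThan_split by (simp add: coord_def)

lemma coord_sq_sum:
  "(\<Sum>a<CARD('p) + k. (coord a (u :: (real ^ 'p::finite) \<times> 'h))\<^sup>2)
   = (norm (fst u))\<^sup>2 + (\<Sum>a<k. (v (\<phi> a) (snd u))\<^sup>2)"
  using coord_sum[where f = "\<lambda>_ y. y\<^sup>2" and k = k and u = u] sum_index_of[of "\<lambda>i. (fst u $ i)\<^sup>2"] by (simp add: vec_norm_sq)

lemma coord_expansion:
  "(\<lambda>k. \<Sum>a<k. coord a u *\<^sub>R bvec a) \<longlonglongrightarrow> (u :: (real ^ 'p::finite) \<times> 'h)"
proof (rule LIMSEQ_offset[where k = "CARD('p)"])
  have eq: "(\<Sum>a<k + CARD('p). coord a u *\<^sub>R bvec a) = (fst u, P k (snd u))" for k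
  proof -
    have "(\<Sum>a<CARD('p). coord a u *\<^sub>R (bvec a :: (real ^ 'p) \<times> 'h))
      = (\<Sum>a<CARD('p). (\<lambda>i. (fst u $ i *\<^sub>R axis i 1, 0)) (index_of a))"
      by (intro sum.cong) (auto simp: coord_def bvec_def)
    also have "\<dots> = (\<Sum>i\<in>UNIV. (fst u $ i *\<^sub>R axis i 1, 0))" by (rule sum_index_of)
    also have "\<dots> = (fst u, 0)"
    proof (rule prod_eqI)
      show "fst (\<Sum>i\<in>UNIV. (fst u $ i *\<^sub>R axis i 1, 0 :: 'h)) = fst (fst u, 0 :: 'h)"
        by (simp add: fst_sum basis_expansion scalar_mult_eq_scaleR[symmetric])
    qed (simp add: snd_sum)
    finally have 1: "(\<Sum>a<CARD('p). coord a u *\<^sub>R (bvec a :: (real ^ 'p) \<times> 'h)) = (fst u, 0)" .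
    have 2: "(\<Sum>a<k. coord (CARD('p) + a) u *\<^sub>R (bvec (CARD('p) + a) :: (real ^ 'p) \<times> 'h)) = (0, P k (snd u))"
      by (rule prod_eqI) (simp_all add: coord_def bvec_def P_def fst_sum snd_sum)
    show ?thesis unfolding add.commute[of k] sum_lessThan_split 1 2 by simp
  qed
  have "(\<lambda>k. (fst u, P k (snd u))) \<longlonglongrightarrow> (fst u, snd u)"
    by (intro tendsto_Pair tendsto_const P_tendsto)
  thus "(\<lambda>k. \<Sum>a<k + CARD('p). coord a u *\<^sub>R bvec a) \<longlonglongrightarrow> u" unfolding eq by simp
qed

lemma coord_bessel: "(\<Sum>a<k. (coord a (u :: (real ^ 'p::finite) \<times> 'h))\<^sup>2) \<le> (norm (fst u))\<^sup>2 + v (snd u) (snd u)"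
proof -
  have "(\<Sum>a<k. (coord a u)\<^sup>2) \<le> (\<Sum>a<CARD('p) + k. (coord a u)\<^sup>2)" by (intro sum_mono2) auto
  also have "\<dots> \<le> (norm (fst u))\<^sup>2 + v (snd u) (snd u)"
    unfolding coord_sq_sum using v_parseval[of "snd u" k] v.pos[of "snd u - P k (snd u)"] by simp
  finally show ?thesis .
qed

lemma coord_bessel_weighted:
  "(\<Sum>a<k. weight CARD('p) a * (coord a (u :: (real ^ 'p::finite) \<times> 'h))\<^sup>2) \<le> J (snd u) (snd u)"
proof -
  have "(\<Sum>a<k. weight CARD('p) a * (coord a u)\<^sup>2) \<le> (\<Sum>a<CARD('p) + k. weight CARD('p) a * (coord a u)\<^sup>2)"
    using \<rho> by (intro sum_mono2) (auto simp: weight_def)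
  also have "\<dots> = (\<Sum>a<k. \<rho> a * (v (\<phi> a) (snd u))\<^sup>2)"
    using coord_sum[where f = "\<lambda>a y. weight CARD('p) a * y\<^sup>2" and k = k and u = u] by (simp add: weight_def)
  also have "\<dots> \<le> J (snd u) (snd u)"
    using J_parseval[of "snd u" k] J.pos[of "snd u - P k (snd u)"] by simp
  finally show ?thesis .
qed

lemma coord_tail:
  assumes R: "R > 0" "\<And>a. a \<ge> k \<Longrightarrow> weight CARD('p) a \<ge> R"
  shows "(norm (fst u))\<^sup>2 + v (snd u) (snd u) \<le> (\<Sum>a<k. (coord a (u :: (real ^ 'p::finite) \<times> 'h))\<^sup>2) + J (snd u) (snd u) / R"
proof -
  \<comment> \<open>The Euclidean coordinates have weight 0, below the positive \<open>R\<close>, so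
    all of them precede the cut-off.\<close>
  have kp: "k \<ge> CARD('p)"
  proof (rule ccontr)
    assume "\<not> ?thesis"
    thus False using R(2)[of k] R(1) by (simp add: weight_def)
  qed
  have "\<rho> a \<ge> R" if "a \<ge> k - CARD('p)" for a using R(2)[of "a + CARD('p)"] that by (simp add: weight_def)
  from v_tail[where g = "snd u", OF R(1) this]
  show ?thesis using coord_sq_sum[of u "k - CARD('p)"] kp by simp
qed

end

section \<open>The true law as base measure\<close>

locale base_model =
  fixes M :: "'x measure" and \<eta> :: "('p::finite, 'h::real_inner, 'x) model" and \<tau>0 :: "('p, 'h) param"
  assumes \<eta>_L20: "\<And>\<tau>. \<eta> \<tau> \<in> L20_of M \<eta> \<tau>0"
    and \<eta>_exp: "\<And>\<tau>. integrable M (\<lambda>x. exp (\<eta> \<tau> x))"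
    and Z0: "(\<integral>x. exp (\<eta> \<tau>0 x) \<partial>M) > 0"
begin

definition "f0 = pdf_of M \<eta> \<tau>0"
definition "Q = density M (\<lambda>x. ennreal (f0 x))"
definition "Z \<tau> = (\<integral>x. exp (\<eta> \<tau> x) \<partial>M)"
definition h :: "('p, 'h) param \<Rightarrow> 'x \<Rightarrow> real" where "h d x = \<eta> (\<tau>0 + d) x - \<eta> \<tau>0 x"

lemma \<eta>_meas [measurable]: "\<eta> \<tau> \<in> borel_measurable M"
  using \<eta>_L20[of \<tau>] by (simp add: L20_of_def L2_of_def)

lemma f0_pos: "f0 x > 0" using Z0 by (simp add: f0_def pdf_of_def)

lemma f0_meas [measurable]: "f0 \<in> borel_measurable M"
  unfolding f0_def pdf_of_def[abs_def] by measurable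

lemma sets_Q [measurable_cong]: "sets Q = sets M" by (simp add: Q_def)

lemma meas_Q: "borel_measurable Q = borel_measurable M" by (rule measurable_cong_sets) (simp_all add: sets_Q)

lemma AE_Q: "(AE x in Q. R x) \<longleftrightarrow> (AE x in M. R x)"
  unfolding Q_def by (subst AE_density) (auto simp: f0_pos)

lemma integrable_Q: "f \<in> borel_measurable M \<Longrightarrow> integrable Q f \<longleftrightarrow> integrable M (\<lambda>x. f x * f0 x)"
  for f :: "'x \<Rightarrow> real"
  unfolding Q_def by (subst integrable_density) (auto simp: f0_pos less_imp_le mult.commute)

lemma integral_Q: "f \<in> borel_measurable M \<Longrightarrow> (\<integral>x. f x \<partial>Q) = (\<integral>x. f x * f0 x \<partial>M)"
  for f :: "'x \<Rightarrow> real"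
  unfolding Q_def by (subst integral_density) (auto simp: f0_pos less_imp_le mult.commute)

lemma mean_Q: "f \<in> borel_measurable M \<Longrightarrow> mean_of M \<eta> \<tau>0 f = (\<integral>x. f x \<partial>Q)"
  by (simp add: mean_of_def integral_Q f0_def)

lemma prob_Q: "prob_space Q"
proof
  have f0i: "integrable M f0" "(\<integral>x. f0 x \<partial>M) = 1"
    unfolding f0_def pdf_of_def[abs_def] using \<eta>_exp[of \<tau>0] Z0 by auto
  have "emeasure Q (space Q) = (\<integral>\<^sup>+x. ennreal (f0 x) \<partial>M)"
    unfolding Q_def by (simp add: emeasure_density)
  also have "\<dots> = ennreal (\<integral>x. f0 x \<partial>M)"
    using f0i f0_pos by (intro nn_integral_eq_integral) (auto simp: less_imp_le)
  finally show "emeasure Q (space Q) = 1" using f0i by simp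
qed

sublocale Q: prob_space Q by (rule prob_Q)

lemma L20_iff: "f \<in> L20_of M \<eta> \<tau>0 \<longleftrightarrow> f \<in> borel_measurable M \<and> integrable Q (\<lambda>x. (f x)\<^sup>2) \<and> (\<integral>x. f x \<partial>Q) = 0"
  by (auto simp: L20_of_def L2_of_def integrable_Q mean_Q f0_def)

lemma L20D:
  assumes "f \<in> L20_of M \<eta> \<tau>0"
  shows "f \<in> borel_measurable M" "f \<in> borel_measurable Q" "integrable Q (\<lambda>x. (f x)\<^sup>2)" "(\<integral>x. f x \<partial>Q) = 0" "integrable Q f"
  using assms by (auto simp: L20_iff meas_Q intro: Q.square_integrable_imp_integrable)

lemma cov_L20:
  assumes "f \<in> L20_of M \<eta> \<tau>0" "g \<in> L20_of M \<eta> \<tau>0"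
  shows "cov_of M \<eta> \<tau>0 f g = (\<integral>x. f x * g x \<partial>Q)"
  using L20D[OF assms(1)] L20D[OF assms(2)] by (simp add: cov_of_def mean_Q)

lemma var_L20: "f \<in> L20_of M \<eta> \<tau>0 \<Longrightarrow> var_of M \<eta> \<tau>0 f = (\<integral>x. (f x)\<^sup>2 \<partial>Q)"
  by (simp add: var_of_def cov_L20 power2_eq_square)

lemma L20_add:
  assumes "f \<in> L20_of M \<eta> \<tau>0" "g \<in> L20_of M \<eta> \<tau>0" shows "(\<lambda>x. f x + g x) \<in> L20_of M \<eta> \<tau>0"
  using L20D[OF assms(1)] L20D[OF assms(2)] Q.square_integrable_mult(2)[of f g] by (simp add: L20_iff)

lemma L20_cmult: "f \<in> L20_of M \<eta> \<tau>0 \<Longrightarrow> (\<lambda>x. a * f x) \<in> L20_of M \<eta> \<tau>0"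
  by (auto simp: L20_iff power_mult_distrib)

lemma Z_exp: "(\<integral>x. exp (h d x) \<partial>Q) = Z (\<tau>0 + d) / Z \<tau>0" "integrable Q (\<lambda>x. exp (h d x))"
proof -
  have eq: "exp (h d x) * f0 x = exp (\<eta> (\<tau>0 + d) x) / Z \<tau>0" for x
    by (simp add: h_def f0_def pdf_of_def Z_def exp_diff)
  have hm: "(\<lambda>x. exp (h d x)) \<in> borel_measurable M" unfolding h_def by measurable
  show "(\<integral>x. exp (h d x) \<partial>Q) = Z (\<tau>0 + d) / Z \<tau>0" unfolding integral_Q[OF hm] eq by (simp add: Z_def)
  show "integrable Q (\<lambda>x. exp (h d x))" unfolding integrable_Q[OF hm] eq using \<eta>_exp by simp
qed

lemma h_L20: "h d \<in> L20_of M \<eta> \<tau>0"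
  unfolding h_def[abs_def] using L20_add[OF \<eta>_L20 L20_cmult[OF \<eta>_L20, of "-1" \<tau>0], of "\<tau>0 + d"] by simp

text \<open>\<open>h\<close> is centred under the true law, so its exponential has mean at least 1:
  the normalising integral is smallest at the truth.\<close>

lemma Z_pos: "Z \<tau> > 0"
proof -
  have "1 = (\<integral>x. 1 + h (\<tau> - \<tau>0) x \<partial>Q)" using L20D(4,5)[OF h_L20[of "\<tau> - \<tau>0"]] by (simp add: Q.prob_space)
  also have "\<dots> \<le> (\<integral>x. exp (h (\<tau> - \<tau>0) x) \<partial>Q)"
    using L20D(5)[OF h_L20[of "\<tau> - \<tau>0"]] Z_exp(2) by (intro integral_mono) auto
  finally have "Z \<tau> / Z \<tau>0 \<ge> 1" unfolding Z_exp by simp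
  thus ?thesis using Z0 by (simp add: Z_def[of \<tau>0] field_simps)
qed

lemma loss_eq: "loss Q h d x = (ln (Z (\<tau>0 + d)) - \<eta> (\<tau>0 + d) x) - (ln (Z \<tau>0) - \<eta> \<tau>0 x)"
  unfolding loss_def cgf_def Z_exp(1) using Z_pos[of "\<tau>0 + d"] Z_pos[of \<tau>0] by (simp add: ln_div h_def)

lemma pdf_eq: "pdf_of M \<eta> (\<tau>0 + d) x = f0 x * exp (- loss Q h d x)"
  unfolding loss_eq using Z_pos[of "\<tau>0 + d"] Z_pos[of \<tau>0]
  by (simp add: f0_def pdf_of_def Z_def[symmetric] exp_diff exp_minus exp_add field_simps)

lemma loss_meas [measurable]: "loss Q h d \<in> borel_measurable M"
  unfolding loss_def[abs_def] h_def by measurable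

lemma mean_tilted: "f \<in> borel_measurable M \<Longrightarrow> mean_of M \<eta> (\<tau>0 + d) f = (\<integral>x. f x * exp (- loss Q h d x) \<partial>Q)"
  by (subst integral_Q) (auto simp: mean_of_def pdf_eq mult_ac)

lemma crit_eq: "n \<ge> 1 \<Longrightarrow> crit M \<eta> n xs (\<tau>0 + d) - crit M \<eta> n xs \<tau>0 = (\<Sum>i<n. loss Q h d (xs i)) / real n"
  unfolding loss_eq crit_def Z_def by (simp add: sum_subtractf sum.distrib field_simps)

text \<open>Every \<open>\<eta> \<tau>\<close> is centred under the true law, so the first of the
  two means vanishes and only the tilted mean of \<open>h d\<close> remains.\<close>

lemma skl_eq: "SKL M \<eta> \<tau>0 (\<tau>0 + d) = (\<integral>x. h d x * exp (- loss Q h d x) \<partial>Q)"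
proof -
  have hm: "h d \<in> borel_measurable M" using L20D(1)[OF h_L20] .
  have "(\<lambda>x. \<eta> \<tau>0 x - \<eta> (\<tau>0 + d) x) = (\<lambda>x. - h d x)" by (simp add: h_def)
  hence "mean_of M \<eta> \<tau>0 (\<lambda>x. \<eta> \<tau>0 x - \<eta> (\<tau>0 + d) x) = 0"
    using L20D(4)[OF h_L20[of d]] hm by (simp add: mean_Q)
  moreover have "(\<lambda>x. \<eta> (\<tau>0 + d) x - \<eta> \<tau>0 x) = h d" by (simp add: h_def fun_eq_iff)
  ultimately show ?thesis using mean_tilted[OF hm] by (simp add: SKL_def)
qed

end

section \<open>Convexity, partial derivatives and covariance forms\<close>

lemma convex_local_min_global:
  fixes F :: "'a::real_normed_vector \<Rightarrow> real"
  assumes "convex_on UNIV F" "local_min F a" shows "F a \<le> F b"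
proof -
  obtain e where e: "e > 0" "\<And>y. dist y a < e \<Longrightarrow> F a \<le> F y"
    using assms(2) by (auto simp: local_min_def eventually_nhds_metric)
  have "\<forall>y\<in>ball a e. F a \<le> F y" using e(2) by (metis dist_commute mem_ball)
  from convex_local_global_minimum[OF e(1) assms(1) subset_UNIV this] show ?thesis by simp
qed

lemma (in psd_form) convex_diagonal: "convex_on UNIV (\<lambda>f. B f f)"
proof (rule convex_onI)
  fix t :: real and f g assume t: "0 < t" "t < 1"
  have "(1 - t) * B f f + t * B g g - B ((1 - t) *\<^sub>R f + t *\<^sub>R g) ((1 - t) *\<^sub>R f + t *\<^sub>R g)
      = t * (1 - t) * B (f - g) (f - g)"
    by (simp only: add_left add_right scale_left scale_right diff_left diff_right sym[of g f])
      (simp add: algebra_simps)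
  thus "B ((1 - t) *\<^sub>R f + t *\<^sub>R g) ((1 - t) *\<^sub>R f + t *\<^sub>R g) \<le> (1 - t) * B f f + t * B g g"
    using mult_nonneg_nonneg[OF mult_nonneg_nonneg pos[of "f - g"], of t "1 - t"] t by linarith
qed simp

text \<open>The slices through \<open>\<tau>\<close> inherit the joint derivative along the two
  axes, and linearity recombines them into one derivative on the product space.\<close>

lemma partial_derivatives:
  assumes f': "((\<lambda>\<tau>. \<eta> \<tau> x) has_derivative f') (at (\<tau> :: (real ^ 'p::finite) \<times> 'h::real_inner))"
  shows "D\<theta> \<eta> \<tau> (fst u) x + Dh \<eta> \<tau> (snd u) x = f' u"
proof -
  have f: "((\<lambda>\<tau>. \<eta> \<tau> x) has_derivative f') (at (fst \<tau>, snd \<tau>))" using f' by simp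
  have "((\<lambda>\<theta>. (\<theta>, snd \<tau>)) has_derivative (\<lambda>\<zeta>. (\<zeta>, 0))) (at (fst \<tau>))"
    by (auto intro!: derivative_eq_intros)
  hence "((\<lambda>\<theta>. \<eta> (\<theta>, snd \<tau>) x) has_derivative (\<lambda>\<zeta>. f' (\<zeta>, 0))) (at (fst \<tau>))"
    by (rule has_derivative_compose) (rule f)
  hence 1: "D\<theta> \<eta> \<tau> (fst u) x = f' (fst u, 0)"
    unfolding D\<theta>_def by (simp add: frechet_derivative_at[symmetric])
  have "((\<lambda>h. (fst \<tau>, h)) has_derivative (\<lambda>g. (0, g))) (at (snd \<tau>))"
    by (auto intro!: derivative_eq_intros)
  hence "((\<lambda>h. \<eta> (fst \<tau>, h) x) has_derivative (\<lambda>g. f' (0, g))) (at (snd \<tau>))"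
    by (rule has_derivative_compose) (rule f)
  hence 2: "Dh \<eta> \<tau> (snd u) x = f' (0, snd u)"
    unfolding Dh_def by (simp add: frechet_derivative_at[symmetric])
  have "f' u = f' ((fst u, 0) + (0, snd u))" by simp
  also have "\<dots> = f' (fst u, 0) + f' (0, snd u)" by (rule linear_add[OF has_derivative_linear[OF f']])
  finally show ?thesis using 1 2 by simp
qed

context base_model
begin

lemma bounded_linear_sq_le:
  assumes "bounded_linear_L20 M \<eta> \<tau>0 T"
  shows "\<exists>C\<ge>0. \<forall>v. var_of M \<eta> \<tau>0 (T v) \<le> C * (norm v)\<^sup>2"
proof -
  obtain B where B: "\<And>v. L2norm_of M \<eta> \<tau>0 (T v) \<le> B * norm v" and T: "\<And>v. T v \<in> L20_of M \<eta> \<tau>0"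
    using assms unfolding bounded_linear_L20_def by blast
  have "var_of M \<eta> \<tau>0 (T v) \<le> B\<^sup>2 * (norm v)\<^sup>2" for v
  proof -
    have "sqrt (\<integral>x. (T v x)\<^sup>2 \<partial>Q) \<le> B * norm v"
      using B[of v] L20D(1)[OF T[of v]] by (simp add: L2norm_of_def mean_Q)
    hence "(sqrt (\<integral>x. (T v x)\<^sup>2 \<partial>Q))\<^sup>2 \<le> (B * norm v)\<^sup>2" by (intro power_mono) auto
    thus ?thesis by (simp add: var_L20[OF T] power_mult_distrib)
  qed
  thus ?thesis by (intro exI[of _ "B\<^sup>2"]) auto
qed

text \<open>\<open>T\<close> is linear only up to null sets that depend on the combination;
  integrals do not see them, so the covariance is a genuine semi-inner product.\<close>

lemma psd_form_cov:
  assumes T: "\<And>v. T v \<in> L20_of M \<eta> \<tau>0"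
    and lin: "\<And>a b u v. AE x in M. T (a *\<^sub>R u + b *\<^sub>R v) x = a * T u x + b * T v x"
  shows "psd_form (\<lambda>u v. cov_of M \<eta> \<tau>0 (T u) (T v))"
proof (rule psd_form.intro)
  have Tm: "T v \<in> borel_measurable Q" for v using L20D(2)[OF T] .
  have TT: "integrable Q (\<lambda>x. T u x * T v x)" for u v
    using L20D[OF T] by (intro Q.square_integrable_mult(1)) auto
  show "cov_of M \<eta> \<tau>0 (T f) (T g) = cov_of M \<eta> \<tau>0 (T g) (T f)" for f g
    by (simp add: cov_L20[OF T T] mult.commute)
  show "cov_of M \<eta> \<tau>0 (T f) (T f) \<ge> 0" for f by (simp add: cov_L20[OF T T])
  have comb: "cov_of M \<eta> \<tau>0 (T (a *\<^sub>R u + b *\<^sub>R v)) (T g)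
      = a * cov_of M \<eta> \<tau>0 (T u) (T g) + b * cov_of M \<eta> \<tau>0 (T v) (T g)" for a b u v g
  proof -
    have "(\<integral>x. T (a *\<^sub>R u + b *\<^sub>R v) x * T g x \<partial>Q) = (\<integral>x. a * (T u x * T g x) + b * (T v x * T g x) \<partial>Q)"
    proof (rule integral_cong_AE)
      show "AE x in Q. T (a *\<^sub>R u + b *\<^sub>R v) x * T g x = a * (T u x * T g x) + b * (T v x * T g x)"
        unfolding AE_Q using lin[of a u b v] by eventually_elim (simp add: algebra_simps)
    qed (use Tm in measurable)
    thus ?thesis using TT by (simp add: cov_L20[OF T T])
  qed
  show "linear (\<lambda>f. cov_of M \<eta> \<tau>0 (T f) (T g))" for g
    using comb[of 1 _ 1 _ g] comb[of _ _ 0 0 g] by (intro linearI) auto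
qed

end

theorem theorem3:
  fixes M :: "'x measure"
    and \<eta> :: "(real ^ 'p::finite) \<times> ('h::{real_inner, complete_space}) \<Rightarrow> 'x \<Rightarrow> real"
    and J :: "'h \<Rightarrow> 'h \<Rightarrow> real"
    and \<theta>0 :: "real ^ 'p" and h0 :: 'h
    and L\<theta> :: "real ^ 'p \<Rightarrow> 'x \<Rightarrow> real" and Lh :: "'h \<Rightarrow> 'x \<Rightarrow> real"
    and N\<theta> :: "(real ^ 'p) set" and Nh :: "'h set"
    and \<phi> :: "nat \<Rightarrow> 'h" and \<rho> :: "nat \<Rightarrow> real" and C1 C2 r :: real
    and P :: "'w measure" and X :: "nat \<Rightarrow> 'w \<Rightarrow> 'x"
    and l :: "nat \<Rightarrow> real"
    and \<tau>hat :: "nat \<Rightarrow> 'w \<Rightarrow> (real ^ 'p) \<times> 'h"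
  defines "\<tau>0 \<equiv> (\<theta>0, h0)" and "N \<equiv> N\<theta> \<times> Nh"
  assumes model: "\<And>\<tau>. \<eta> \<tau> \<in> L20_of M \<eta> \<tau>0" "\<And>\<tau>. integrable M (\<lambda>x. exp (\<eta> \<tau> x))"
    and prob: "prob_space P"
    and iid: "prob_space.indep_vars P (\<lambda>_. M) X UNIV"
      "\<And>i. distributed P M (X i) (\<lambda>x. ennreal (pdf_of M \<eta> \<tau>0 x))"
    and nbhd: "\<theta>0 \<in> interior N\<theta>" "h0 \<in> interior Nh"
    and A1: "assumption1 J"
    and A2: "assumption2 M \<eta> J \<tau>0 L\<theta> Lh"
    and A3: "assumption3 P M \<eta> X \<tau>0 N"
    and A4: "assumption4 M \<eta> \<tau>0 L\<theta> Lh N C1 C2"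
    and A5: "assumption5 M \<eta> \<tau>0 L\<theta> Lh N C1"
    and A6: "assumption6 M \<eta> \<tau>0 N"
    and A7: "assumption7 M \<eta> J \<tau>0 Lh \<phi> \<rho>"
    and A8: "assumption8 \<rho> r"
    and convex: "\<And>n. n \<ge> 1 \<Longrightarrow> AE \<omega> in P. convex_on UNIV (crit M \<eta> n (\<lambda>i. X i \<omega>))"
    and estimators: "with_prob_tending_to_1 P (\<lambda>n \<omega>.
        unique_penalized_min (pen_crit M \<eta> J (l n) n (\<lambda>i. X i \<omega>)) N (\<tau>hat n \<omega>) \<and>
        minimizer_in (quad_crit M \<eta> J \<tau>0 (l n) n (\<lambda>i. X i \<omega>)) N)"
    and lambda: "\<And>n. l n > 0" "l \<longlonglongrightarrow> 0"
      "filterlim (\<lambda>n. real n * l n powr (1 / r)) at_top sequentially"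
  shows "bigO_in_prob P (\<lambda>n \<omega>. SKL M \<eta> \<tau>0 (\<tau>hat n \<omega>))
           (\<lambda>n. 1 / real n * l n powr (- 1 / r) + l n)"
proof -
  interpret P: prob_space P by (rule prob)
  have XM [measurable]: "X i \<in> measurable P M" for i using iid(2)[of i] by (rule distributed_measurable)
  have distrX: "distr P M (X i) = density M (\<lambda>x. ennreal (pdf_of M \<eta> \<tau>0 x))" for i
    using iid(2)[of i] by (rule distributed_distr_eq_density)
  \<comment> \<open>With a vanishing normaliser the density would be a division by zero, hence 0,
    and the law of \<open>X 0\<close> would have no mass.\<close>
  have Z0: "(\<integral>x. exp (\<eta> \<tau>0 x) \<partial>M) > 0"
  proof (rule ccontr)
    assume "\<not> ?thesis"
    moreover have "(\<integral>x. exp (\<eta> \<tau>0 x) \<partial>M) \<ge> 0" by simp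
    ultimately have "(\<lambda>x. ennreal (pdf_of M \<eta> \<tau>0 x)) = (\<lambda>_. 0)" by (simp add: pdf_of_def)
    moreover have "emeasure (distr P M (X 0)) (space M) = 1"
      using prob_space.emeasure_space_1[OF P.prob_space_distr[OF XM[of 0]]] by simp
    ultimately show False unfolding distrX by (simp add: emeasure_density)
  qed
  interpret b: base_model M \<eta> \<tau>0 by unfold_locales (use model Z0 in auto)
  have X: "distr P M (X i) = b.Q" for i by (simp add: distrX b.Q_def b.f0_def)

  \<comment> \<open>The information form and its comparison with a block diagonal form\<close>
  have L\<theta>: "bounded_linear_L20 M \<eta> \<tau>0 L\<theta>" and Lh: "bounded_linear_L20 M \<eta> \<tau>0 Lh"
    using A2 unfolding assumption2_def by auto
  have L\<theta>20: "L\<theta> \<zeta> \<in> L20_of M \<eta> \<tau>0" and Lh20: "Lh g \<in> L20_of M \<eta> \<tau>0" for \<zeta> g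
    using L\<theta> Lh unfolding bounded_linear_L20_def by auto
  have L\<theta>_lin: "AE x in M. L\<theta> (a *\<^sub>R u + c *\<^sub>R w) x = a * L\<theta> u x + c * L\<theta> w x" for a c u w
    using L\<theta> unfolding bounded_linear_L20_def by auto
  have Lh_lin: "AE x in M. Lh (a *\<^sub>R u + c *\<^sub>R w) x = a * Lh u x + c * Lh w x" for a c u w
    using Lh unfolding bounded_linear_L20_def by auto
  define L where "L u x = L\<theta> (fst u) x + Lh (snd u) x" for u :: "(real ^ 'p) \<times> 'h" and x
  have L20: "L u \<in> L20_of M \<eta> \<tau>0" for u
    unfolding L_def[abs_def] by (rule b.L20_add[OF L\<theta>20 Lh20])
  have L_lin: "AE x in M. L (a *\<^sub>R u + c *\<^sub>R w) x = a * L u x + c * L w x" for a c u w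
    using L\<theta>_lin[of a "fst u" c "fst w"] Lh_lin[of a "snd u" c "snd w"]
    by eventually_elim (simp add: L_def algebra_simps)
  define q where "q u = var_of M \<eta> \<tau>0 (L u)" for u
  define B where "B u w = cov_of M \<eta> \<tau>0 (L u) (L w)" for u w
  define v where "v f g = cov_of M \<eta> \<tau>0 (Lh f) (Lh g)" for f g
  define j where "j u w = J (snd u) (snd w)" for u w :: "(real ^ 'p) \<times> 'h"
  interpret B: psd_form B unfolding B_def[abs_def] by (rule b.psd_form_cov[OF L20 L_lin])
  interpret v: psd_form v unfolding v_def[abs_def] by (rule b.psd_form_cov[OF Lh20 Lh_lin])
  interpret J: psd_form J
  proof (rule psd_form.intro)
    have A1': "\<forall>f g. J f g = J g f" "\<forall>g. linear (\<lambda>f. J f g)" "\<forall>g. 0 \<le> J g g"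
      using A1 unfolding assumption1_def by auto
    show "J f g = J g f" for f g using A1'(1) by blast
    show "linear (\<lambda>f. J f g)" for g using A1'(2) by blast
    show "J f f \<ge> 0" for f using A1'(3) by blast
  qed
  interpret j: psd_form j
  proof (rule psd_form.intro)
    show "j f g = j g f" for f g unfolding j_def by (rule J.sym)
    show "linear (\<lambda>f. j f g)" for g by (rule linearI) (simp_all add: j_def J.add_left J.scale_left)
    show "j f f \<ge> 0" for f unfolding j_def by (rule J.pos)
  qed
  have vv: "var_of M \<eta> \<tau>0 (Lh g) = v g g" for g by (simp add: v_def var_of_def)
  have q_eq: "q u = B u u" for u by (simp add: q_def B_def var_of_def)

  \<comment> \<open>The norm equivalence is taken at penalty level 1, so \<open>M1\<close> and
    \<open>M2\<close> do not vary with the smoothing parameter.\<close>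
  obtain M1 M2 where M12: "M1 > 0" "\<And>g. M1 * (norm g)\<^sup>2 \<le> v g g + J g g" "\<And>g. v g g + J g g \<le> M2 * (norm g)\<^sup>2"
  proof -
    have "\<forall>l>0. \<exists>M1>0. \<exists>M2>0. \<forall>g. M1 * (norm g)\<^sup>2 \<le> v g g + l * J g g \<and> v g g + l * J g g \<le> M2 * (norm g)\<^sup>2"
      using A2 unfolding assumption2_def vv by blast
    from this[rule_format, of 1] show ?thesis using that by auto
  qed
  have eig: "cov_of M \<eta> \<tau>0 (Lh (\<phi> i)) (Lh (\<phi> k)) = (if i = k then 1 else 0) \<and>
        J (\<phi> i) (\<phi> k) = (if i = k then \<rho> i else 0)" if "i \<ge> 1" "k \<ge> 1" for i k
    using A7 that unfolding assumption7_def eigen_system_def by blast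
  have eig2: "closure (span (\<phi> ` {1..})) = UNIV" "\<And>i. i \<ge> 1 \<Longrightarrow> 0 \<le> \<rho> i"
    using A7 unfolding assumption7_def eigen_system_def by auto
  have range_Suc: "range (\<lambda>i. \<phi> (Suc i)) = \<phi> ` {1..}"
  proof -
    have "{1..} = range Suc" by (auto simp: image_iff Suc_le_eq gr0_conv_Suc)
    thus ?thesis by (simp add: image_image)
  qed
  interpret e: eigenbasis v J "\<lambda>i. \<phi> (Suc i)" "\<lambda>i. \<rho> (Suc i)" M1 M2
    by unfold_locales (use M12 eig eig2 in \<open>auto simp: v_def range_Suc\<close>)

  obtain Ca Cb where Cab: "Ca \<ge> 0" "\<And>\<zeta>. var_of M \<eta> \<tau>0 (L\<theta> \<zeta>) \<le> Ca * (norm \<zeta>)\<^sup>2"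
    "Cb \<ge> 0" "\<And>g. var_of M \<eta> \<tau>0 (Lh g) \<le> Cb * (norm g)\<^sup>2"
    using b.bounded_linear_sq_le[OF L\<theta>] b.bounded_linear_sq_le[OF Lh] by blast
  have L_\<theta>: "q (\<zeta>, 0) = var_of M \<eta> \<tau>0 (L\<theta> \<zeta>)" and L_h: "q (0, g) = v g g" for \<zeta> g
  proof -
    have z: "AE x in M. L\<theta> 0 x = 0" "AE x in M. Lh 0 x = 0"
      using L\<theta>_lin[of 0 0 0 0] Lh_lin[of 0 0 0 0] by simp_all
    have "(\<integral>x. (L (\<zeta>, 0) x)\<^sup>2 \<partial>b.Q) = (\<integral>x. (L\<theta> \<zeta> x)\<^sup>2 \<partial>b.Q)"
    proof (rule integral_cong_AE)
      show "AE x in b.Q. (L (\<zeta>, 0) x)\<^sup>2 = (L\<theta> \<zeta> x)\<^sup>2"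
        unfolding b.AE_Q using z(2) by eventually_elim (simp add: L_def)
    qed (use b.L20D(2)[OF L20] b.L20D(2)[OF L\<theta>20] in measurable)
    thus "q (\<zeta>, 0) = var_of M \<eta> \<tau>0 (L\<theta> \<zeta>)" unfolding q_def by (simp add: b.var_L20[OF L20] b.var_L20[OF L\<theta>20])
    have "(\<integral>x. (L (0, g) x)\<^sup>2 \<partial>b.Q) = (\<integral>x. (Lh g x)\<^sup>2 \<partial>b.Q)"
    proof (rule integral_cong_AE)
      show "AE x in b.Q. (L (0, g) x)\<^sup>2 = (Lh g x)\<^sup>2"
        unfolding b.AE_Q using z(1) by eventually_elim (simp add: L_def)
    qed (use b.L20D(2)[OF L20] b.L20D(2)[OF Lh20] in measurable)
    thus "q (0, g) = v g g" unfolding q_def vv[symmetric] by (simp add: b.var_L20[OF L20] b.var_L20[OF Lh20])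
  qed
  have split: "u = (fst u, 0) + (0, snd u)" for u :: "(real ^ 'p) \<times> 'h" by simp
  have q_le1: "q u \<le> 2 * Ca * (norm (fst u))\<^sup>2 + 2 * v (snd u) (snd u)" for u
  proof -
    have "q u \<le> 2 * q (fst u, 0) + 2 * q (0, snd u)"
      using B.add_le[of "(fst u, 0)" "(0, snd u)"] by (simp add: q_eq)
    thus ?thesis using Cab(2)[of "fst u"] by (simp add: L_\<theta> L_h)
  qed
  obtain cd where cd: "cd > 0" "\<And>\<zeta> g. norm \<zeta> = 1 \<Longrightarrow> var_of M \<eta> \<tau>0 (\<lambda>x. L\<theta> \<zeta> x - Lh g x) > cd"
    using A2 unfolding assumption2_def by blast
  \<comment> \<open>Dividing by the norm of the Euclidean part reduces to unit vectors, where the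
    separation constant applies with \<open>- snd w\<close> in place of \<open>g\<close>.\<close>
  have \<zeta>_le: "cd * (norm (fst u))\<^sup>2 \<le> q u" for u
  proof (cases "fst u = 0")
    case True
    thus ?thesis using B.pos[of u] by (simp add: q_eq)
  next
    case False
    define a where "a = norm (fst u)"
    have a: "a > 0" using False by (simp add: a_def)
    define w where "w = ((1 / a) *\<^sub>R fst u, (1 / a) *\<^sub>R snd u)"
    have u: "u = a *\<^sub>R w" using a by (simp add: w_def prod_eq_iff)
    have "AE x in M. Lh (- snd w) x = - Lh (snd w) x" using Lh_lin[of "-1" "snd w" 0 0] by simp
    hence ae: "AE x in b.Q. (L\<theta> (fst w) x - Lh (- snd w) x)\<^sup>2 = (L w x)\<^sup>2"
      unfolding b.AE_Q by eventually_elim (simp add: L_def)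
    have m20: "(\<lambda>x. L\<theta> (fst w) x - Lh (- snd w) x) \<in> L20_of M \<eta> \<tau>0"
      using b.L20_add[OF L\<theta>20 b.L20_cmult[OF Lh20, of "-1"]] by simp
    have "var_of M \<eta> \<tau>0 (\<lambda>x. L\<theta> (fst w) x - Lh (- snd w) x) = q w"
      unfolding q_def b.var_L20[OF m20] b.var_L20[OF L20]
      using ae b.L20D(2)[OF m20] b.L20D(2)[OF L20] by (intro integral_cong_AE) auto
    moreover have "norm (fst w) = 1" using a by (simp add: w_def a_def)
    ultimately have "cd < q w" using cd(2)[of "fst w" "- snd w"] by simp
    hence "a\<^sup>2 * cd \<le> a\<^sup>2 * q w" by (intro mult_left_mono) auto
    also have "a\<^sup>2 * q w = q u" unfolding u by (simp add: q_eq B.scale_left B.scale_right power2_eq_square)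
    finally show ?thesis by (simp add: a_def mult.commute)
  qed
  have v_le: "v (snd u) (snd u) \<le> 2 * q u + 2 * Ca * (norm (fst u))\<^sup>2" for u
  proof -
    have "(0, snd u) = u - (fst u, 0)" by (simp add: prod_eq_iff)
    hence "q (0, snd u) \<le> 2 * q u + 2 * q (fst u, 0)" using B.diff_le[of u "(fst u, 0)"] by (simp add: q_eq)
    thus ?thesis using Cab(2)[of "fst u"] by (simp add: L_\<theta> L_h)
  qed
  \<comment> \<open>The long entry comes from bounding both blocks by \<open>q\<close>;
    \<open>2 * Ca\<close> and 2 come from bounding \<open>q\<close> by the blocks.\<close>
  define CL where "CL = max (1 / cd + 2 + 2 * Ca / cd) (max (2 * Ca) 2)"
  have CL: "CL \<ge> 1" "CL \<ge> 2 * Ca" "CL \<ge> 2" "CL \<ge> 1 / cd + 2 + 2 * Ca / cd" by (auto simp: CL_def)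
  have lowerL: "(norm (fst u))\<^sup>2 + v (snd u) (snd u) \<le> CL * q u" for u
  proof -
    have 1: "(norm (fst u))\<^sup>2 \<le> q u / cd" using \<zeta>_le[of u] cd(1) by (simp add: field_simps)
    have "2 * Ca * (norm (fst u))\<^sup>2 \<le> 2 * Ca * (q u / cd)" using 1 Cab(1) by (intro mult_left_mono) auto
    hence "(norm (fst u))\<^sup>2 + v (snd u) (snd u) \<le> (1 / cd + 2 + 2 * Ca / cd) * q u"
      using 1 v_le[of u] by (simp add: algebra_simps)
    also have "\<dots> \<le> CL * q u" using CL(4) B.pos[of u] by (intro mult_right_mono) (auto simp: q_eq)
    finally show ?thesis .
  qed
  have upperL: "q u \<le> CL * ((norm (fst u))\<^sup>2 + v (snd u) (snd u))" for u
  proof -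
    have "2 * Ca * (norm (fst u))\<^sup>2 \<le> CL * (norm (fst u))\<^sup>2" using CL by (intro mult_right_mono) auto
    moreover have "2 * v (snd u) (snd u) \<le> CL * v (snd u) (snd u)" using CL v.pos by (intro mult_right_mono) auto
    ultimately show ?thesis using q_le1[of u] by (simp add: distrib_left)
  qed

  \<comment> \<open>The neighbourhood of the truth as a convex family\<close>
  define S where "S = {d. \<tau>0 + d \<in> N}"
  have convN: "convex N" using A6 by (simp add: assumption6_def)
  have S: "convex S" "0 \<in> S"
  proof -
    have "S = (\<lambda>\<tau>. - \<tau>0 + \<tau>) ` N" by (auto simp: S_def image_iff intro!: bexI[of _ "\<tau>0 + _"])
    thus "convex S" using convex_translation[OF convN] by simp
    have "\<theta>0 \<in> N\<theta>" "h0 \<in> Nh" using nbhd interior_subset by blast+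
    thus "0 \<in> S" by (simp add: S_def N_def \<tau>0_def)
  qed
  define D where "D d u x = D\<theta> \<eta> (\<tau>0 + d) (fst u) x + Dh \<eta> (\<tau>0 + d) (snd u) x" for d u x
  have A4': "C1 > 0" "C2 > 0"
    "\<And>\<tau>. \<tau> \<in> N \<Longrightarrow> bounded_linear_L20 M \<eta> \<tau>0 (D\<theta> \<eta> \<tau>) \<and> bounded_linear_L20 M \<eta> \<tau>0 (Dh \<eta> \<tau>)"
    "\<And>\<tau> \<zeta> g. \<tau> \<in> N \<Longrightarrow> C1 * var_of M \<eta> \<tau>0 (\<lambda>x. L\<theta> \<zeta> x + Lh g x)
            \<le> var_of M \<eta> \<tau>0 (\<lambda>x. D\<theta> \<eta> \<tau> \<zeta> x + Dh \<eta> \<tau> g x)"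
    "\<And>\<tau> \<zeta> g. \<tau> \<in> N \<Longrightarrow> var_of M \<eta> \<tau>0 (\<lambda>x. D\<theta> \<eta> \<tau> \<zeta> x + Dh \<eta> \<tau> g x)
            \<le> C2 * var_of M \<eta> \<tau>0 (\<lambda>x. L\<theta> \<zeta> x + Lh g x)"
    using A4 unfolding assumption4_def by auto
  have D20: "D d u \<in> L20_of M \<eta> \<tau>0" if "d \<in> S" for d u
    unfolding D_def[abs_def] using A4'(3)[of "\<tau>0 + d"] that
    by (intro b.L20_add) (auto simp: S_def bounded_linear_L20_def)
  have D_le: "C1 * q u \<le> (\<integral>x. (D d u x)\<^sup>2 \<partial>b.Q)" "(\<integral>x. (D d u x)\<^sup>2 \<partial>b.Q) \<le> C2 * q u" if "d \<in> S" for d u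
    using A4'(4,5)[of "\<tau>0 + d" "fst u" "snd u"] that
    unfolding b.var_L20[OF D20[OF that], symmetric] q_def by (auto simp: S_def D_def[abs_def] L_def[abs_def])
  have deriv: "AE x in b.Q. \<forall>d\<in>S. ((\<lambda>d. b.h d x) has_derivative (\<lambda>u. D d u x)) (at d)"
  proof -
    have "AE x in M. \<forall>\<tau>\<in>N. (\<lambda>\<tau>. \<eta> \<tau> x) differentiable (at \<tau>)" using A3 by (simp add: assumption3_def)
    thus ?thesis unfolding b.AE_Q
    proof eventually_elim
      case (elim x)
      show ?case
      proof
        fix d assume "d \<in> S"
        then obtain f' where f': "((\<lambda>\<tau>. \<eta> \<tau> x) has_derivative f') (at (\<tau>0 + d))"
          using elim by (auto simp: S_def differentiable_def)
        have "((\<lambda>d. \<tau>0 + d) has_derivative (\<lambda>u. u)) (at d)" by (auto intro!: derivative_eq_intros)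
        hence "((\<lambda>d. \<eta> (\<tau>0 + d) x) has_derivative f') (at d)"
          by (rule has_derivative_compose) (rule f')
        hence "((\<lambda>d. \<eta> (\<tau>0 + d) x - \<eta> \<tau>0 x) has_derivative f') (at d)"
          by (auto intro!: derivative_eq_intros)
        moreover have "f' = (\<lambda>u. D d u x)" by (simp add: fun_eq_iff D_def partial_derivatives[where \<eta> = \<eta> and x = x, OF f'])
        ultimately show "((\<lambda>d. b.h d x) has_derivative (\<lambda>u. D d u x)) (at d)" by (simp add: b.h_def)
      qed
    qed
  qed
  have loss_convex: "AE x in b.Q. loss b.Q b.h ((1 - t) *\<^sub>R d + t *\<^sub>R d') x
      \<le> (1 - t) * loss b.Q b.h d x + t * loss b.Q b.h d' x" if t: "0 \<le> t" "t \<le> 1" for t d d'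
  proof -
    let ?d = "(1 - t) *\<^sub>R d + t *\<^sub>R d'"
    let ?R = "\<lambda>x. loss b.Q b.h ?d x \<le> (1 - t) * loss b.Q b.h d x + t * loss b.Q b.h d' x"
    have eq: "loss b.Q b.h d (xs 0) = crit M \<eta> 1 xs (\<tau>0 + d) - crit M \<eta> 1 xs \<tau>0" for xs d
      using b.crit_eq[of 1 xs d] by simp
    \<comment> \<open>For a sample of size one, increments of the criterion from the truth are
      exactly the loss at \<open>X 0\<close>. Its law is \<open>b.Q\<close>, so almost sure
      convexity becomes a statement for almost every \<open>x\<close>.\<close>
    have "AE \<omega> in P. ?R (X 0 \<omega>)"
      using convex[OF order_refl]
    proof eventually_elim
      case (elim \<omega>)
      let ?c = "crit M \<eta> 1 (\<lambda>i. X i \<omega>)"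
      have "?c ((1 - t) *\<^sub>R (\<tau>0 + d) + t *\<^sub>R (\<tau>0 + d')) \<le> (1 - t) * ?c (\<tau>0 + d) + t * ?c (\<tau>0 + d')"
        using t by (intro convex_onD[OF elim]) auto
      also have "(1 - t) *\<^sub>R (\<tau>0 + d) + t *\<^sub>R (\<tau>0 + d') = \<tau>0 + ?d"
        by (simp add: scaleR_add_right scaleR_diff_left)
      finally have "?c (\<tau>0 + ?d) - ?c \<tau>0 \<le> (1 - t) * (?c (\<tau>0 + d) - ?c \<tau>0) + t * (?c (\<tau>0 + d') - ?c \<tau>0)"
        by (simp only: left_diff_distrib right_diff_distrib)
      thus ?case unfolding eq[of _ "\<lambda>i. X i \<omega>", symmetric] .
    qed
    moreover have "{x \<in> space M. ?R x} \<in> sets M" by measurable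
    ultimately have "AE x in distr P M (X 0). ?R x" by (subst AE_distr_iff) auto
    thus ?thesis unfolding X .
  qed
  obtain C3 C4 where C34: "C3 > 0" "C4 > 0"
    "\<And>\<tau> f. \<tau> \<in> N \<Longrightarrow> f \<in> L20_of M \<eta> \<tau>0 \<Longrightarrow>
        C3 * var_of M \<eta> \<tau>0 f \<le> var_of M \<eta> \<tau> f \<and> var_of M \<eta> \<tau> f \<le> C4 * var_of M \<eta> \<tau>0 f"
    using A6 unfolding assumption6_def by blast
  \<comment> \<open>A centred function of variance 1 is positive and negative with positive
    probability each; its positivity set is the set of non-trivial probability for the density ratio
    bound.\<close>
  define f1 where "f1 = Lh (\<phi> 1)"
  have f120: "f1 \<in> L20_of M \<eta> \<tau>0" unfolding f1_def by (rule Lh20)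
  define E where "E = {x \<in> space b.Q. f1 x > 0}"
  have Lm [measurable]: "f1 \<in> borel_measurable b.Q" by (rule b.L20D(2)[OF f120])
  have E: "E \<in> sets b.Q" unfolding E_def by measurable
  have L1: "(\<integral>x. (f1 x)\<^sup>2 \<partial>b.Q) = 1"
  proof -
    have "cov_of M \<eta> \<tau>0 f1 f1 = 1" using eig[of 1 1] by (simp add: f1_def)
    thus ?thesis by (simp add: b.cov_L20[OF f120 f120] power2_eq_square)
  qed
  note L1m = b.L20D(4,5)[OF f120]
  have zero_contra: False if "AE x in b.Q. f1 x = 0"
  proof -
    have "(\<integral>x. (f1 x)\<^sup>2 \<partial>b.Q) = (\<integral>x. 0 \<partial>b.Q)"
      by (rule integral_cong_AE) (use that in auto)
    thus False using L1 by simp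
  qed
  have E_prob: "0 < measure b.Q E" "measure b.Q E < 1"
  proof -
    show "0 < measure b.Q E"
    proof (rule ccontr)
      assume "\<not> ?thesis"
      hence "measure b.Q E = 0" by (simp add: zero_less_measure_iff)
      hence "AE x in b.Q. x \<notin> E" using E b.Q.prob_eq_0 by blast
      hence "AE x in b.Q. 0 \<le> - f1 x" using AE_space by eventually_elim (auto simp: E_def)
      moreover have "(\<integral>x. - f1 x \<partial>b.Q) = 0" using L1m by simp
      ultimately have "AE x in b.Q. - f1 x = 0"
        using integral_nonneg_eq_0_iff_AE[of b.Q "\<lambda>x. - f1 x"] L1m(2) by simp
      thus False using zero_contra by simp
    qed
    show "measure b.Q E < 1"
    proof (rule ccontr)
      assume "\<not> ?thesis"
      hence "measure b.Q E = 1" using b.Q.prob_le_1[of E] by linarith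
      hence ae: "AE x in b.Q. x \<in> E" using E b.Q.prob_eq_1 by blast
      hence "AE x in b.Q. 0 \<le> f1 x" by eventually_elim (auto simp: E_def)
      from integral_nonneg_eq_0_iff_AE[OF L1m(2) this] show False using L1m(1) zero_contra by blast
    qed
  qed
  define k0 where "k0 = C3 * (measure b.Q E * (1 - measure b.Q E))"
  have k0: "k0 > 0" using C34 E_prob by (simp add: k0_def)
  \<comment> \<open>The smallest constant at least 1 that covers both the lower and the upper ratio
    bound.\<close>
  define \<kappa> where "\<kappa> = max 1 (max (1 / k0) (C4 / k0))"
  have \<kappa>: "\<kappa> \<ge> 1" "1 / \<kappa> \<le> k0" "C4 / k0 \<le> \<kappa>"
  proof -
    have "1 / k0 \<le> \<kappa>" by (simp add: \<kappa>_def)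
    hence "1 \<le> \<kappa> * k0" using k0 by (simp add: field_simps)
    thus "1 / \<kappa> \<le> k0" by (simp add: \<kappa>_def divide_le_eq mult.commute)
  qed (auto simp: \<kappa>_def)
  have ratio: "AE x in b.Q. 1 / \<kappa> \<le> exp (- loss b.Q b.h d x) \<and> exp (- loss b.Q b.h d x) \<le> \<kappa>" if d: "d \<in> S" for d
  proof -
    let ?g = "\<lambda>x. exp (- loss b.Q b.h d x)"
    have geq: "?g x = exp (b.h d x) / (\<integral>x. exp (b.h d x) \<partial>b.Q)" for x
      using b.Z_pos[of "\<tau>0 + d"] b.Z_pos[of \<tau>0] by (simp add: loss_def cgf_def exp_diff b.Z_exp(1))
    have gi: "integrable b.Q ?g" "(\<integral>x. ?g x \<partial>b.Q) = 1"
      unfolding geq using b.Z_exp[of d] b.Z_pos[of "\<tau>0 + d"] b.Z_pos[of \<tau>0] by auto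
    have "AE x in b.Q. C3 * (measure b.Q E * (1 - measure b.Q E)) \<le> ?g x \<and> ?g x \<le> C4 / (C3 * (measure b.Q E * (1 - measure b.Q E)))"
    proof (rule b.Q.density_ratio_bounds[OF _ _ gi E E_prob C34(1,2)])
      show "?g \<in> borel_measurable b.Q" unfolding b.meas_Q by measurable
      fix f :: "'x \<Rightarrow> real" assume f: "f \<in> borel_measurable b.Q" "integrable b.Q (\<lambda>x. (f x)\<^sup>2)" "(\<integral>x. f x \<partial>b.Q) = 0"
      hence f20: "f \<in> L20_of M \<eta> \<tau>0" and [measurable]: "f \<in> borel_measurable M" by (auto simp: b.L20_iff b.meas_Q)
      have "var_of M \<eta> (\<tau>0 + d) f = (\<integral>x. (f x)\<^sup>2 * ?g x \<partial>b.Q) - (\<integral>x. f x * ?g x \<partial>b.Q)\<^sup>2"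
        by (simp add: var_of_def cov_of_def b.mean_tilted power2_eq_square)
      thus "C3 * (\<integral>x. (f x)\<^sup>2 \<partial>b.Q) \<le> (\<integral>x. (f x)\<^sup>2 * ?g x \<partial>b.Q) - (\<integral>x. f x * ?g x \<partial>b.Q)\<^sup>2 \<and>
        (\<integral>x. (f x)\<^sup>2 * ?g x \<partial>b.Q) - (\<integral>x. f x * ?g x \<partial>b.Q)\<^sup>2 \<le> C4 * (\<integral>x. (f x)\<^sup>2 \<partial>b.Q)"
        using C34(3)[of "\<tau>0 + d" f] d f20 by (simp add: S_def b.var_L20)
    qed simp
    thus ?thesis unfolding k0_def[symmetric] by eventually_elim (use \<kappa> in linarith)
  qed

  have family: "convex_family b.Q b.h D S q C1 C2 \<kappa>"
  proof (intro convex_family.intro convex_family_axioms.intro)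
    show "prob_space b.Q" by (rule b.prob_Q)
    show "b.h d \<in> borel_measurable b.Q" "integrable b.Q (\<lambda>x. (b.h d x)\<^sup>2)" "(\<integral>x. b.h d x \<partial>b.Q) = 0"
      "integrable b.Q (\<lambda>x. exp (b.h d x))" for d
      using b.L20D[OF b.h_L20] b.Z_exp by auto
    show "b.h 0 x = 0" for x by (simp add: b.h_def)
    show "convex S" "0 \<in> S" by (rule S)+
    show "AE x in b.Q. \<forall>d\<in>S. ((\<lambda>d. b.h d x) has_derivative (\<lambda>u. D d u x)) (at d)" by (rule deriv)
    show "D d u \<in> borel_measurable b.Q" "integrable b.Q (\<lambda>x. (D d u x)\<^sup>2)" "(\<integral>x. D d u x \<partial>b.Q) = 0"
      if "d \<in> S" for d u using b.L20D[OF D20[OF that]] by auto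
    show "C1 > 0" "C2 > 0" "\<kappa> \<ge> 1" by (rule A4' \<kappa>)+
    show "C1 * q u \<le> (\<integral>x. (D d u x)\<^sup>2 \<partial>b.Q)" "(\<integral>x. (D d u x)\<^sup>2 \<partial>b.Q) \<le> C2 * q u" if "d \<in> S" for d u
      by (rule D_le[OF that])+
    show "AE x in b.Q. loss b.Q b.h ((1 - t) *\<^sub>R d + t *\<^sub>R d') x
      \<le> (1 - t) * loss b.Q b.h d x + t * loss b.Q b.h d' x" if "0 \<le> t" "t \<le> 1" for t d d'
      by (rule loss_convex[OF that])
    show "AE x in b.Q. 1 / \<kappa> \<le> exp (- loss b.Q b.h d x) \<and> exp (- loss b.Q b.h d x) \<le> \<kappa>" if "d \<in> S" for d
      by (rule ratio[OF that])
    show "\<exists>T. countable T \<and> T \<subseteq> S \<and> S \<subseteq> closure T"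
      by (rule countable_dense_subset[OF e.coord_expansion])
    show "\<exists>C. \<forall>u. q u \<le> C * (norm u)\<^sup>2"
    proof (intro exI allI)
      fix u :: "(real ^ 'p) \<times> 'h"
      have n: "(norm (fst u))\<^sup>2 \<le> (norm u)\<^sup>2" "(norm (snd u))\<^sup>2 \<le> (norm u)\<^sup>2"
        using norm_fst_le[of "fst u" "snd u"] norm_snd_le[of "snd u" "fst u"] by (auto intro!: power_mono)
      have "2 * Ca * (norm (fst u))\<^sup>2 \<le> 2 * Ca * (norm u)\<^sup>2" using n Cab by (intro mult_left_mono) auto
      moreover have "2 * v (snd u) (snd u) \<le> 2 * Cb * (norm u)\<^sup>2"
        using Cab(4)[of "snd u"] mult_left_mono[OF n(2) Cab(3)] by (simp add: vv)
      ultimately show "q u \<le> (2 * Ca + 2 * Cb) * (norm u)\<^sup>2" using q_le1[of u] by (simp add: distrib_right)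
    qed
  qed
  interpret G: graded_family b.Q b.h D S q C1 C2 \<kappa> B j e.coord e.bvec "e.weight CARD('p)" CL
  proof (intro graded_family.intro graded_family_axioms.intro family B.psd_form_axioms j.psd_form_axioms)
    show "q u = B u u" for u by (rule q_eq)
    show "linear (e.coord a :: (real ^ 'p) \<times> 'h \<Rightarrow> real)" for a by (rule e.coord_linear)
    show "(\<lambda>k. \<Sum>a<k. e.coord a u *\<^sub>R e.bvec a) \<longlonglongrightarrow> u" for u :: "(real ^ 'p) \<times> 'h" by (rule e.coord_expansion)
    show "e.weight CARD('p) a \<ge> 0" for a using e.\<rho> by (simp add: e.weight_def)
    show "CL \<ge> 1" by (rule CL)
    show "(\<Sum>a<k. (e.coord a u)\<^sup>2) \<le> CL * q u" for k u by (rule order.trans[OF e.coord_bessel lowerL])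
    show "(\<Sum>a<k. e.weight CARD('p) a * (e.coord a u)\<^sup>2) \<le> j u u" for k u
      unfolding j_def by (rule e.coord_bessel_weighted)
    show "q u \<le> CL * ((\<Sum>a<k. (e.coord a u)\<^sup>2) + j u u / R)"
      if "R > 0" "\<And>a. a \<ge> k \<Longrightarrow> e.weight CARD('p) a \<ge> R" for k R u
    proof -
      have "q u \<le> CL * ((norm (fst u))\<^sup>2 + v (snd u) (snd u))" by (rule upperL)
      also have "\<dots> \<le> CL * ((\<Sum>a<k. (e.coord a u)\<^sup>2) + j u u / R)"
        unfolding j_def using CL by (intro mult_left_mono e.coord_tail that) auto
      finally show ?thesis .
    qed
    show "q (e.bvec a) \<le> CL" for a
      using upperL[of "e.bvec a"] v.scale_left[of 0 0 0] by (auto simp: e.bvec_def e.v_\<phi> split: if_splits)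
  qed

  \<comment> \<open>Effective dimension in joint coordinates\<close>
  define w where "w x = x powr (- 1 / r)" for x :: real
  obtain \<kappa>' \<beta>1 \<beta>2 where r: "r > 1" and \<beta>: "0 < \<beta>1"
    "\<And>i. i \<ge> 1 \<Longrightarrow> \<kappa>' i \<in> {\<beta>1<..<\<beta>2} \<and> \<rho> i = \<kappa>' i * real i powr r"
    using A8 unfolding assumption8_def by blast
  have \<rho>_ge: "\<rho> (Suc i) \<ge> \<beta>1 * real (Suc i) powr r" for i
  proof -
    have "\<beta>1 \<le> \<kappa>' (Suc i)" using \<beta>(2)[of "Suc i"] by auto
    hence "\<beta>1 * real (Suc i) powr r \<le> \<kappa>' (Suc i) * real (Suc i) powr r" by (intro mult_right_mono) auto
    thus ?thesis using \<beta>(2)[of "Suc i"] by simp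
  qed
  have "\<exists>C>0. \<forall>l. 0 < l \<longrightarrow> l \<le> 1 \<longrightarrow>
    (\<forall>m. (\<Sum>i<m. 1 / (1 + l * \<rho> (Suc i))) \<le> C * l powr (- 1 / r)) \<and>
    (\<exists>k. real k \<le> C * l powr (- 1 / r) \<and> (\<forall>i\<ge>k. l * \<rho> (Suc i) \<ge> 1))"
    by (rule effective_dimension[where \<beta> = \<beta>1]) (use r \<beta>(1) \<rho>_ge in auto)
  then obtain C0 where C0: "C0 > 0"
    "\<And>l m. 0 < l \<Longrightarrow> l \<le> 1 \<Longrightarrow> (\<Sum>i<m. 1 / (1 + l * \<rho> (Suc i))) \<le> C0 * w l"
    "\<And>l. 0 < l \<Longrightarrow> l \<le> 1 \<Longrightarrow> \<exists>k. real k \<le> C0 * w l \<and> (\<forall>i\<ge>k. l * \<rho> (Suc i) \<ge> 1)"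
    unfolding w_def by blast
  have w1: "w x \<ge> 1" if "0 < x" "x \<le> 1" for x
  proof -
    have "1 powr (- 1 / r) \<le> x powr (- 1 / r)" using that r by (intro powr_mono2') auto
    thus ?thesis by (simp add: w_def)
  qed
  \<comment> \<open>Each Euclidean coordinate has weight 0 and adds 1 to the trace;
    \<open>w \<ge> 1\<close> absorbs this finite number into the rate.\<close>
  define C\<rho> where "C\<rho> = real CARD('p) + C0"
  have C\<rho>: "C\<rho> > 0" using C0 by (simp add: C\<rho>_def add_nonneg_pos)
  have pw: "real CARD('p) \<le> real CARD('p) * w x" if "0 < x" "x \<le> 1" for x
    using w1[OF that] by simp
  have dim: "(\<Sum>a<k. 1 / (1 + x * e.weight CARD('p) a)) \<le> C\<rho> * w x" if x: "0 < x" "x \<le> 1" for x k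
  proof -
    have pos: "1 / (1 + x * e.weight CARD('p) a) \<ge> 0" for a
      using x e.\<rho> by (simp add: e.weight_def)
    have "(\<Sum>a<k. 1 / (1 + x * e.weight CARD('p) a)) \<le> (\<Sum>a<CARD('p) + k. 1 / (1 + x * e.weight CARD('p) a))"
      using pos by (intro sum_mono2) auto
    also have "\<dots> = real CARD('p) + (\<Sum>i<k. 1 / (1 + x * \<rho> (Suc i)))"
      unfolding sum_lessThan_split by (simp add: e.weight_def)
    also have "\<dots> \<le> C\<rho> * w x"
      using add_mono[OF pw[OF x] C0(2)[OF x, of k]] by (simp only: C\<rho>_def distrib_right)
    finally show ?thesis .
  qed
  have cut: "\<exists>k. real k \<le> C\<rho> * w x \<and> (\<forall>a\<ge>k. x * e.weight CARD('p) a \<ge> 1)" if x: "0 < x" "x \<le> 1" for x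
  proof -
    obtain k where k: "real k \<le> C0 * w x" "\<And>i. i \<ge> k \<Longrightarrow> x * \<rho> (Suc i) \<ge> 1" using C0(3)[OF x] by blast
    have "real (CARD('p) + k) \<le> C\<rho> * w x"      using add_mono[OF pw[OF x] k(1)] by (simp only: C\<rho>_def distrib_right of_nat_add)
    moreover have "x * e.weight CARD('p) a \<ge> 1" if "a \<ge> CARD('p) + k" for a
      using k(2)[of "a - CARD('p)"] that by (simp add: e.weight_def)
    ultimately show ?thesis by blast
  qed

  \<comment> \<open>From the deviation bound to the rate\<close>
  obtain Ev where Ev: "\<And>n. Ev n \<in> sets P" "(\<lambda>n. measure P (Ev n)) \<longlonglongrightarrow> 1"
    and Ev_min: "\<And>n \<omega>. \<omega> \<in> Ev n \<Longrightarrow> unique_penalized_min (pen_crit M \<eta> J (l n) n (\<lambda>i. X i \<omega>)) N (\<tau>hat n \<omega>)"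
    using estimators unfolding with_prob_tending_to_1_def by blast
  show ?thesis
    unfolding bigO_in_prob_def
  proof (intro allI impI)
    fix \<epsilon> :: real assume \<epsilon>: "\<epsilon> > 0"
    \<comment> \<open>Half of the error probability goes to the deviation bound and half to the
      event on which the estimator is the penalised minimum; the cap keeps it in the range that the
      deviation bound accepts.\<close>
    define \<epsilon>' where "\<epsilon>' = min (\<epsilon> / 2) 1"
    have \<epsilon>': "\<epsilon>' > 0" "\<epsilon>' \<le> 1" "\<epsilon>' \<le> \<epsilon> / 2" using \<epsilon> by (auto simp: \<epsilon>'_def)
    obtain K where K: "\<And>n x. n \<ge> 1 \<Longrightarrow> 0 < x \<Longrightarrow> x \<le> 1 \<Longrightarrow> \<exists>A\<in>sets P. measure P A \<ge> 1 - \<epsilon>' \<and>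
      (\<forall>\<omega>\<in>A. \<forall>v\<in>S. (\<forall>d\<in>S. \<forall>t\<in>{0..1}. G.pen n x \<tau>0 (\<lambda>i. X i \<omega>) (d + t *\<^sub>R (v - d)) \<le> G.pen n x \<tau>0 (\<lambda>i. X i \<omega>) d) \<longrightarrow>
         q v + x * j v v \<le> K * (w x / real n + x))"
      using G.deviation_bound[OF prob iid(1) X b.sets_Q C\<rho> w1 dim cut \<epsilon>'(1,2), of \<tau>0] by blast
    have "eventually (\<lambda>n. measure P (Ev n) > 1 - \<epsilon> / 2) sequentially"
      using Ev(2) \<epsilon> by (intro order_tendstoD(1)) auto
    moreover have "eventually (\<lambda>n. l n < 1) sequentially"
      using lambda(2) by (intro order_tendstoD(2)) auto
    moreover have "eventually (\<lambda>n. n \<ge> 1) sequentially" by (rule eventually_ge_at_top)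
    ultimately have "eventually (\<lambda>n. \<exists>A\<in>sets P. measure P A \<ge> 1 - \<epsilon> \<and>
      (\<forall>\<omega>\<in>A. \<bar>SKL M \<eta> \<tau>0 (\<tau>hat n \<omega>)\<bar> \<le> 4 * \<kappa> * G.CY * K * (1 / real n * l n powr (- 1 / r) + l n))) sequentially"
    proof eventually_elim
      case (elim n)
      obtain A where A: "A \<in> sets P" "measure P A \<ge> 1 - \<epsilon>'"
        and Abound: "\<And>\<omega> v. \<omega> \<in> A \<Longrightarrow> v \<in> S \<Longrightarrow>
          (\<forall>d\<in>S. \<forall>t\<in>{0..1}. G.pen n (l n) \<tau>0 (\<lambda>i. X i \<omega>) (d + t *\<^sub>R (v - d)) \<le> G.pen n (l n) \<tau>0 (\<lambda>i. X i \<omega>) d) \<Longrightarrow>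
          q v + l n * j v v \<le> K * (w (l n) / real n + l n)"
        using K[of n "l n"] elim lambda(1)[of n] by auto
      have AE': "A \<inter> Ev n \<in> sets P" using A Ev by auto
      have "measure P A \<le> measure P ((A \<inter> Ev n) \<union> (space P - Ev n))"
        using A Ev(1)[of n] sets.sets_into_space[OF A(1)] by (intro P.finite_measure_mono) auto
      also have "\<dots> \<le> measure P (A \<inter> Ev n) + measure P (space P - Ev n)"
        using AE' Ev(1)[of n] by (intro measure_Un_le) auto
      also have "measure P (space P - Ev n) = 1 - measure P (Ev n)" by (rule P.prob_compl[OF Ev(1)])
      finally have "measure P (A \<inter> Ev n) \<ge> 1 - \<epsilon>" using A(2) elim(1) \<epsilon>' by linarith
      then obtain A' where A': "A' \<in> sets P" "A' \<subseteq> A \<inter> Ev n" "measure P A' \<ge> 1 - \<epsilon>"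
        and cvx: "\<And>\<omega>. \<omega> \<in> A' \<Longrightarrow> convex_on UNIV (crit M \<eta> n (\<lambda>i. X i \<omega>))"
        by (rule P.prob_ge_AE[OF AE' _ convex[OF elim(3)]]) (rule that)
      show ?case
      proof (rule bexI[OF _ A'(1)], intro conjI A'(3) ballI)
        fix \<omega> assume \<omega>: "\<omega> \<in> A'"
        define v where "v = \<tau>hat n \<omega> - \<tau>0"
        have hat: "\<tau>hat n \<omega> = \<tau>0 + v" by (simp add: v_def)
        let ?F = "pen_crit M \<eta> J (l n) n (\<lambda>i. X i \<omega>)"
        have min: "unique_penalized_min ?F N (\<tau>0 + v)" using Ev_min[of \<omega> n] \<omega> A'(2) by (auto simp: hat)
        have vS: "v \<in> S" using min by (simp add: unique_penalized_min_def S_def)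
        have "convex_on UNIV (\<lambda>\<tau>. crit M \<eta> n (\<lambda>i. X i \<omega>) \<tau> + l n / 2 * j \<tau> \<tau>)"
          using cvx[OF \<omega>] lambda(1)[of n] by (intro convex_on_add convex_on_cmul j.convex_diagonal) auto
        hence Fc: "convex_on UNIV ?F" unfolding pen_crit_def[abs_def] j_def .
        \<comment> \<open>Convexity on the whole space makes the local minimum global; convexity
          along segments then keeps the criterion from rising between any point and the
          estimator.\<close>
        have "local_min ?F (\<tau>0 + v)" using min by (auto simp: unique_penalized_min_def)
        hence Fmin: "?F (\<tau>0 + v) \<le> ?F \<tau>" for \<tau> by (rule convex_local_min_global[OF Fc])
        have penF: "G.pen n (l n) \<tau>0 (\<lambda>i. X i \<omega>) d = ?F (\<tau>0 + d) - crit M \<eta> n (\<lambda>i. X i \<omega>) \<tau>0" for d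
          using b.crit_eq[OF elim(3), of "\<lambda>i. X i \<omega>" d] by (simp add: G.pen_def pen_crit_def j_def)
        have "G.pen n (l n) \<tau>0 (\<lambda>i. X i \<omega>) (d + t *\<^sub>R (v - d)) \<le> G.pen n (l n) \<tau>0 (\<lambda>i. X i \<omega>) d"
          if t: "t \<in> {0..1}" for d t
        proof -
          have "?F ((1 - t) *\<^sub>R (\<tau>0 + d) + t *\<^sub>R (\<tau>0 + v)) \<le> (1 - t) * ?F (\<tau>0 + d) + t * ?F (\<tau>0 + v)"
            using t by (intro convex_onD[OF Fc]) auto
          also have "\<dots> \<le> (1 - t) * ?F (\<tau>0 + d) + t * ?F (\<tau>0 + d)"
            using t Fmin by (intro add_left_mono mult_left_mono) auto
          also have "(1 - t) *\<^sub>R (\<tau>0 + d) + t *\<^sub>R (\<tau>0 + v) = \<tau>0 + (d + t *\<^sub>R (v - d))"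
            by (simp add: scaleR_add_right scaleR_diff_left scaleR_diff_right)
          finally show ?thesis unfolding penF by (simp add: algebra_simps)
        qed
        hence "q v + l n * j v v \<le> K * (w (l n) / real n + l n)"
          using \<omega> A'(2) by (intro Abound vS) auto
        moreover have "l n * j v v \<ge> 0" using lambda(1)[of n] j.pos[of v] by simp
        ultimately have qv: "q v \<le> K * (w (l n) / real n + l n)" by linarith
        have "\<bar>SKL M \<eta> \<tau>0 (\<tau>hat n \<omega>)\<bar> \<le> 4 * \<kappa> * G.CY * q v"
          unfolding hat b.skl_eq by (rule G.skl_le[OF vS])
        also have "\<dots> \<le> 4 * \<kappa> * G.CY * (K * (w (l n) / real n + l n))"
          using \<kappa>(1) G.CY qv by (intro mult_left_mono) auto
        finally show "\<bar>SKL M \<eta> \<tau>0 (\<tau>hat n \<omega>)\<bar> \<le> 4 * \<kappa> * G.CY * K * (1 / real n * l n powr (- 1 / r) + l n)"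
          by (simp add: w_def mult_ac)
      qed
    qed
    thus "\<exists>C. \<forall>\<^sub>F n in sequentially. \<exists>A\<in>sets P. measure P A \<ge> 1 - \<epsilon> \<and>
      (\<forall>\<omega>\<in>A. \<bar>SKL M \<eta> \<tau>0 (\<tau>hat n \<omega>)\<bar> \<le> C * (1 / real n * l n powr (- 1 / r) + l n))" by blast
  qed
qed

end
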